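(* Let $\alpha\in(0,2)$ and let $\mathfrak{L}=\mathcal{L}^\mu$ where $\mu$ is a nonnegative symmetric Radon measure on $\mathbb{R}^N\setminus\{0\}$ with $\int_{|z|\le1}|z|^2d\mu(z)+\int_{|z|>1}d\mu(z)<\infty$. Consider the following statements: (i) There exist constants $C,c>0$ such that $$\frac{c}{|z|^{N+\alpha}}\le\frac{d\mu}{dz}(z)\le\frac{C}{|z|^{N+\alpha}}.$$ (ii) There exists a constant $C>0$ such that $$\mathbb{H}_{-\mathcal{L}^\mu}^{x_0}(x,t)\le C\min\big\{t^{-\frac N\alpha},\,t|x-x_0|^{-(N+\alpha)}\big\}.$$ (iii) There exists a constant $C>0$ such that $$\mathbb{G}_{-\mathcal{L}^\mu}^{x_0}(x)\le C|x-x_0|^{-(N-\alpha)}.$$ Then (i) implies (ii), and (ii) implies (iii).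
   Context: Throughout $N\ge3$. $\mathcal{L}^\mu[\psi](x):=P.V.\int_{\mathbb{R}^N\setminus\{0\}}(\psi(x+z)-\psi(x))\,d\mu(z)$ for $\psi\in C_{\rm c}^\infty(\mathbb{R}^N)$, $\frac{d\mu}{dz}$ being the density of $\mu$ with respect to Lebesgue measure. $\mathbb{H}_{-\mathcal{L}^\mu}^{x_0}(x,t)=\mathbb{H}_{-\mathcal{L}^\mu}^{0}(x-x_0,t)$ denotes the heat kernel, i.e. the kernel of the solution semigroup of $\partial_tu+(-\mathcal{L}^\mu)[u]=0$ (initial data $\delta_{x_0}$), and the Green function is $\mathbb{G}_{-\mathcal{L}^\mu}^{x_0}(x)=\int_0^\infty\mathbb{H}_{-\mathcal{L}^\mu}^{x_0}(x,t)\,dt$. *)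

theory Defs
  imports "HOL-Analysis.Analysis"
begin

primrec Ck :: "nat \<Rightarrow> ('a::euclidean_space \<Rightarrow> real) \<Rightarrow> bool" where
  "Ck 0 f \<longleftrightarrow> continuous_on UNIV f"
| "Ck (Suc k) f \<longleftrightarrow>
     (\<forall>x. f differentiable (at x)) \<and> (\<forall>b\<in>Basis. Ck k (\<lambda>x. frechet_derivative f (at x) b))"

definition test_function :: "('a::euclidean_space \<Rightarrow> real) \<Rightarrow> bool" where
  "test_function f \<longleftrightarrow> (\<forall>k. Ck k f) \<and> compact (closure {x. f x \<noteq> 0})"

(* A measure on R^N - {0} is represented by a Borel measure on the whole space without mass
   at 0.  The integrability condition makes it finite on compact subsets of R^N - {0}, hence a
   Radon measure there. *)
definition symmetric_levy_measure :: "'a::euclidean_space measure \<Rightarrow> bool" where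
  "symmetric_levy_measure \<mu> \<longleftrightarrow>
     sets \<mu> = sets borel \<and> emeasure \<mu> {0} = 0 \<and>
     (\<forall>A\<in>sets borel. emeasure \<mu> (uminus ` A) = emeasure \<mu> A) \<and>
     (\<integral>\<^sup>+z\<in>{z. norm z \<le> 1}. ennreal ((norm z)\<^sup>2) \<partial>\<mu>) + (\<integral>\<^sup>+z\<in>{z. norm z > 1}. 1 \<partial>\<mu>) < \<infinity>"

definition levy_operator :: "'a::euclidean_space measure \<Rightarrow> ('a \<Rightarrow> real) \<Rightarrow> 'a \<Rightarrow> real" where
  "levy_operator \<mu> \<psi> x =
     Lim (at_right 0) (\<lambda>\<epsilon>. LINT z:{z. norm z > \<epsilon>}|\<mu>. (\<psi> (x + z) - \<psi> x))"

(* u solves du/dt = L[u] for t > 0 with initial datum the Dirac mass at x0, in the sense of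
   distributions (L is symmetric, so it can be moved onto the test function).  Within this class
   of solutions, bounded in L^1 uniformly in time, u(.,t) is unique up to null sets for every
   t > 0.  The values of u at times t <= 0 are irrelevant. *)
definition fundamental_solution ::
  "'a::euclidean_space measure \<Rightarrow> 'a \<Rightarrow> ('a \<Rightarrow> real \<Rightarrow> real) \<Rightarrow> bool" where
  "fundamental_solution \<mu> x0 u \<longleftrightarrow>
     (\<lambda>(x, t). u x t) \<in> borel_measurable (borel \<Otimes>\<^sub>M restrict_space borel {0<..}) \<and>
     (\<forall>x. \<forall>t>0. 0 \<le> u x t) \<and>
     (\<exists>M. \<forall>t>0. integrable lborel (\<lambda>x. u x t) \<and> (LINT x|lborel. u x t) \<le> M) \<and>
     (\<forall>\<psi>. test_function \<psi> \<longrightarrow> (\<forall>t>0.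
        (LINT x|lborel. u x t * \<psi> x) =
          \<psi> x0 + (LINT s:{0<..<t}|lborel. (LINT x|lborel. u x s * levy_operator \<mu> \<psi> x))))"

(* H x0 x t is the value at (x,t) of the heat kernel with pole x0.  In general the solution
   semigroup of a Levy operator has only a measure as kernel; this predicate expresses that
   the kernel is a function, and determines H up to null sets in x for each t > 0. *)
definition heat_kernel ::
  "'a::euclidean_space measure \<Rightarrow> ('a \<Rightarrow> 'a \<Rightarrow> real \<Rightarrow> real) \<Rightarrow> bool" where
  "heat_kernel \<mu> H \<longleftrightarrow>
     (\<forall>x0. fundamental_solution \<mu> x0 (H x0)) \<and>
     (\<forall>x0 x. \<forall>t>0. H x0 x t = H 0 (x - x0) t)"

definition green_function :: "('a \<Rightarrow> 'a \<Rightarrow> real \<Rightarrow> real) \<Rightarrow> 'a \<Rightarrow> 'a \<Rightarrow> ennreal" where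
  "green_function H x0 x = (\<integral>\<^sup>+t\<in>{0<..}. ennreal (H x0 x t) \<partial>lborel)"

definition density_comparable :: "real \<Rightarrow> 'a::euclidean_space measure \<Rightarrow> bool" where
  "density_comparable \<alpha> \<mu> \<longleftrightarrow>
     (\<exists>f\<in>borel_measurable borel. \<mu> = density lborel (\<lambda>z. ennreal (f z)) \<and>
       (\<exists>C>0. \<exists>c>0. AE z in lborel.
          c / norm z powr (real DIM('a) + \<alpha>) \<le> f z \<and>
          f z \<le> C / norm z powr (real DIM('a) + \<alpha>)))"

(* In the next two definitions the bounds are required for almost every x, since heat kernels
   are determined only up to null sets.  The null set {x0}, where the conventions 0 powr a = 0
   and 1/0 = 0 would distort the right-hand sides, is thereby irrelevant. *)
definition heat_kernel_bound :: "real \<Rightarrow> 'a::euclidean_space measure \<Rightarrow> bool" where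
  "heat_kernel_bound \<alpha> \<mu> \<longleftrightarrow>
     (\<exists>H. heat_kernel \<mu> H) \<and>
     (\<forall>H. heat_kernel \<mu> H \<longrightarrow>
       (\<exists>C>0. \<forall>x0. \<forall>t>0. AE x in lborel.
          H x0 x t \<le> C * min (t powr (- (real DIM('a) / \<alpha>)))
                              (t * norm (x - x0) powr (- (real DIM('a) + \<alpha>)))))"

definition green_function_bound :: "real \<Rightarrow> 'a::euclidean_space measure \<Rightarrow> bool" where
  "green_function_bound \<alpha> \<mu> \<longleftrightarrow>
     (\<exists>H. heat_kernel \<mu> H) \<and>
     (\<forall>H. heat_kernel \<mu> H \<longrightarrow>
       (\<exists>C>0. \<forall>x0. AE x in lborel.
          green_function H x0 x \<le> ennreal (C * norm (x - x0) powr (- (real DIM('a) - \<alpha>)))))"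

end

theory Submission
  imports Defs
begin

text \<open>
  Why the bounds hold. Let \<open>f\<close> be a symmetric jump density comparable to \<open>|z| powr (- (N + \<alpha>))\<close>. Cutting
  off the jumps of size at most \<open>\<epsilon>\<close> leaves a finite jump measure, whose semigroup is the exponential of a
  bounded operator on bounded continuous functions. Everything is done with these compound Poisson
  semigroups, uniformly in \<open>\<epsilon>\<close>; neither Fourier transforms nor the construction of a jump process
  are needed.

  Weak solutions. Convolving a weak solution with a test function gives a path in the Banach space of
  bounded continuous functions that solves the equation with truncated generator up to an error
  \<open>O(\<integral>\<^bsub>|z| \<le> \<epsilon>\<^esub> |z|\<^sup>2 f)\<close>, and the contraction property of the semigroup turns this into an error of the
  same size for the solution (\<open>cps_duhamel\<close>, \<open>fundamental_solution_approx\<close>). Hence a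
  fundamental solution, tested against \<open>\<psi>\<close>, is the limit of the truncated semigroups applied to \<open>\<psi>\<close>.
  This is uniqueness, and it transfers every bound that is uniform in \<open>\<epsilon>\<close> to every heat kernel.

  Regularisation. Below the size \<open>r\<close>, each dyadic annulus of jumps contains a multiple of a \<open>C\<^sup>1\<^sup>,\<^sup>1\<close> bump.
  Adding the annuli from the largest to the smallest, the law splits into a regular density \<open>Qs\<close>, carried by
  the event that a bump jump has occurred, and a remainder whose mass \<open>Am\<close> tends to zero
  (locale \<open>scale_scheme\<close>, lemma \<open>decomp\<close>). The \<open>n\<close>-th annulus contributes to the density at most \<open>Am\<close> times
  \<open>const * (r / 2 ^ n) powr (- N)\<close>, and \<open>Am\<close> is doubly exponentially small in \<open>n\<close>, so that the sum converges. With
  \<open>r = t powr (1 / \<alpha>)\<close> it is at most a multiple of \<open>t powr (- N / \<alpha>)\<close>, which is the on-diagonal bound.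

  Off the diagonal, jumps larger than a small multiple \<open>\<rho>\<close> of the distance \<open>R\<close> contribute at most \<open>t\<close> times the
  supremum of their density, which is the claimed order (\<open>cps_bounded_density\<close>). For the
  remaining jumps the estimate of \<open>Qs\<close> is run with the exponential weight \<open>exp (l \<bullet> y)\<close>, where
  \<open>|l| \<rho>\<close> is half the logarithm of \<open>\<rho> powr \<alpha> / t\<close> (\<open>regular_density_bound\<close>, \<open>heat_kernel_bounds\<close>).

  Existence. For \<open>r = 1\<close> the densities \<open>Qs\<close> converge uniformly, because adding an annulus changes a
  \<open>C\<^sup>1\<^sup>,\<^sup>1\<close> function by at most a multiple of the second moment of the annulus, and what is added to the
  regular part is summable. The limit is a heat kernel
  (\<open>heat_kernel_exists\<close>).

  The Green function bound is the integral of the heat kernel bound over time, split at \<open>R powr \<alpha>\<close>.\<close>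

section \<open>The Banach algebra of bounded operators on bounded continuous functions\<close>

text \<open>The bounded operators form a type of their own, so that the type class machinery of Banach
  algebras, in particular the exponential, applies to them.\<close>
typedef (overloaded) 'a cop =
  "UNIV :: (('a::euclidean_space \<Rightarrow>\<^sub>C real) \<Rightarrow>\<^sub>L ('a \<Rightarrow>\<^sub>C real)) set"
  morphisms blin_of Cop by auto

setup_lifting type_definition_cop

text \<open>Application of an operator to a function.\<close>
lift_definition ap :: "'a::euclidean_space cop \<Rightarrow> ('a \<Rightarrow>\<^sub>C real) \<Rightarrow> ('a \<Rightarrow>\<^sub>C real)"
  is blinfun_apply .

instantiation cop :: (euclidean_space) real_vector
begin

lift_definition zero_cop :: "'a cop" is 0 .
lift_definition plus_cop :: "'a cop \<Rightarrow> 'a cop \<Rightarrow> 'a cop" is "(+)" .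
lift_definition minus_cop :: "'a cop \<Rightarrow> 'a cop \<Rightarrow> 'a cop" is "(-)" .
lift_definition uminus_cop :: "'a cop \<Rightarrow> 'a cop" is "uminus" .
lift_definition scaleR_cop :: "real \<Rightarrow> 'a cop \<Rightarrow> 'a cop" is "scaleR" .

instance
  by standard (transfer, simp add: algebra_simps scaleR_add_right scaleR_add_left)+

end

instantiation cop :: (euclidean_space) real_normed_vector
begin

lift_definition norm_cop :: "'a cop \<Rightarrow> real" is norm .
lift_definition dist_cop :: "'a cop \<Rightarrow> 'a cop \<Rightarrow> real" is dist .
lift_definition sgn_cop :: "'a cop \<Rightarrow> 'a cop" is sgn .
definition uniformity_cop :: "('a cop \<times> 'a cop) filter" where
  "uniformity_cop = (INF e\<in>{0 <..}. principal {(x, y). dist x y < e})"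
definition open_cop :: "'a cop set \<Rightarrow> bool" where
  "open_cop U = (\<forall>x\<in>U. \<forall>\<^sub>F (x', y) in uniformity. x' = x \<longrightarrow> y \<in> U)"

instance
proof
  fix x y :: "'a cop" and a :: real
  show "dist x y = norm (x - y)" by transfer (simp add: dist_norm)
  show "sgn x = x /\<^sub>R norm x" by transfer (simp add: sgn_div_norm)
  show "(norm x = 0) = (x = 0)" by transfer simp
  show "norm (x + y) \<le> norm x + norm y" by transfer (rule norm_triangle_ineq)
  show "norm (a *\<^sub>R x) = \<bar>a\<bar> * norm x" by transfer simp
qed (rule uniformity_cop_def open_cop_def)+

end

instantiation cop :: (euclidean_space) real_normed_algebra_1
begin

lift_definition one_cop :: "'a cop" is id_blinfun .
lift_definition times_cop :: "'a cop \<Rightarrow> 'a cop \<Rightarrow> 'a cop" is "(o\<^sub>L)" .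

instance
proof
  fix x y z :: "'a cop" and a :: real
  show "x * y * z = x * (y * z)" by transfer (rule blinfun_eqI, simp)
  show "(x + y) * z = x * z + y * z"
    by transfer (rule blinfun_eqI, simp add: blinfun.add_left)
  show "x * (y + z) = x * y + x * z"
    by transfer (rule blinfun_eqI, simp add: blinfun.add_left blinfun.add_right)
  show "a *\<^sub>R x * y = a *\<^sub>R (x * y)"
    by transfer (rule blinfun_eqI, simp add: blinfun.scaleR_left)
  show "x * a *\<^sub>R y = a *\<^sub>R (x * y)"
    by transfer (rule blinfun_eqI, simp add: blinfun.scaleR_left blinfun.scaleR_right)
  show "1 * x = x" by transfer (rule blinfun_eqI, simp)
  show "x * 1 = x" by transfer (rule blinfun_eqI, simp)
  show "norm (x * y) \<le> norm x * norm y" by transfer (rule norm_blinfun_compose)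
  let ?u = "const_bcontfun 1 :: 'a \<Rightarrow>\<^sub>C real"
  have u: "?u \<noteq> 0"
  proof
    assume "?u = 0"
    then have "apply_bcontfun ?u 0 = apply_bcontfun (0 :: 'a \<Rightarrow>\<^sub>C real) 0" by (simp only:)
    then show False by (simp add: const_bcontfun.rep_eq zero_bcontfun.rep_eq)
  qed
  have "norm (id_blinfun :: ('a \<Rightarrow>\<^sub>C real) \<Rightarrow>\<^sub>L ('a \<Rightarrow>\<^sub>C real)) = 1"
    by (rule norm_blinfun_eqI[where x = ?u]) (use u in auto)
  then show "norm (1::'a cop) = 1" by transfer
  show "(0::'a cop) \<noteq> 1"
  proof
    assume "(0::'a cop) = 1"
    then have "norm (1::'a cop) = norm (0::'a cop)" by (simp only:)
    with \<open>norm (1::'a cop) = 1\<close> show False by simp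
  qed
qed

end

instance bcontfun :: (metric_space, banach) banach ..

instance cop :: (euclidean_space) banach
proof
  fix X :: "nat \<Rightarrow> 'a cop"
  assume "Cauchy X"
  then have "Cauchy (\<lambda>n. blin_of (X n))"
    by (simp add: Cauchy_def dist_cop.rep_eq)
  then have "convergent (\<lambda>n. blin_of (X n))" by (rule Cauchy_convergent)
  then obtain L where "(\<lambda>n. blin_of (X n)) \<longlonglongrightarrow> L"
    unfolding convergent_def by (elim exE)
  then have "X \<longlonglongrightarrow> Cop L"
    by (simp add: tendsto_iff dist_cop.rep_eq Cop_inverse)
  then show "convergent X" by (auto simp: convergent_def)
qed

lemma cop_eqI: "(\<And>\<phi>. ap S \<phi> = ap T \<phi>) \<Longrightarrow> S = T"
  by transfer (rule blinfun_eqI)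

lemma ap_bilinear: "bounded_bilinear ap"
proof
  fix S T :: "'a cop" and f g :: "'a \<Rightarrow>\<^sub>C real" and r :: real
  show "ap (S + T) f = ap S f + ap T f" by transfer (simp add: blinfun.bilinear_simps)
  show "ap S (f + g) = ap S f + ap S g" by transfer (simp add: blinfun.bilinear_simps)
  show "ap (r *\<^sub>R S) f = r *\<^sub>R ap S f" by transfer (simp add: blinfun.bilinear_simps)
  show "ap S (r *\<^sub>R f) = r *\<^sub>R ap S f" by transfer (simp add: blinfun.bilinear_simps)
  show "\<exists>K. \<forall>a b. norm (ap (a::'a cop) b) \<le> norm a * norm b * K"
    by (rule exI[of _ 1], transfer) (simp add: norm_blinfun)
qed

interpretation ap: bounded_bilinear ap by (rule ap_bilinear)

lemma norm_ap: "norm (ap S \<phi>) \<le> norm S * norm \<phi>"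
  by transfer (rule norm_blinfun)

lemma ap_one [simp]: "ap 1 \<phi> = \<phi>" by transfer simp
lemma ap_mult: "ap (S * T) \<phi> = ap S (ap T \<phi>)" by transfer simp

lemma norm_cop_le: "0 \<le> b \<Longrightarrow> (\<And>\<phi>. norm (ap S \<phi>) \<le> b * norm \<phi>) \<Longrightarrow> norm S \<le> b"
  by transfer (rule norm_blinfun_bound)

text \<open>The operator with a given underlying map, which is meaningful only for bounded linear maps.\<close>
lift_definition cop_of :: "(('a::euclidean_space \<Rightarrow>\<^sub>C real) \<Rightarrow> ('a \<Rightarrow>\<^sub>C real)) \<Rightarrow> 'a cop"
  is Blinfun .

lemma ap_cop_of: "bounded_linear F \<Longrightarrow> ap (cop_of F) = F"
  by transfer (rule bounded_linear_Blinfun_apply)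

lemma abs_apply_le_norm: "\<bar>apply_bcontfun \<phi> x\<bar> \<le> norm \<phi>" for \<phi> :: "'a::euclidean_space \<Rightarrow>\<^sub>C real"
  using norm_bounded[of \<phi> x] by simp

lemma apply_bounded_linear: "bounded_linear (\<lambda>\<phi>. apply_bcontfun \<phi> x)"
  for x :: "'a::euclidean_space" and z :: real
  by (rule bounded_linear_intro[where K=1])
     (auto simp: plus_bcontfun.rep_eq scaleR_bcontfun.rep_eq norm_bounded abs_apply_le_norm)

lemma tendsto_apply_bcontfun:
  assumes "(F \<longlongrightarrow> \<phi>) G"
  shows "((\<lambda>n. apply_bcontfun (F n) x) \<longlongrightarrow> apply_bcontfun (\<phi> :: 'a::euclidean_space \<Rightarrow>\<^sub>C real) x) G"
  by (rule bounded_linear.tendsto[OF apply_bounded_linear assms])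

lemma sums_apply:
  assumes "S sums (T :: 'a::euclidean_space cop)"
  shows "(\<lambda>n. apply_bcontfun (ap (S n) \<phi>) x) sums apply_bcontfun (ap T \<phi>) x"
  using bounded_linear.sums[OF bounded_linear_compose[OF apply_bounded_linear ap.bounded_linear_left]] assms by blast

lemma apply_scaleR [simp]: "apply_bcontfun (c *\<^sub>R \<phi>) x = c * apply_bcontfun \<phi> x"
  for \<phi> :: "'a::euclidean_space \<Rightarrow>\<^sub>C real" by (simp add: scaleR_bcontfun.rep_eq)

section \<open>Lebesgue integrals under affine maps\<close>

lemma borel_measurable_bcontfun [measurable]:
  "apply_bcontfun (\<phi> :: 'a::euclidean_space \<Rightarrow>\<^sub>C real) \<in> borel_measurable borel"
  by (rule borel_measurable_continuous_onI) simp

lemma nn_integral_lborel_affine: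
  fixes f :: "'a::euclidean_space \<Rightarrow> ennreal"
  assumes [measurable]: "f \<in> borel_measurable borel" and "c \<noteq> 0"
  shows "(\<integral>\<^sup>+x. f x \<partial>lborel) = ennreal (\<bar>c\<bar> ^ DIM('a)) * (\<integral>\<^sup>+x. f (t + c *\<^sub>R x) \<partial>lborel)"
  by (subst lborel_affine[OF \<open>c \<noteq> 0\<close>, of t])
     (simp add: nn_integral_density nn_integral_distr nn_integral_cmult ennreal_power)

lemma has_bochner_integral_lborel_affine:
  fixes f :: "'a::euclidean_space \<Rightarrow> real"
  assumes [measurable]: "f \<in> borel_measurable borel" and "c \<noteq> 0"
  shows "integrable lborel (\<lambda>x. f (t + c *\<^sub>R x)) \<longleftrightarrow> integrable lborel f"
    and "(LINT x|lborel. f x) = \<bar>c\<bar> ^ DIM('a) * (LINT x|lborel. f (t + c *\<^sub>R x))"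
  by (subst (2) lborel_affine[OF \<open>c \<noteq> 0\<close>, of t], simp add: integrable_density integrable_distr_eq \<open>c \<noteq> 0\<close>)
     (subst lborel_affine[OF \<open>c \<noteq> 0\<close>, of t], simp add: integral_density integral_distr)

lemma integral_lborel_translate:
  fixes f :: "'a::euclidean_space \<Rightarrow> real"
  assumes "f \<in> borel_measurable borel"
  shows "integrable lborel (\<lambda>x. f (x + t)) \<longleftrightarrow> integrable lborel f"
    and "(LINT x|lborel. f (x + t)) = (LINT x|lborel. f x)"
  using has_bochner_integral_lborel_affine[OF assms, of 1 t] by (simp_all add: add.commute)

lemma integral_lborel_reflect:
  fixes f :: "'a::euclidean_space \<Rightarrow> real"
  assumes "f \<in> borel_measurable borel"
  shows "integrable lborel (\<lambda>x. f (- x)) \<longleftrightarrow> integrable lborel f"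
    and "(LINT x|lborel. f (- x)) = (LINT x|lborel. f x)"
  using has_bochner_integral_lborel_affine[OF assms, of "-1" 0] by simp_all

section \<open>Convolution operators\<close>

text \<open>The operator \<open>\<phi> \<mapsto> (\<lambda>x. \<integral> g z * \<phi> (x + z) dz)\<close> for an integrable kernel \<open>g\<close>; for symmetric \<open>g\<close> it is
  convolution with \<open>g\<close>.\<close>
definition conv_op :: "('a::euclidean_space \<Rightarrow> real) \<Rightarrow> 'a cop" where
  "conv_op g = cop_of (\<lambda>\<phi>. Bcontfun (\<lambda>x. LINT z|lborel. g z * apply_bcontfun \<phi> (x + z)))"

text \<open>Translation by \<open>z\<close>.\<close>
definition shift_op :: "'a::euclidean_space \<Rightarrow> 'a cop" where
  "shift_op z = cop_of (\<lambda>\<phi>. Bcontfun (\<lambda>x. apply_bcontfun \<phi> (x + z)))"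

lemma integrable_mult_bcontfun:
  fixes \<phi> :: "'a::euclidean_space \<Rightarrow>\<^sub>C real"
  assumes [measurable]: "integrable lborel g"
  shows "integrable lborel (\<lambda>z. g z * \<phi> (x + z))"
proof (rule Bochner_Integration.integrable_bound)
  show "integrable lborel (\<lambda>z. norm \<phi> * g z)" using assms by simp
  show "AE z in lborel. norm (g z * \<phi> (x + z)) \<le> norm (norm \<phi> * g z)"
  proof (rule AE_I2)
    fix z show "norm (g z * \<phi> (x + z)) \<le> norm (norm \<phi> * g z)"
      using mult_left_mono[OF abs_apply_le_norm[of \<phi> "x + z"], of "\<bar>g z\<bar>"]
      by (simp add: abs_mult mult.commute)
  qed
qed simp

lemma integrable_mult_bcontfun_abs:
  fixes \<phi> :: "'a::euclidean_space \<Rightarrow>\<^sub>C real"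
  assumes "integrable lborel g"
  shows "integrable lborel (\<lambda>z. \<bar>g z\<bar> * \<bar>\<phi> (x + z)\<bar>)"
  using integrable_abs[OF integrable_mult_bcontfun[OF assms, of \<phi> x]] by (simp add: abs_mult)

lemma integrable_mult_bcontfun':
  fixes \<phi> :: "'a::euclidean_space \<Rightarrow>\<^sub>C real"
  assumes "integrable lborel g"
  shows "integrable lborel (\<lambda>z. g z * \<phi> z)" "integrable lborel (\<lambda>z. \<phi> z * g z)"
  using integrable_mult_bcontfun[OF assms, of \<phi> 0] by (simp_all add: mult.commute)

lemma conv_bcontfun:
  fixes \<phi> :: "'a::euclidean_space \<Rightarrow>\<^sub>C real"
  assumes g[measurable]: "integrable lborel g"
  shows "(\<lambda>x. LINT z|lborel. g z * \<phi> (x + z)) \<in> bcontfun"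
    and "\<bar>LINT z|lborel. g z * \<phi> (x + z)\<bar> \<le> (LINT z|lborel. \<bar>g z\<bar>) * norm \<phi>"
proof -
  have bd: "\<bar>LINT z|lborel. g z * \<phi> (x + z)\<bar> \<le> (LINT z|lborel. \<bar>g z\<bar>) * norm \<phi>" for x
  proof -
    have "\<bar>LINT z|lborel. g z * \<phi> (x + z)\<bar> \<le> (LINT z|lborel. \<bar>g z * \<phi> (x + z)\<bar>)"
      by (rule integral_abs_bound)
    also have "\<dots> \<le> (LINT z|lborel. \<bar>g z\<bar> * norm \<phi>)"
      by (rule integral_mono) (auto simp: abs_mult g intro!: integrable_mult_bcontfun_abs[OF g] mult_left_mono abs_apply_le_norm)
    finally show ?thesis by simp
  qed
  then show "\<bar>LINT z|lborel. g z * \<phi> (x + z)\<bar> \<le> (LINT z|lborel. \<bar>g z\<bar>) * norm \<phi>" .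
  have "continuous_on UNIV (\<lambda>x. LINT z|lborel. g z * \<phi> (x + z))"
  proof (rule continuous_on_sequentiallyI)
    fix u and a :: 'a assume u: "u \<longlonglongrightarrow> a"
    show "(\<lambda>n. LINT z|lborel. g z * \<phi> (u n + z)) \<longlonglongrightarrow> (LINT z|lborel. g z * \<phi> (a + z))"
    proof (rule integral_dominated_convergence[where w = "\<lambda>z. \<bar>g z\<bar> * norm \<phi>"])
      show "AE z in lborel. (\<lambda>n. g z * \<phi> (u n + z)) \<longlonglongrightarrow> g z * \<phi> (a + z)"
        using u by (auto intro!: tendsto_intros continuous_on_tendsto_compose[of UNIV "apply_bcontfun \<phi>"])
      show "AE z in lborel. norm (g z * \<phi> (u n + z)) \<le> \<bar>g z\<bar> * norm \<phi>" for n
        by (auto simp: abs_mult intro!: mult_left_mono abs_apply_le_norm)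
    qed (use g in auto)
  qed
  then show "(\<lambda>x. LINT z|lborel. g z * \<phi> (x + z)) \<in> bcontfun"
    by (rule bcontfun_normI[where b = "(LINT z|lborel. \<bar>g z\<bar>) * norm \<phi>"]) (use bd in auto)
qed

lemma conv_op:
  fixes \<phi> :: "'a::euclidean_space \<Rightarrow>\<^sub>C real"
  assumes g: "integrable lborel g"
  shows conv_op_apply: "ap (conv_op g) \<phi> x = (LINT z|lborel. g z * \<phi> (x + z))"
    and norm_conv_op: "norm (conv_op g) \<le> (LINT z|lborel. \<bar>g z\<bar>)"
proof -
  let ?F = "\<lambda>\<phi> :: 'a \<Rightarrow>\<^sub>C real. Bcontfun (\<lambda>x. LINT z|lborel. g z * \<phi> (x + z))"
  note F = Bcontfun_inverse[OF conv_bcontfun(1)[OF g]]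
  have nF: "norm (?F \<phi>) \<le> (LINT z|lborel. \<bar>g z\<bar>) * norm \<phi>" for \<phi>
    by (rule norm_bound) (simp add: F conv_bcontfun(2)[OF g])
  have "bounded_linear ?F"
  proof (rule bounded_linear_intro)
    show "?F (\<phi> + \<psi>) = ?F \<phi> + ?F \<psi>" for \<phi> \<psi>
      by (rule bcontfun_eqI, simp only: F plus_bcontfun.rep_eq[of "?F \<phi>"])
         (simp add: plus_bcontfun.rep_eq ring_distribs integrable_mult_bcontfun[OF g])
    show "?F (r *\<^sub>R \<phi>) = r *\<^sub>R ?F \<phi>" for r \<phi>
      by (rule bcontfun_eqI, simp only: F apply_scaleR[of _ "?F \<phi>"])
         (simp add: mult.left_commute[of _ r])
    show "norm (?F \<phi>) \<le> norm \<phi> * (LINT z|lborel. \<bar>g z\<bar>)" for \<phi>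
      using nF[of \<phi>] by (simp add: mult.commute)
  qed
  then have ap: "ap (conv_op g) \<phi> = ?F \<phi>" for \<phi> by (simp add: conv_op_def ap_cop_of)
  then show "ap (conv_op g) \<phi> x = (LINT z|lborel. g z * \<phi> (x + z))" by (simp add: F)
  show "norm (conv_op g) \<le> (LINT z|lborel. \<bar>g z\<bar>)"
    by (rule norm_cop_le) (use nF in \<open>simp_all add: ap\<close>)
qed

lemma shift_op_apply [simp]: "ap (shift_op z) \<phi> x = \<phi> (x + z)"
proof -
  have c: "(\<lambda>x. apply_bcontfun \<phi> (x + z)) \<in> bcontfun" for \<phi> :: "'a \<Rightarrow>\<^sub>C real"
    by (rule bcontfun_normI[where b = "norm \<phi>"])
       (auto intro!: continuous_intros continuous_on_compose2[OF continuous_on_apply_bcontfun[of UNIV \<phi>]] abs_apply_le_norm)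
  note F = Bcontfun_inverse[OF c]
  let ?F = "\<lambda>\<phi> :: 'a \<Rightarrow>\<^sub>C real. Bcontfun (\<lambda>x. apply_bcontfun \<phi> (x + z))"
  have "bounded_linear ?F"
  proof (rule bounded_linear_intro)
    show "?F (\<phi> + \<psi>) = ?F \<phi> + ?F \<psi>" for \<phi> \<psi>
      by (rule bcontfun_eqI, simp only: F plus_bcontfun.rep_eq[of "?F \<phi>"]) (simp add: plus_bcontfun.rep_eq)
    show "?F (r *\<^sub>R \<phi>) = r *\<^sub>R ?F \<phi>" for r \<phi>
      by (rule bcontfun_eqI, simp only: F apply_scaleR[of _ "?F \<phi>"]) simp
    show "norm (?F \<phi>) \<le> norm \<phi> * 1" for \<phi>
      by (rule norm_bound) (simp add: F abs_apply_le_norm)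
  qed
  then show ?thesis by (simp add: shift_op_def ap_cop_of F)
qed

lemma norm_shift_op: "norm (shift_op z) \<le> 1"
  by (rule norm_cop_le) (auto intro!: norm_bound abs_apply_le_norm)

lemma conv_op_shift_commute:
  assumes "integrable lborel g"
  shows "conv_op g * shift_op z = shift_op z * conv_op g"
  by (rule cop_eqI, rule bcontfun_eqI) (simp add: ap_mult conv_op_apply[OF assms] ac_simps)

lemma conv_op_add:
  assumes "integrable lborel g" "integrable lborel h"
  shows "conv_op (\<lambda>z. g z + h z) = conv_op g + conv_op h"
  by (rule cop_eqI, rule bcontfun_eqI)
     (simp add: ap.add_left plus_bcontfun.rep_eq conv_op_apply assms ring_distribs integrable_mult_bcontfun)

lemma conv_op_commute:
  fixes g h :: "'a::euclidean_space \<Rightarrow> real"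
  assumes g[measurable]: "integrable lborel g" and h[measurable]: "integrable lborel h"
  shows "conv_op g * conv_op h = conv_op h * conv_op g"
proof (rule cop_eqI, rule bcontfun_eqI)
  fix \<phi> :: "'a \<Rightarrow>\<^sub>C real" and x
  have "integrable (lborel \<Otimes>\<^sub>M lborel) (\<lambda>(z, y). g z * (h y * \<phi> (x + z + y)))"
  proof (rule lborel_pair.Fubini_integrable)
    show "AE z in lborel. integrable lborel (\<lambda>y. case (z, y) of (z, y) \<Rightarrow> g z * (h y * \<phi> (x + z + y)))"
      by (simp add: integrable_mult_bcontfun[OF h])
    have b: "(LINT y|lborel. norm (h y * \<phi> (x + z + y))) \<le> (LINT y|lborel. \<bar>h y\<bar>) * norm \<phi>" for z
      unfolding integral_mult_left_zero[symmetric]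
      by (rule integral_mono) (auto simp: abs_mult h intro!: integrable_mult_bcontfun_abs[OF h] mult_left_mono abs_apply_le_norm)
    show "integrable lborel (\<lambda>z. LINT y|lborel. norm (case (z, y) of (z, y) \<Rightarrow> g z * (h y * \<phi> (x + z + y))))"
      by (rule Bochner_Integration.integrable_bound[where f = "\<lambda>z. \<bar>g z\<bar> * ((LINT y|lborel. \<bar>h y\<bar>) * norm \<phi>)"])
         (use g b in \<open>auto simp: abs_mult intro!: mult_left_mono integral_nonneg_AE\<close>)
  qed simp
  from lborel_pair.Fubini_integral[OF this]
  have "(LINT y|lborel. LINT z|lborel. g z * (h y * \<phi> (x + z + y))) =
        (LINT z|lborel. LINT y|lborel. g z * (h y * \<phi> (x + z + y)))" by simp
  moreover have "(LINT z|lborel. g z * (h y * \<phi> (x + z + y))) = h y * (LINT z|lborel. g z * \<phi> (x + y + z))" for y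
  proof -
    have "(\<lambda>z. g z * (h y * \<phi> (x + z + y))) = (\<lambda>z. h y * (g z * \<phi> (x + y + z)))"
      by (simp add: fun_eq_iff ac_simps)
    then show ?thesis by simp
  qed
  ultimately have "(LINT z|lborel. g z * (LINT y|lborel. h y * \<phi> (x + z + y))) =
        (LINT y|lborel. h y * (LINT z|lborel. g z * \<phi> (x + y + z)))"
    by simp
  then show "ap (conv_op g * conv_op h) \<phi> x = ap (conv_op h * conv_op g) \<phi> x"
    by (simp add: ap_mult conv_op_apply g h)
qed

text \<open>\<open>dom_op l \<kappa> S\<close>: on nonnegative functions below a multiple of the exponential weight
  \<open>exp (- (l \<bullet> x))\<close>, the operator \<open>S\<close> is positive and increases this multiple at most by the factor \<open>\<kappa>\<close>. For
  \<open>l = 0\<close> these are all nonnegative bounded continuous functions.\<close>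
definition dom_op :: "'a::euclidean_space \<Rightarrow> real \<Rightarrow> 'a cop \<Rightarrow> bool" where
  "dom_op l \<kappa> S \<longleftrightarrow> 0 \<le> \<kappa> \<and> (\<forall>\<phi> B. 0 \<le> B \<longrightarrow> (\<forall>x. 0 \<le> apply_bcontfun \<phi> x \<and> apply_bcontfun \<phi> x \<le> B * exp (- (l \<bullet> x))) \<longrightarrow>
     (\<forall>x. 0 \<le> apply_bcontfun (ap S \<phi>) x \<and> apply_bcontfun (ap S \<phi>) x \<le> \<kappa> * B * exp (- (l \<bullet> x))))"

text \<open>\<open>adj_op \<kappa> S\<close>: \<open>S\<close> is bounded by \<open>\<kappa>\<close> in the \<open>L\<^sup>1\<close> norm, and it is symmetric with respect to the pairing of
  bounded continuous functions with integrable ones.\<close>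
definition adj_op :: "real \<Rightarrow> 'a::euclidean_space cop \<Rightarrow> bool" where
  "adj_op \<kappa> S \<longleftrightarrow> 0 \<le> \<kappa> \<and> (\<forall>\<phi>. integrable lborel (apply_bcontfun \<phi>) \<longrightarrow> integrable lborel (apply_bcontfun (ap S \<phi>)) \<and>
     (LINT x|lborel. \<bar>ap S \<phi> x\<bar>) \<le> \<kappa> * (LINT x|lborel. \<bar>apply_bcontfun \<phi> x\<bar>) \<and>
     (\<forall>q. (LINT x|lborel. ap S q x * apply_bcontfun \<phi> x) = (LINT x|lborel. apply_bcontfun q x * ap S \<phi> x)))"

lemma dom_opI:
  assumes "0 \<le> \<kappa>" "\<And>\<phi> B x. 0 \<le> B \<Longrightarrow> (\<And>x. 0 \<le> apply_bcontfun \<phi> x) \<Longrightarrow> (\<And>x. apply_bcontfun \<phi> x \<le> B * exp (- (l \<bullet> x))) \<Longrightarrow>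
      0 \<le> apply_bcontfun (ap S \<phi>) x \<and> apply_bcontfun (ap S \<phi>) x \<le> \<kappa> * B * exp (- (l \<bullet> x))"
  shows "dom_op l \<kappa> S"
  unfolding dom_op_def using assms by blast

lemma dom_opD:
  assumes "dom_op l \<kappa> S" "0 \<le> B" "\<And>x. 0 \<le> apply_bcontfun \<phi> x" "\<And>x. apply_bcontfun \<phi> x \<le> B * exp (- (l \<bullet> x))"
  shows "0 \<le> ap S \<phi> x" "ap S \<phi> x \<le> \<kappa> * B * exp (- (l \<bullet> x))"
  using assms unfolding dom_op_def by blast+

lemma dom_op_nonneg: "dom_op l \<kappa> S \<Longrightarrow> 0 \<le> \<kappa>"
  by (simp add: dom_op_def)

lemma dom_op_one: "dom_op l 1 1"
  by (auto simp: dom_op_def)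

lemma dom_op_mult:
  assumes "dom_op l a S" "dom_op l b T"
  shows "dom_op l (a * b) (S * T)"
proof (rule dom_opI)
  show "0 \<le> a * b" using assms by (simp add: dom_op_nonneg)
next
  fix \<phi> :: "'a \<Rightarrow>\<^sub>C real" and B x
  assume *: "0 \<le> B" "\<And>x. 0 \<le> apply_bcontfun \<phi> x" "\<And>x. apply_bcontfun \<phi> x \<le> B * exp (- (l \<bullet> x))"
  note T = dom_opD[OF assms(2) *]
  have "0 \<le> b * B" using * dom_op_nonneg[OF assms(2)] by simp
  from dom_opD[OF assms(1) this, of "ap T \<phi>"] T
  show "0 \<le> ap (S * T) \<phi> x \<and> ap (S * T) \<phi> x \<le> a * b * B * exp (- (l \<bullet> x))"
    by (simp add: ap_mult mult.assoc)
qed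

lemma dom_op_scale:
  assumes "dom_op l a S" "0 \<le> c"
  shows "dom_op l (c * a) (c *\<^sub>R S)"
proof (rule dom_opI)
  show "0 \<le> c * a" using assms by (simp add: dom_op_nonneg)
next
  fix \<phi> :: "'a \<Rightarrow>\<^sub>C real" and B x
  assume *: "0 \<le> B" "\<And>x. 0 \<le> apply_bcontfun \<phi> x" "\<And>x. apply_bcontfun \<phi> x \<le> B * exp (- (l \<bullet> x))"
  note D = dom_opD[OF assms(1) *, of x]
  have "0 \<le> c * ap S \<phi> x" "c * ap S \<phi> x \<le> c * (a * B * exp (- (l \<bullet> x)))"
    using D assms(2) by (auto intro: mult_left_mono)
  then show "0 \<le> ap (c *\<^sub>R S) \<phi> x \<and> ap (c *\<^sub>R S) \<phi> x \<le> c * a * B * exp (- (l \<bullet> x))"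
    by (simp add: ap.scaleR_left mult.assoc)
qed

lemma dom_op_mono:
  assumes "dom_op l a S" "a \<le> b"
  shows "dom_op l b S"
proof (rule dom_opI)
  show "0 \<le> b" using assms dom_op_nonneg by force
next
  fix \<phi> :: "'a \<Rightarrow>\<^sub>C real" and B x
  assume *: "0 \<le> B" "\<And>x. 0 \<le> apply_bcontfun \<phi> x" "\<And>x. apply_bcontfun \<phi> x \<le> B * exp (- (l \<bullet> x))"
  note D = dom_opD[OF assms(1) *, of x]
  have "a * B * exp (- (l \<bullet> x)) \<le> b * B * exp (- (l \<bullet> x))"
    using assms(2) *(1) by (intro mult_right_mono) auto
  then show "0 \<le> ap S \<phi> x \<and> ap S \<phi> x \<le> b * B * exp (- (l \<bullet> x))"
    using D by linarith
qed

lemma dom_op_power: "dom_op l a S \<Longrightarrow> dom_op l (a ^ n) (S ^ n)"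
  by (induction n) (auto intro: dom_op_one dom_op_mult)

lemma dom_op_sums:
  assumes S: "\<And>n. dom_op l (k n) (S n)" and "S sums T" "k sums K"
  shows "dom_op l K T"
proof (rule dom_opI)
  show "0 \<le> K" by (rule sums_le[OF _ sums_zero assms(3)]) (rule dom_op_nonneg[OF S])
next
  fix \<phi> :: "'a \<Rightarrow>\<^sub>C real" and B x
  assume *: "0 \<le> B" "\<And>x. 0 \<le> apply_bcontfun \<phi> x" "\<And>x. apply_bcontfun \<phi> x \<le> B * exp (- (l \<bullet> x))"
  note S' = dom_opD[OF S *]
  have s: "(\<lambda>n. ap (S n) \<phi> x) sums ap T \<phi> x" by (rule sums_apply) fact
  have K: "(\<lambda>n. k n * (B * exp (- (l \<bullet> x)))) sums (K * (B * exp (- (l \<bullet> x))))"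
    using assms(3) by (rule sums_mult2)
  have "ap T \<phi> x \<le> K * (B * exp (- (l \<bullet> x)))"
    by (rule sums_le[OF _ s K]) (use S'(2)[of _ x] in \<open>simp add: mult.assoc\<close>)
  moreover have "0 \<le> ap T \<phi> x" by (rule sums_le[OF _ sums_zero s]) (use S' in auto)
  ultimately show "0 \<le> ap T \<phi> x \<and> ap T \<phi> x \<le> K * B * exp (- (l \<bullet> x))"
    by (simp add: mult.assoc)
qed

lemma dom_conv_op:
  assumes g[measurable]: "integrable lborel g" and pos: "\<And>z. 0 \<le> g z"
    and e: "integrable lborel (\<lambda>z. exp (- (l \<bullet> z)) * g z)"
  shows "dom_op l (LINT z|lborel. exp (- (l \<bullet> z)) * g z) (conv_op g)"
proof (rule dom_opI)
  show "0 \<le> (LINT z|lborel. exp (- (l \<bullet> z)) * g z)" using pos by (auto intro!: integral_nonneg_AE)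
next
  fix \<phi> :: "'a \<Rightarrow>\<^sub>C real" and B x
  assume *: "0 \<le> B" "\<And>x. 0 \<le> apply_bcontfun \<phi> x" "\<And>x. apply_bcontfun \<phi> x \<le> B * exp (- (l \<bullet> x))"
  have "ap (conv_op g) \<phi> x = (LINT z|lborel. g z * \<phi> (x + z))" by (rule conv_op_apply[OF g])
  also have "\<dots> \<le> (LINT z|lborel. (exp (- (l \<bullet> z)) * g z) * (B * exp (- (l \<bullet> x))))"
  proof (rule integral_mono)
    show "g z * \<phi> (x + z) \<le> exp (- (l \<bullet> z)) * g z * (B * exp (- (l \<bullet> x)))" for z
      using mult_left_mono[OF *(3)[of "x + z"] pos[of z]]
      by (simp add: inner_add_right exp_add ac_simps exp_diff exp_minus divide_inverse)
  qed (use e in \<open>auto intro!: integrable_mult_bcontfun[OF g]\<close>)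
  also have "\<dots> = (LINT z|lborel. exp (- (l \<bullet> z)) * g z) * (B * exp (- (l \<bullet> x)))"
    by (rule integral_mult_left_zero)
  finally show "0 \<le> ap (conv_op g) \<phi> x \<and> ap (conv_op g) \<phi> x \<le> (LINT z|lborel. exp (- (l \<bullet> z)) * g z) * B * exp (- (l \<bullet> x))"
    using pos *(2) by (auto simp: conv_op_apply[OF g] mult.assoc intro!: integral_nonneg_AE)
qed


lemma adj_opI:
  assumes "0 \<le> \<kappa>" "\<And>\<phi>. integrable lborel (apply_bcontfun \<phi>) \<Longrightarrow> integrable lborel (apply_bcontfun (ap S \<phi>))"
    "\<And>\<phi>. integrable lborel (apply_bcontfun \<phi>) \<Longrightarrow> (LINT x|lborel. \<bar>ap S \<phi> x\<bar>) \<le> \<kappa> * (LINT x|lborel. \<bar>apply_bcontfun \<phi> x\<bar>)"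
    "\<And>\<phi> q. integrable lborel (apply_bcontfun \<phi>) \<Longrightarrow> (LINT x|lborel. ap S q x * apply_bcontfun \<phi> x) = (LINT x|lborel. apply_bcontfun q x * ap S \<phi> x)"
  shows "adj_op \<kappa> S"
  unfolding adj_op_def using assms by blast

lemma adj_opD:
  assumes "adj_op \<kappa> S" "integrable lborel (apply_bcontfun \<phi>)"
  shows "integrable lborel (apply_bcontfun (ap S \<phi>))"
    "(LINT x|lborel. \<bar>ap S \<phi> x\<bar>) \<le> \<kappa> * (LINT x|lborel. \<bar>apply_bcontfun \<phi> x\<bar>)"
    "(LINT x|lborel. ap S q x * apply_bcontfun \<phi> x) = (LINT x|lborel. apply_bcontfun q x * ap S \<phi> x)"
  using assms unfolding adj_op_def by blast+

lemma adj_op_nonneg: "adj_op \<kappa> S \<Longrightarrow> 0 \<le> \<kappa>"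
  by (simp add: adj_op_def)

lemma adj_op_one: "adj_op 1 1"
  by (auto simp: adj_op_def)

lemma adj_op_mult:
  assumes S: "adj_op a S" and T: "adj_op b T"
    and comm: "S * T = T * S"
  shows "adj_op (a * b) (S * T)"
proof (rule adj_opI)
  show "0 \<le> a * b" using assms by (simp add: adj_op_nonneg)
next
  fix \<phi> :: "'a \<Rightarrow>\<^sub>C real" assume *: "integrable lborel (apply_bcontfun \<phi>)"
  note T1 = adj_opD(1)[OF T *]
  show "integrable lborel (apply_bcontfun (ap (S * T) \<phi>))"
    using adj_opD(1)[OF S T1] by (simp add: ap_mult)
  have "(LINT x|lborel. \<bar>ap (S * T) \<phi> x\<bar>) \<le> a * (LINT x|lborel. \<bar>ap T \<phi> x\<bar>)"
    using adj_opD(2)[OF S T1] by (simp add: ap_mult)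
  also have "\<dots> \<le> a * (b * (LINT x|lborel. \<bar>apply_bcontfun \<phi> x\<bar>))"
    by (intro mult_left_mono adj_opD(2)[OF T *] adj_op_nonneg[OF S])
  finally show "(LINT x|lborel. \<bar>ap (S * T) \<phi> x\<bar>) \<le> a * b * (LINT x|lborel. \<bar>apply_bcontfun \<phi> x\<bar>)"
    by (simp add: mult.assoc)
  fix q
  have "(LINT x|lborel. ap (S * T) q x * apply_bcontfun \<phi> x) = (LINT x|lborel. ap S q x * ap T \<phi> x)"
    using adj_opD(3)[OF T *, of "ap S q"] by (subst comm) (simp add: ap_mult)
  also have "\<dots> = (LINT x|lborel. apply_bcontfun q x * ap (S * T) \<phi> x)"
    using adj_opD(3)[OF S T1, of q] by (simp add: ap_mult)
  finally show "(LINT x|lborel. ap (S * T) q x * apply_bcontfun \<phi> x) = (LINT x|lborel. apply_bcontfun q x * ap (S * T) \<phi> x)" .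
qed

lemma adj_op_scale:
  assumes S: "adj_op a S"
  shows "adj_op (\<bar>c\<bar> * a) (c *\<^sub>R S)"
proof (rule adj_opI)
  show "0 \<le> \<bar>c\<bar> * a" using assms by (simp add: adj_op_nonneg)
next
  fix \<phi> :: "'a \<Rightarrow>\<^sub>C real" assume *: "integrable lborel (apply_bcontfun \<phi>)"
  note D = adj_opD[OF S *]
  show "integrable lborel (apply_bcontfun (ap (c *\<^sub>R S) \<phi>))"
    using D(1) by (simp add: ap.scaleR_left)
  show "(LINT x|lborel. \<bar>ap (c *\<^sub>R S) \<phi> x\<bar>) \<le> \<bar>c\<bar> * a * (LINT x|lborel. \<bar>apply_bcontfun \<phi> x\<bar>)"
    using mult_left_mono[OF D(2), of "\<bar>c\<bar>"] by (simp add: ap.scaleR_left abs_mult mult.assoc)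
  show "(LINT x|lborel. ap (c *\<^sub>R S) q x * apply_bcontfun \<phi> x) = (LINT x|lborel. apply_bcontfun q x * ap (c *\<^sub>R S) \<phi> x)" for q
    using D(3)[of q] by (simp add: ap.scaleR_left mult.assoc mult.left_commute[of _ c])
qed

lemma adj_op_mono:
  assumes S: "adj_op a S" and "a \<le> b"
  shows "adj_op b S"
proof (rule adj_opI)
  show "0 \<le> b" using assms adj_op_nonneg by force
next
  fix \<phi> :: "'a \<Rightarrow>\<^sub>C real" assume *: "integrable lborel (apply_bcontfun \<phi>)"
  have "a * (LINT x|lborel. \<bar>apply_bcontfun \<phi> x\<bar>) \<le> b * (LINT x|lborel. \<bar>apply_bcontfun \<phi> x\<bar>)"
    using assms(2) by (intro mult_right_mono) (auto intro!: integral_nonneg_AE)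
  then show "(LINT x|lborel. \<bar>ap S \<phi> x\<bar>) \<le> b * (LINT x|lborel. \<bar>apply_bcontfun \<phi> x\<bar>)"
    using adj_opD(2)[OF S *] by linarith
qed (use adj_opD[OF S] in auto)

lemma adj_op_power: "adj_op a S \<Longrightarrow> adj_op (a ^ n) (S ^ n)"
  by (induction n) (auto intro!: adj_op_one adj_op_mult simp: power_commutes)

lemma adj_op_sums:
  assumes S: "\<And>n. adj_op (k n) (S n)" and ST: "S sums T" and K: "k sums K"
  shows "adj_op K T"
proof (rule adj_opI)
  show "0 \<le> K" by (rule sums_le[OF _ sums_zero K]) (rule adj_op_nonneg[OF S])
next
  fix \<phi> :: "'a \<Rightarrow>\<^sub>C real" assume *: "integrable lborel (apply_bcontfun \<phi>)"
  note D = adj_opD[OF S *]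
  let ?I = "LINT x|lborel. \<bar>apply_bcontfun \<phi> x\<bar>"
  have sx: "(\<lambda>n. ap (S n) \<psi> x) sums ap T \<psi> x" for \<psi> x by (rule sums_apply[OF ST])
  have KI: "(\<lambda>n. k n * ?I) sums (K * ?I)" by (rule sums_mult2[OF K])
  have su: "summable (\<lambda>n. LINT x|lborel. \<bar>ap (S n) \<phi> x\<bar>)"
    by (rule summable_comparison_test'[OF sums_summable[OF KI], of 0])
       (use D(2) in \<open>auto intro!: integral_nonneg_AE\<close>)
  have nni: "(\<integral>\<^sup>+x. ennreal \<bar>ap (S n) \<phi> x\<bar> \<partial>lborel) = ennreal (LINT x|lborel. \<bar>ap (S n) \<phi> x\<bar>)" for n
    by (rule nn_integral_eq_integral) (use D(1) in auto)
  have fin: "(\<integral>\<^sup>+x. (\<Sum>n. ennreal \<bar>ap (S n) \<phi> x\<bar>) \<partial>lborel) < \<infinity>"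
    by (subst nn_integral_suminf) (auto simp: nni suminf_ennreal_eq[OF _ summable_sums[OF su]] intro!: integral_nonneg_AE)
  have "AE x in lborel. (\<Sum>n. ennreal \<bar>ap (S n) \<phi> x\<bar>) \<noteq> \<infinity>"
    by (rule nn_integral_PInf_AE) (use fin in auto)
  then have ab: "AE x in lborel. summable (\<lambda>n. norm (ap (S n) \<phi> x))"
    by eventually_elim (auto intro!: summable_suminf_not_top)
  have su': "summable (\<lambda>n. LINT x|lborel. norm (ap (S n) \<phi> x))" using su by simp
  have eq: "(\<lambda>x. \<Sum>n. ap (S n) \<phi> x) = apply_bcontfun (ap T \<phi>)"
    using sums_unique[OF sx] by auto
  show int: "integrable lborel (apply_bcontfun (ap T \<phi>))"
    using integrable_suminf[OF D(1) ab su'] by (simp add: eq)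
  have Tle: "AE x in lborel. \<bar>ap T \<phi> x\<bar> \<le> (\<Sum>n. \<bar>ap (S n) \<phi> x\<bar>)"
    using ab
  proof eventually_elim
    case (elim x)
    then show ?case using summable_norm[OF elim] sums_unique[OF sx, of \<phi> x] by simp
  qed
  have ab2: "AE x in lborel. summable (\<lambda>n. norm \<bar>ap (S n) \<phi> x\<bar>)" using ab by simp
  have su2: "summable (\<lambda>n. LINT x|lborel. norm \<bar>ap (S n) \<phi> x\<bar>)" using su by simp
  have D1: "integrable lborel (\<lambda>x. \<bar>ap (S n) \<phi> x\<bar>)" for n using D(1) by simp
  have "(LINT x|lborel. \<bar>ap T \<phi> x\<bar>) \<le> (LINT x|lborel. (\<Sum>n. \<bar>ap (S n) \<phi> x\<bar>))"
    by (rule integral_mono_AE) (use int Tle integrable_suminf[OF D1 ab2 su2] in auto)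
  also have "\<dots> = (\<Sum>n. LINT x|lborel. \<bar>ap (S n) \<phi> x\<bar>)"
    by (rule integral_suminf[OF D1 ab2 su2])
  also have "\<dots> \<le> K * ?I"
    using suminf_le[OF D(2) su sums_summable[OF KI]] sums_unique[OF KI] by simp
  finally show "(LINT x|lborel. \<bar>ap T \<phi> x\<bar>) \<le> K * ?I" .
  fix q
  let ?P = "\<lambda>\<psi>. LINT x|lborel. apply_bcontfun \<psi> x * apply_bcontfun \<phi> x"
  have "bounded_linear ?P"
  proof (rule bounded_linear_intro)
    fix \<psi> \<xi> :: "'a \<Rightarrow>\<^sub>C real" and r
    note i = integrable_mult_bcontfun'(2)[OF *]
    show "?P (\<psi> + \<xi>) = ?P \<psi> + ?P \<xi>" by (simp add: plus_bcontfun.rep_eq ring_distribs i)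
    show "?P (r *\<^sub>R \<psi>) = r *\<^sub>R ?P \<psi>" by (simp add: mult.assoc)
    have "\<bar>?P \<psi>\<bar> \<le> (LINT x|lborel. \<bar>apply_bcontfun \<psi> x * apply_bcontfun \<phi> x\<bar>)" by (rule integral_abs_bound)
    also have "\<dots> \<le> (LINT x|lborel. norm \<psi> * \<bar>apply_bcontfun \<phi> x\<bar>)"
      by (rule integral_mono)
         (use * integrable_abs[OF i[of \<psi>]] in \<open>auto simp: abs_mult intro!: mult_right_mono abs_apply_le_norm\<close>)
    finally show "norm (?P \<psi>) \<le> norm \<psi> * ?I" by simp
  qed
  then have 1: "(\<lambda>n. ?P (ap (S n) q)) sums ?P (ap T q)"
    by (rule bounded_linear.sums[OF bounded_linear_compose[OF _ ap.bounded_linear_left] ST])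
  have D2: "integrable lborel (\<lambda>x. apply_bcontfun q x * ap (S n) \<phi> x)" for n
    by (rule integrable_mult_bcontfun'(2)[OF D(1)])
  have ab3: "AE x in lborel. summable (\<lambda>n. norm (apply_bcontfun q x * ap (S n) \<phi> x))"
    using ab by eventually_elim (auto simp: abs_mult intro!: summable_mult)
  have su3: "summable (\<lambda>n. LINT x|lborel. norm (apply_bcontfun q x * ap (S n) \<phi> x))"
  proof (rule summable_comparison_test'[OF summable_mult[OF su, of "norm q"], of 0])
    fix n
    have "(LINT x|lborel. norm (apply_bcontfun q x * ap (S n) \<phi> x)) \<le> (LINT x|lborel. norm q * \<bar>ap (S n) \<phi> x\<bar>)"
      by (rule integral_mono) (use D2[THEN integrable_norm] D1 in \<open>auto simp: abs_mult intro!: mult_right_mono abs_apply_le_norm\<close>)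
    then show "norm (LINT x|lborel. norm (apply_bcontfun q x * ap (S n) \<phi> x)) \<le> norm q * (LINT x|lborel. \<bar>ap (S n) \<phi> x\<bar>)"
      by (simp add: integral_nonneg_AE)
  qed
  have "(\<lambda>n. LINT x|lborel. apply_bcontfun q x * ap (S n) \<phi> x) sums (LINT x|lborel. (\<Sum>n. apply_bcontfun q x * ap (S n) \<phi> x))"
    by (rule sums_integral[OF D2 ab3 su3])
  also have "(\<lambda>x. \<Sum>n. apply_bcontfun q x * ap (S n) \<phi> x) = (\<lambda>x. apply_bcontfun q x * ap T \<phi> x)"
    by (rule ext, rule sums_unique[symmetric, OF sums_mult[OF sx]])
  finally have 2: "(\<lambda>n. LINT x|lborel. apply_bcontfun q x * ap (S n) \<phi> x) sums (LINT x|lborel. apply_bcontfun q x * ap T \<phi> x)" .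
  show "(LINT x|lborel. ap T q x * apply_bcontfun \<phi> x) = (LINT x|lborel. apply_bcontfun q x * ap T \<phi> x)"
    by (rule sums_unique2[OF 1[unfolded D(3)] 2])
qed

lemma adj_conv_op:
  fixes g :: "'a::euclidean_space \<Rightarrow> real"
  assumes g[measurable]: "integrable lborel g" and pos: "\<And>z. 0 \<le> g z" and sym: "\<And>z. g (- z) = g z"
  shows "adj_op (LINT z|lborel. g z) (conv_op g)"
proof (rule adj_opI)
  show "0 \<le> (LINT z|lborel. g z)" using pos by (auto intro!: integral_nonneg_AE)
next
  fix \<phi> :: "'a \<Rightarrow>\<^sub>C real" assume \<phi>[measurable]: "integrable lborel (apply_bcontfun \<phi>)"
  have F: "integrable (lborel \<Otimes>\<^sub>M lborel) (\<lambda>(z, x). g z * (\<phi> (x + z) * apply_bcontfun q x))" for q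
  proof (rule lborel_pair.Fubini_integrable)
    have i: "integrable lborel (\<lambda>x. \<phi> (x + z))" for z
      using \<phi> by (simp add: integral_lborel_translate)
    have i2: "integrable lborel (\<lambda>x. \<phi> (x + z) * apply_bcontfun q x)" for z
      by (rule integrable_mult_bcontfun'(1)[OF i])
    show "AE z in lborel. integrable lborel (\<lambda>x. case (z, x) of (z, x) \<Rightarrow> g z * (\<phi> (x + z) * apply_bcontfun q x))"
      using i2 by simp
    have b: "(LINT x|lborel. norm (\<phi> (x + z) * apply_bcontfun q x)) \<le> (LINT x|lborel. \<bar>apply_bcontfun \<phi> x\<bar>) * norm q" for z
    proof -
      have "(LINT x|lborel. norm (\<phi> (x + z) * apply_bcontfun q x)) \<le> (LINT x|lborel. \<bar>\<phi> (x + z)\<bar> * norm q)"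
        by (rule integral_mono) (use i2[THEN integrable_norm] i in \<open>auto simp: abs_mult intro!: mult_left_mono abs_apply_le_norm\<close>)
      also have "\<dots> = (LINT x|lborel. \<bar>apply_bcontfun \<phi> x\<bar>) * norm q"
        using integral_lborel_translate(2)[of "\<lambda>x. \<bar>apply_bcontfun \<phi> x\<bar>" z] by simp
      finally show ?thesis .
    qed
    show "integrable lborel (\<lambda>z. LINT x|lborel. norm (case (z, x) of (z, x) \<Rightarrow> g z * (\<phi> (x + z) * apply_bcontfun q x)))"
    proof (rule Bochner_Integration.integrable_bound[where f = "\<lambda>z. \<bar>g z\<bar> * ((LINT x|lborel. \<bar>apply_bcontfun \<phi> x\<bar>) * norm q)"])
      show "AE z in lborel. norm (LINT x|lborel. norm (case (z, x) of (z, x) \<Rightarrow> g z * (\<phi> (x + z) * apply_bcontfun q x)))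
        \<le> norm (\<bar>g z\<bar> * ((LINT x|lborel. \<bar>apply_bcontfun \<phi> x\<bar>) * norm q))"
      proof (rule AE_I2)
        fix z
        have "\<bar>g z\<bar> * (LINT x|lborel. norm (\<phi> (x + z) * apply_bcontfun q x)) \<le> \<bar>g z\<bar> * ((LINT x|lborel. \<bar>apply_bcontfun \<phi> x\<bar>) * norm q)"
          using b by (intro mult_left_mono) auto
        then show "norm (LINT x|lborel. norm (case (z, x) of (z, x) \<Rightarrow> g z * (\<phi> (x + z) * apply_bcontfun q x)))
        \<le> norm (\<bar>g z\<bar> * ((LINT x|lborel. \<bar>apply_bcontfun \<phi> x\<bar>) * norm q))"
          by (simp add: abs_mult integral_nonneg_AE)
      qed
    qed (use g in auto)
  qed simp
  have one: "apply_bcontfun (const_bcontfun 1) x = (1::real)" for x :: 'a by (simp add: const_bcontfun.rep_eq)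
  have F1: "integrable (lborel \<Otimes>\<^sub>M lborel) (\<lambda>(z, x). g z * \<phi> (x + z))"
    using F[of "const_bcontfun 1"] by (simp add: one)
  from lborel_pair.integrable_snd[OF F1]
  show int: "integrable lborel (apply_bcontfun (ap (conv_op g) \<phi>))"
    by (simp add: conv_op_apply[OF g, symmetric])
  have F2: "integrable (lborel \<Otimes>\<^sub>M lborel) (\<lambda>(z, x). \<bar>g z * \<phi> (x + z)\<bar>)"
    using integrable_abs[OF F1] by (simp add: case_prod_beta')
  have int': "integrable lborel (\<lambda>x. \<bar>LINT z|lborel. g z * \<phi> (x + z)\<bar>)"
    using integrable_abs[OF int] by (simp add: conv_op_apply[OF g])
  have "(LINT x|lborel. \<bar>ap (conv_op g) \<phi> x\<bar>) \<le> (LINT x|lborel. (LINT z|lborel. \<bar>g z * \<phi> (x + z)\<bar>))"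
    using int' lborel_pair.integrable_snd[OF F2]
    by (intro integral_mono) (auto simp: conv_op_apply[OF g] intro!: integral_abs_bound)
  also have "\<dots> = (LINT z|lborel. (LINT x|lborel. \<bar>g z * \<phi> (x + z)\<bar>))"
    using lborel_pair.Fubini_integral[OF F2] by simp
  also have "\<dots> = (LINT z|lborel. g z * (LINT x|lborel. \<bar>apply_bcontfun \<phi> x\<bar>))"
    using integral_lborel_translate(2)[of "\<lambda>x. \<bar>apply_bcontfun \<phi> x\<bar>"] pos by (simp add: abs_mult)
  also have "\<dots> = (LINT z|lborel. g z) * (LINT x|lborel. \<bar>apply_bcontfun \<phi> x\<bar>)"
    by (rule integral_mult_left_zero)
  finally show "(LINT x|lborel. \<bar>ap (conv_op g) \<phi> x\<bar>) \<le> (LINT z|lborel. g z) * (LINT x|lborel. \<bar>apply_bcontfun \<phi> x\<bar>)" .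
  fix q
  have "(LINT x|lborel. apply_bcontfun q x * ap (conv_op g) \<phi> x) = (LINT x|lborel. LINT z|lborel. g z * (\<phi> (x + z) * apply_bcontfun q x))"
  proof -
    have "(LINT z|lborel. g z * (\<phi> (x + z) * apply_bcontfun q x)) = ap (conv_op g) \<phi> x * apply_bcontfun q x" for x
      unfolding conv_op_apply[OF g] integral_mult_left_zero[symmetric] mult.assoc ..
    then show ?thesis by (simp only: mult.commute[of "apply_bcontfun q _"])
  qed
  also have "\<dots> = (LINT z|lborel. LINT x|lborel. g z * (\<phi> (x + z) * apply_bcontfun q x))"
    using lborel_pair.Fubini_integral[OF F] by simp
  also have "\<dots> = (LINT z|lborel. g z * (LINT x|lborel. \<phi> x * q (x - z)))"
  proof -
    have "(LINT x|lborel. \<phi> (x + z) * apply_bcontfun q x) = (LINT x|lborel. \<phi> x * q (x - z))" for z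
      using integral_lborel_translate(2)[of "\<lambda>x. \<phi> x * q (x - z)" z] by simp
    then show ?thesis by simp
  qed
  also have "\<dots> = (LINT z|lborel. g z * (LINT x|lborel. \<phi> x * q (x + z)))"
    using integral_lborel_reflect(2)[of "\<lambda>z. g z * (LINT x|lborel. \<phi> x * q (x + z))"] by (simp add: sym)
  also have "\<dots> = (LINT z|lborel. LINT x|lborel. g z * (\<phi> x * q (x + z)))" by simp
  also have "\<dots> = (LINT x|lborel. LINT z|lborel. g z * (\<phi> x * q (x + z)))"
  proof -
    have "integrable (lborel \<Otimes>\<^sub>M lborel) (\<lambda>(z, x). g z * (\<phi> x * q (x + z)))"
    proof (rule Bochner_Integration.integrable_bound)
      have "integrable (lborel \<Otimes>\<^sub>M lborel) (\<lambda>(z, x). g z * apply_bcontfun \<phi> x)"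
        by (rule lborel_pair.Fubini_integrable) (use \<phi> g in \<open>auto simp: abs_mult\<close>)
      then show "integrable (lborel \<Otimes>\<^sub>M lborel) (\<lambda>p. norm q * (case p of (z, x) \<Rightarrow> g z * apply_bcontfun \<phi> x))" by simp
      show "AE p in lborel \<Otimes>\<^sub>M lborel. norm (case p of (z, x) \<Rightarrow> g z * (\<phi> x * q (x + z))) \<le> norm (norm q * (case p of (z, x) \<Rightarrow> g z * apply_bcontfun \<phi> x))"
      proof (rule AE_I2, safe)
        fix z x
        have "(\<bar>g z\<bar> * \<bar>\<phi> x\<bar>) * \<bar>q (x + z)\<bar> \<le> (\<bar>g z\<bar> * \<bar>\<phi> x\<bar>) * norm q"
          by (intro mult_left_mono abs_apply_le_norm) auto
        then show "norm (g z * (\<phi> x * q (x + z))) \<le> norm (norm q * (g z * apply_bcontfun \<phi> x))"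
          by (simp add: abs_mult ac_simps)
      qed
    qed simp
    from lborel_pair.Fubini_integral[OF this] show ?thesis by simp
  qed
  also have "\<dots> = (LINT x|lborel. ap (conv_op g) q x * apply_bcontfun \<phi> x)"
  proof -
    have "(LINT z|lborel. g z * (\<phi> x * q (x + z))) = ap (conv_op g) q x * apply_bcontfun \<phi> x" for x
    proof -
      have "(\<lambda>z. g z * (\<phi> x * q (x + z))) = (\<lambda>z. (g z * q (x + z)) * \<phi> x)"
        by (simp add: fun_eq_iff)
      then show ?thesis unfolding conv_op_apply[OF g] integral_mult_left_zero[symmetric] by (simp only:)
    qed
    then show ?thesis by (simp only:)
  qed
  finally show "(LINT x|lborel. ap (conv_op g) q x * apply_bcontfun \<phi> x) = (LINT x|lborel. apply_bcontfun q x * ap (conv_op g) \<phi> x)" ..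
qed

section \<open>Compound Poisson semigroups\<close>

text \<open>The density of a finite symmetric jump measure.\<close>
definition jump_density :: "('a::euclidean_space \<Rightarrow> real) \<Rightarrow> bool" where
  "jump_density g \<longleftrightarrow> integrable lborel g \<and> (\<forall>z. 0 \<le> g z) \<and> (\<forall>z. g (- z) = g z)"

text \<open>The generator of the compound Poisson process with jump density \<open>g\<close>, and its semigroup.\<close>
definition gen_op :: "('a::euclidean_space \<Rightarrow> real) \<Rightarrow> 'a cop" where
  "gen_op g = conv_op g - (LINT z|lborel. g z) *\<^sub>R 1"

definition cps :: "('a::euclidean_space \<Rightarrow> real) \<Rightarrow> real \<Rightarrow> 'a cop" where
  "cps g t = exp (t *\<^sub>R gen_op g)"

text \<open>The entire function \<open>(exp (t s) - 1) / s\<close> of an operator \<open>s = S\<close>. Up to the factor \<open>exp (- t m)\<close>, with \<open>m\<close> the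
  mass of \<open>g\<close>, the law at time \<open>t\<close> of a compound Poisson process on the event that it has jumped has the density
  that \<open>phi_op t (conv_op g)\<close> assigns to \<open>g\<close>.\<close>
definition phi_op :: "real \<Rightarrow> 'a::euclidean_space cop \<Rightarrow> 'a cop" where
  "phi_op t S = (\<Sum>n. (t ^ Suc n / fact (Suc n)) *\<^sub>R S ^ n)"

lemma jump_densityD:
  assumes "jump_density g"
  shows "integrable lborel g" "0 \<le> g z" "g (- z) = g z"
  using assms by (auto simp: jump_density_def)

lemma jump_density_mass_nonneg: "jump_density g \<Longrightarrow> 0 \<le> (LINT z|lborel. g z)"
  by (auto simp: jump_density_def intro!: integral_nonneg_AE)

lemma norm_conv_jump: "jump_density g \<Longrightarrow> norm (conv_op g) \<le> (LINT z|lborel. g z)"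
  using norm_conv_op[of g] by (simp add: jump_density_def)

lemma gen_op_add:
  assumes "jump_density g" "jump_density h"
  shows "gen_op (\<lambda>z. g z + h z) = gen_op g + gen_op h"
  using assms by (simp add: gen_op_def conv_op_add jump_density_def algebra_simps)

lemma conv_gen_commute:
  assumes "jump_density g" "A * conv_op g = conv_op g * A"
  shows "A * gen_op g = gen_op g * A"
  using assms by (simp add: gen_op_def algebra_simps)

lemma gen_op_commute:
  assumes "jump_density g" "jump_density h"
  shows "gen_op g * gen_op h = gen_op h * gen_op g"
  using conv_op_commute[of g h] assms by (simp add: gen_op_def jump_density_def algebra_simps)

lemma exp_commute_left:
  fixes A B :: "'b::{real_normed_algebra_1, banach}"
  assumes AB: "A * B = B * A"
  shows "exp A * B = B * exp A"
proof -
  have p: "A ^ n * B = B * A ^ n" for n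
    by (induction n) (simp_all add: mult.assoc AB, simp add: mult.assoc[symmetric] AB)
  have "(\<lambda>n. A ^ n /\<^sub>R fact n * B) sums (exp A * B)"
    by (rule bounded_linear.sums[OF bounded_linear_mult_left exp_converges])
  moreover have "(\<lambda>n. B * (A ^ n /\<^sub>R fact n)) sums (B * exp A)"
    by (rule bounded_linear.sums[OF bounded_linear_mult_right exp_converges])
  moreover have "(\<lambda>n. A ^ n /\<^sub>R fact n * B) = (\<lambda>n. B * (A ^ n /\<^sub>R fact n))"
    by (simp add: p)
  ultimately show ?thesis by (metis sums_unique2)
qed

lemma cps_commute:
  assumes "jump_density g" "A * conv_op g = conv_op g * A"
  shows "cps g t * A = A * cps g t"
  unfolding cps_def by (rule exp_commute_left) (simp add: conv_gen_commute[OF assms])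

lemma cps_conv_commute:
  assumes "jump_density g" "jump_density h"
  shows "cps g t * conv_op h = conv_op h * cps g t"
  using assms by (intro cps_commute) (auto simp: jump_density_def conv_op_commute)

lemma cps_shift_commute:
  assumes "jump_density g"
  shows "cps g t * shift_op z = shift_op z * cps g t"
  using assms by (intro cps_commute) (auto simp: jump_density_def conv_op_shift_commute)

lemma cps_zero [simp]: "cps g 0 = 1"
  by (simp add: cps_def)

lemma cps_semigroup: "cps g (s + t) = cps g s * cps g t"
  unfolding cps_def by (subst exp_add_commuting[symmetric]) (simp_all add: scaleR_add_left)

lemma cps_add:
  assumes "jump_density g" "jump_density h"
  shows "cps (\<lambda>z. g z + h z) t = cps g t * cps h t"
  unfolding cps_def gen_op_add[OF assms] scaleR_add_right
  by (rule exp_add_commuting) (simp add: gen_op_commute[OF assms])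

lemma cps_eq:
  "cps g t = exp (- (t * (LINT z|lborel. g z))) *\<^sub>R exp (t *\<^sub>R conv_op g)"
proof -
  let ?m = "LINT z|lborel. g z"
  have "cps g t = exp (of_real (- (t * ?m)) + t *\<^sub>R conv_op g)"
    by (simp add: cps_def gen_op_def scaleR_diff_right of_real_def)
  also have "\<dots> = exp (of_real (- (t * ?m))) * exp (t *\<^sub>R conv_op g)"
    by (rule exp_add_commuting) (simp add: of_real_def)
  also have "exp (of_real (- (t * ?m)) :: 'a cop) = exp (- (t * ?m)) *\<^sub>R 1"
    unfolding exp_of_real by (simp add: of_real_def)
  finally show ?thesis by simp
qed

lemma norm_cps:
  assumes "jump_density g" "0 \<le> t"
  shows "norm (cps g t) \<le> 1"
proof -
  have "norm (exp (t *\<^sub>R conv_op g)) \<le> exp (norm (t *\<^sub>R conv_op g))" by (rule norm_exp)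
  also have "\<dots> \<le> exp (t * (LINT z|lborel. g z))"
    using assms norm_conv_jump[OF assms(1)] by (simp add: mult_left_mono)
  finally show ?thesis
    by (simp add: cps_eq exp_minus field_simps)
qed

lemma cps_deriv:
  "((\<lambda>t. ap (cps g t) \<phi>) has_vector_derivative ap (cps g t) (ap (gen_op g) \<phi>)) (at t within T)"
proof -
  have "((\<lambda>t. cps g t) has_vector_derivative cps g t * gen_op g) (at t within T)"
    unfolding cps_def by (rule exp_scaleR_has_vector_derivative_right)
  from bounded_linear.has_vector_derivative[OF ap.bounded_linear_left this, of \<phi>]
  show ?thesis by (simp add: ap_mult)
qed

lemma continuous_on_cps: "continuous_on T (cps g)"
  unfolding cps_def by (rule continuous_on_vector_derivative, rule exp_scaleR_has_vector_derivative_right)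

lemma norm_ap_cps:
  assumes "jump_density g" "0 \<le> t"
  shows "norm (ap (cps g t) \<phi>) \<le> norm \<phi>"
proof -
  have "norm (ap (cps g t) \<phi>) \<le> norm (cps g t) * norm \<phi>" by (rule norm_ap)
  also have "\<dots> \<le> 1 * norm \<phi>" by (intro mult_right_mono norm_cps assms) simp
  finally show ?thesis by simp
qed

text \<open>The next two estimates are Taylor expansions in time. Since the semigroup consists of contractions,
  the remainder is bounded by the generator applied to \<open>\<phi>\<close> itself, without an exponential of the mass of \<open>g\<close>.\<close>
lemma cps_diff_bound:
  assumes g: "jump_density g" and t: "0 \<le> t"
  shows "norm (ap (cps g t) \<phi> - \<phi>) \<le> t * norm (ap (gen_op g) \<phi>)"
proof -
  have "norm (ap (cps g t) \<phi> - ap (cps g 0) \<phi>) \<le> norm (ap (gen_op g) \<phi>) * norm (t - 0)"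
  proof (rule differentiable_bound[of "{0..t}"])
    fix s assume s: "s \<in> {0..t}"
    show "((\<lambda>t. ap (cps g t) \<phi>) has_derivative (\<lambda>h. h *\<^sub>R ap (cps g s) (ap (gen_op g) \<phi>))) (at s within {0..t})"
      using cps_deriv by (simp add: has_vector_derivative_def)
    show "onorm (\<lambda>h. h *\<^sub>R ap (cps g s) (ap (gen_op g) \<phi>)) \<le> norm (ap (gen_op g) \<phi>)"
    proof (rule onorm_bound)
      fix h :: real
      have "\<bar>h\<bar> * norm (ap (cps g s) (ap (gen_op g) \<phi>)) \<le> \<bar>h\<bar> * norm (ap (gen_op g) \<phi>)"
        using s by (intro mult_left_mono norm_ap_cps g) auto
      then show "norm (h *\<^sub>R ap (cps g s) (ap (gen_op g) \<phi>)) \<le> norm (ap (gen_op g) \<phi>) * norm h"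
        by (simp add: mult.commute)
    qed simp
  qed (use t in auto)
  then show ?thesis using t by (simp add: mult.commute)
qed

lemma cps_taylor_bound:
  assumes g: "jump_density g" and t: "0 \<le> t"
  shows "norm (ap (cps g t) \<phi> - \<phi> - t *\<^sub>R ap (gen_op g) \<phi>) \<le> t\<^sup>2 * norm (ap (gen_op g) (ap (gen_op g) \<phi>))"
proof -
  let ?G = "ap (gen_op g) \<phi>"
  let ?K = "t * norm (ap (gen_op g) ?G)"
  have "norm ((ap (cps g t) \<phi> - t *\<^sub>R ?G) - (ap (cps g 0) \<phi> - 0 *\<^sub>R ?G)) \<le> ?K * norm (t - 0)"
  proof (rule differentiable_bound[of "{0..t}" "\<lambda>t. ap (cps g t) \<phi> - t *\<^sub>R ?G"])
    fix s assume s: "s \<in> {0..t}"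
    show "((\<lambda>t. ap (cps g t) \<phi> - t *\<^sub>R ?G) has_derivative (\<lambda>h. h *\<^sub>R ap (cps g s) ?G - h *\<^sub>R ?G)) (at s within {0..t})"
      using cps_deriv by (auto simp: has_vector_derivative_def intro!: derivative_eq_intros)
    show "onorm (\<lambda>h. h *\<^sub>R ap (cps g s) ?G - h *\<^sub>R ?G) \<le> ?K"
    proof (rule onorm_bound)
      fix h :: real
      have "norm (ap (cps g s) ?G - ?G) \<le> s * norm (ap (gen_op g) ?G)"
        using s by (intro cps_diff_bound g) auto
      also have "\<dots> \<le> ?K" using s by (intro mult_right_mono) auto
      finally have "\<bar>h\<bar> * norm (ap (cps g s) ?G - ?G) \<le> \<bar>h\<bar> * ?K"
        by (rule mult_left_mono) simp
      then show "norm (h *\<^sub>R ap (cps g s) ?G - h *\<^sub>R ?G) \<le> ?K * norm h"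
        by (simp add: mult.commute[of "\<bar>h\<bar>"] flip: scaleR_diff_right)
    qed (use t in simp)
  qed (use t in auto)
  then show ?thesis using t by (simp add: power2_eq_square algebra_simps)
qed

section \<open>Power series of a convolution operator\<close>

lemma exp_sums_scaled:
  fixes C :: "'b::{real_normed_algebra_1, banach}"
  shows "(\<lambda>n. (t ^ n / fact n) *\<^sub>R C ^ n) sums exp (t *\<^sub>R C)"
  using exp_converges[of "t *\<^sub>R C"] by (simp add: divide_inverse mult.commute)

lemma dom_exp:
  assumes "dom_op l k S" "0 \<le> t"
  shows "dom_op l (exp (t * k)) (exp (t *\<^sub>R S))"
proof (rule dom_op_sums)
  show "dom_op l ((t ^ n / fact n) * k ^ n) ((t ^ n / fact n) *\<^sub>R S ^ n)" for n
    using assms by (intro dom_op_scale dom_op_power) auto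
  show "(\<lambda>n. (t ^ n / fact n) * k ^ n) sums exp (t * k)"
    using exp_sums_scaled[of t k] by simp
qed (rule exp_sums_scaled)

lemma adj_exp:
  assumes "adj_op k S" "0 \<le> t"
  shows "adj_op (exp (t * k)) (exp (t *\<^sub>R S))"
proof (rule adj_op_sums)
  show "adj_op ((t ^ n / fact n) * k ^ n) ((t ^ n / fact n) *\<^sub>R S ^ n)" for n
    using adj_op_scale[OF adj_op_power[OF assms(1), of n], of "t ^ n / fact n"] assms(2) by simp
  show "(\<lambda>n. (t ^ n / fact n) * k ^ n) sums exp (t * k)"
    using exp_sums_scaled[of t k] by simp
qed (rule exp_sums_scaled)

lemma phi_summable:
  fixes S :: "'a::euclidean_space cop"
  shows "summable (\<lambda>n. (t ^ Suc n / fact (Suc n)) *\<^sub>R S ^ n)"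
    and "(\<lambda>n. (t ^ Suc n / fact (Suc n)) *\<^sub>R S ^ n) sums phi_op t S"
    and norm_phi_op: "0 \<le> t \<Longrightarrow> norm (phi_op t S) \<le> t * exp (t * norm S)"
proof -
  have le: "norm ((t ^ Suc n / fact (Suc n)) *\<^sub>R S ^ n) \<le> \<bar>t\<bar> * ((\<bar>t\<bar> ^ n / fact n) *\<^sub>R norm S ^ n)" for n
  proof -
    have "norm ((t ^ Suc n / fact (Suc n)) *\<^sub>R S ^ n) \<le> (\<bar>t\<bar> ^ Suc n / fact (Suc n)) * norm S ^ n"
      by (simp add: power_abs abs_mult norm_power_ineq mult_left_mono divide_right_mono)
    also have "\<dots> \<le> (\<bar>t\<bar> ^ Suc n / fact n) * norm S ^ n"
      by (intro mult_right_mono divide_left_mono fact_mono) auto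
    finally show ?thesis by simp
  qed
  have s: "(\<lambda>n. \<bar>t\<bar> * ((\<bar>t\<bar> ^ n / fact n) *\<^sub>R norm S ^ n)) sums (\<bar>t\<bar> * exp (\<bar>t\<bar> * norm S))"
    using sums_mult[OF exp_sums_scaled[of "\<bar>t\<bar>" "norm S"], of "\<bar>t\<bar>"] by simp
  show *: "summable (\<lambda>n. (t ^ Suc n / fact (Suc n)) *\<^sub>R S ^ n)"
    by (rule summable_comparison_test'[OF sums_summable[OF s], of 0]) (rule le)
  then show "(\<lambda>n. (t ^ Suc n / fact (Suc n)) *\<^sub>R S ^ n) sums phi_op t S"
    unfolding phi_op_def by (rule summable_sums)
  show "norm (phi_op t S) \<le> t * exp (t * norm S)" if "0 \<le> t"
    using sums_unique[OF s] norm_suminf_le[OF le sums_summable[OF s]] that unfolding phi_op_def by simp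
qed

text \<open>Splitting off the event that there is no jump.\<close>
lemma exp_eq_phi: "exp (t *\<^sub>R S) = 1 + S * phi_op t S"
proof -
  have "(\<lambda>n. (t ^ Suc n / fact (Suc n)) *\<^sub>R S ^ Suc n) sums (S * phi_op t S)"
    using bounded_linear.sums[OF bounded_linear_mult_right phi_summable(2), of S t S] by simp
  from sums_Suc[OF this] show ?thesis
    using sums_unique2[OF exp_sums_scaled[of t S]] by (simp add: add.commute)
qed

lemma phi_commute:
  assumes AB: "A * S = S * A"
  shows "phi_op t S * A = A * phi_op t S"
proof -
  have p: "S ^ n * A = A * S ^ n" for n
    by (induction n) (simp_all add: mult.assoc AB[symmetric], simp add: mult.assoc[symmetric] AB)
  have "(\<lambda>n. (t ^ Suc n / fact (Suc n)) *\<^sub>R S ^ n * A) sums (phi_op t S * A)"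
    by (rule bounded_linear.sums[OF bounded_linear_mult_left phi_summable(2)])
  moreover have "(\<lambda>n. A * ((t ^ Suc n / fact (Suc n)) *\<^sub>R S ^ n)) sums (A * phi_op t S)"
    by (rule bounded_linear.sums[OF bounded_linear_mult_right phi_summable(2)])
  ultimately show ?thesis using sums_unique2 by (simp add: p)
qed

lemma continuous_on_phi: "continuous_on {0..T} (\<lambda>t. phi_op t S)"
proof (rule uniform_limit_theorem)
  show "uniform_limit {0..T} (\<lambda>n t. \<Sum>i<n. (t ^ Suc i / fact (Suc i)) *\<^sub>R S ^ i) (\<lambda>t. phi_op t S) sequentially"
    unfolding phi_op_def
  proof (rule Weierstrass_m_test)
    show "norm ((t ^ Suc n / fact (Suc n)) *\<^sub>R S ^ n) \<le> (T ^ Suc n / fact (Suc n)) * norm S ^ n" if "t \<in> {0..T}" for n t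
    proof -
      have "norm ((t ^ Suc n / fact (Suc n)) *\<^sub>R S ^ n) \<le> (t ^ Suc n / fact (Suc n)) * norm S ^ n"
        using that by (simp add: power_abs abs_mult norm_power_ineq mult_left_mono divide_right_mono)
      also have "\<dots> \<le> (T ^ Suc n / fact (Suc n)) * norm S ^ n"
        using that by (intro mult_right_mono divide_right_mono power_mono) auto
      finally show ?thesis .
    qed
    show "summable (\<lambda>n. (T ^ Suc n / fact (Suc n)) * norm S ^ n)"
    proof (rule summable_comparison_test'[OF sums_summable, of _ _ 0])
      show "(\<lambda>n. \<bar>T\<bar> * ((\<bar>T\<bar> ^ n / fact n) *\<^sub>R norm S ^ n)) sums (\<bar>T\<bar> * exp (\<bar>T\<bar> * norm S))"
        using sums_mult[OF exp_sums_scaled[of "\<bar>T\<bar>" "norm S"], of "\<bar>T\<bar>"] by simp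
      fix n
      have "norm ((T ^ Suc n / fact (Suc n)) * norm S ^ n) = (\<bar>T\<bar> ^ Suc n / fact (Suc n)) * norm S ^ n"
        by (simp add: power_abs abs_mult)
      also have "\<dots> \<le> (\<bar>T\<bar> ^ Suc n / fact n) * norm S ^ n"
        by (intro mult_right_mono divide_left_mono fact_mono) auto
      finally show "norm ((T ^ Suc n / fact (Suc n)) * norm S ^ n) \<le> \<bar>T\<bar> * ((\<bar>T\<bar> ^ n / fact n) *\<^sub>R norm S ^ n)" by simp
    qed
  qed
qed (auto intro!: always_eventually continuous_intros)

lemma phi_real_sums:
  fixes k :: real
  assumes "0 < k"
  shows "(\<lambda>n. (t ^ Suc n / fact (Suc n)) * k ^ n) sums ((exp (t * k) - 1) / k)"
proof -
  have "(\<lambda>n. (t ^ Suc n / fact (Suc n)) * k ^ Suc n) sums (exp (t * k) - 1)"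
    using sums_Suc_iff[of "\<lambda>n. (t ^ n / fact n) * k ^ n" "exp (t * k) - 1"] exp_sums_scaled[of t k] by simp
  then have "(\<lambda>n. (t ^ Suc n / fact (Suc n)) * k ^ Suc n / k) sums ((exp (t * k) - 1) / k)"
    by (rule sums_divide)
  moreover have "a * k ^ Suc n / k = a * k ^ n" for a n using assms by simp
  ultimately show ?thesis by (simp only:)
qed

lemma dom_phi:
  assumes "dom_op l k S" "0 \<le> t" "0 < k"
  shows "dom_op l ((exp (t * k) - 1) / k) (phi_op t S)"
proof (rule dom_op_sums[OF _ phi_summable(2) phi_real_sums])
  show "dom_op l ((t ^ Suc n / fact (Suc n)) * k ^ n) ((t ^ Suc n / fact (Suc n)) *\<^sub>R S ^ n)" for n
    using assms by (intro dom_op_scale dom_op_power) auto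
qed fact

lemma adj_phi:
  assumes "adj_op k S" "0 \<le> t"
  shows "adj_op (t * exp (t * k)) (phi_op t S)"
proof (rule adj_op_sums[OF _ phi_summable(2)])
  show "adj_op (t * ((t ^ n / fact n) *\<^sub>R k ^ n)) ((t ^ Suc n / fact (Suc n)) *\<^sub>R S ^ n)" for n
  proof (rule adj_op_mono)
    show "adj_op (\<bar>t ^ Suc n / fact (Suc n)\<bar> * k ^ n) ((t ^ Suc n / fact (Suc n)) *\<^sub>R S ^ n)"
      using assms by (intro adj_op_scale adj_op_power)
    have "(t ^ Suc n / fact (Suc n)) * k ^ n \<le> (t ^ Suc n / fact n) * k ^ n"
      using assms adj_op_nonneg[OF assms(1)] by (intro mult_right_mono divide_left_mono fact_mono) auto
    then show "\<bar>t ^ Suc n / fact (Suc n)\<bar> * k ^ n \<le> t * ((t ^ n / fact n) *\<^sub>R k ^ n)"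
      using assms(2) by simp
  qed
  show "(\<lambda>n. t * ((t ^ n / fact n) *\<^sub>R k ^ n)) sums (t * exp (t * k))"
    using sums_mult[OF exp_sums_scaled[of t k], of t] by simp
qed

lemma dom_cps:
  assumes g: "jump_density g" and e: "integrable lborel (\<lambda>z. exp (- (l \<bullet> z)) * g z)" and t: "0 \<le> t"
  shows "dom_op l (exp (t * (LINT z|lborel. (exp (- (l \<bullet> z)) - 1) * g z))) (cps g t)"
proof -
  note D = jump_densityD[OF g]
  let ?m = "LINT z|lborel. g z" and ?k = "LINT z|lborel. exp (- (l \<bullet> z)) * g z"
  have eq: "(LINT z|lborel. (exp (- (l \<bullet> z)) - 1) * g z) = ?k - ?m"
    using e D(1) by (simp add: left_diff_distrib)
  have "exp (- (t * ?m)) * exp (t * ?k) = exp (t * (?k - ?m))"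
    unfolding mult_exp_exp right_diff_distrib by simp
  then show ?thesis
    using dom_op_scale[OF dom_exp[OF dom_conv_op[OF D(1) D(2) e] t], of "exp (- (t * ?m))"]
    unfolding cps_eq eq by (simp only: exp_ge_zero)
qed

lemma adj_cps:
  assumes g: "jump_density g" and t: "0 \<le> t"
  shows "adj_op 1 (cps g t)"
  using adj_op_scale[OF adj_exp[OF adj_conv_op[OF jump_densityD(1-3)[OF g]] t], of "exp (- (t * (LINT z|lborel. g z)))"]
  by (simp add: cps_eq mult_exp_exp)

lemma dom_cps0:
  assumes "jump_density g" "0 \<le> t"
  shows "dom_op 0 1 (cps g t)"
  using dom_cps[OF assms(1) _ assms(2), of 0] assms(1) by (simp add: jump_densityD)

lemma cps_decomp:
  "cps g t = exp (- (t * (LINT z|lborel. g z))) *\<^sub>R (1 + conv_op g * phi_op t (conv_op g))"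
  by (simp add: cps_eq exp_eq_phi)

text \<open>A jump density bounded by \<open>V\<close> adds at most \<open>t * V\<close> times the mass: a path either
  stays put, or its first jump already spreads the mass with density at most \<open>V\<close>.\<close>
lemma cps_bounded_density:
  fixes \<phi> :: "'a::euclidean_space \<Rightarrow>\<^sub>C real"
  assumes g: "jump_density g" and t: "0 \<le> t" and V: "\<And>z. g z \<le> V"
    and \<phi>: "integrable lborel (apply_bcontfun \<phi>)" and pos: "\<And>x. 0 \<le> apply_bcontfun \<phi> x"
  shows "ap (cps g t) \<phi> x \<le> \<phi> x + t * V * (LINT y|lborel. \<phi> y)"
proof -
  note D = jump_densityD[OF g]
  let ?m = "LINT z|lborel. g z" and ?P = "phi_op t (conv_op g)"
  have dc: "dom_op 0 ?m (conv_op g)" using dom_conv_op[OF D(1,2), of 0] D(1) by simp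
  have Ppos: "0 \<le> ap ?P \<phi> y" for y
  proof -
    have "dom_op 0 (?m + 1) (conv_op g)" by (rule dom_op_mono[OF dc]) simp
    then have "dom_op 0 ((exp (t * (?m + 1)) - 1) / (?m + 1)) ?P"
      using t jump_density_mass_nonneg[OF g] by (intro dom_phi) auto
    then show ?thesis
      by (rule dom_opD(1)[where B = "norm \<phi>"]) (use pos abs_apply_le_norm[of \<phi>] in \<open>auto simp: abs_le_iff\<close>)
  qed
  note A = adj_opD[OF adj_phi[OF adj_conv_op[OF D] t] \<phi>]
  have "ap (conv_op g) (ap ?P \<phi>) x = (LINT z|lborel. g z * ap ?P \<phi> (x + z))"
    by (rule conv_op_apply[OF D(1)])
  also have "\<dots> \<le> (LINT z|lborel. V * ap ?P \<phi> (x + z))"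
  proof (rule integral_mono)
    have "integrable lborel (\<lambda>z. ap ?P \<phi> (z + x))"
      using A(1) by (simp add: integral_lborel_translate)
    then show "integrable lborel (\<lambda>z. V * ap ?P \<phi> (x + z))" by (simp add: add.commute)
    show "integrable lborel (\<lambda>z. g z * ap ?P \<phi> (x + z))" by (rule integrable_mult_bcontfun[OF D(1)])
    show "g z * ap ?P \<phi> (x + z) \<le> V * ap ?P \<phi> (x + z)" for z by (intro mult_right_mono V Ppos)
  qed
  also have "\<dots> = V * (LINT z|lborel. ap ?P \<phi> z)"
    using integral_lborel_translate(2)[of "apply_bcontfun (ap ?P \<phi>)" x] by (simp add: add.commute)
  also have "\<dots> \<le> V * (t * exp (t * ?m) * (LINT y|lborel. \<phi> y))"
    using A(2) Ppos pos V[of 0] D(2)[of 0] by (intro mult_left_mono) auto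
  finally have "exp (- (t * ?m)) * ap (conv_op g) (ap ?P \<phi>) x \<le> exp (- (t * ?m)) * (V * (t * exp (t * ?m) * (LINT y|lborel. \<phi> y)))"
    by (rule mult_left_mono) simp
  also have "\<dots> = t * V * (LINT y|lborel. \<phi> y)" by (simp add: exp_minus field_simps)
  finally have "exp (- (t * ?m)) * ap (conv_op g) (ap ?P \<phi>) x \<le> t * V * (LINT y|lborel. \<phi> y)" .
  moreover have "exp (- (t * ?m)) * \<phi> x \<le> 1 * \<phi> x"
    using t jump_density_mass_nonneg[OF g] by (intro mult_right_mono pos) auto
  moreover have "ap (cps g t) \<phi> x = exp (- (t * ?m)) * \<phi> x + exp (- (t * ?m)) * ap (conv_op g) (ap ?P \<phi>) x"
    by (simp add: cps_decomp ap.scaleR_left ap.add_left ap_mult plus_bcontfun.rep_eq ring_distribs)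
  ultimately show ?thesis by linarith
qed

section \<open>Second differences\<close>

text \<open>\<open>second_diff K \<phi>\<close> is a quantitative form of \<open>C\<^sup>1\<^sup>,\<^sup>1\<close> regularity, which every bounded
  operator commuting with translations preserves.\<close>
definition second_diff :: "real \<Rightarrow> ('a::euclidean_space \<Rightarrow>\<^sub>C real) \<Rightarrow> bool" where
  "second_diff K \<phi> \<longleftrightarrow> (\<forall>x z. \<bar>\<phi> (x + z) + \<phi> (x - z) - 2 * \<phi> x\<bar> \<le> K * (norm z)\<^sup>2)"

lemma second_diff_ap:
  fixes \<phi> :: "'a::euclidean_space \<Rightarrow>\<^sub>C real"
  assumes \<phi>: "second_diff K \<phi>" and comm: "\<And>z. S * shift_op z = shift_op z * S" and n: "norm S \<le> k"
  shows "second_diff (k * K) (ap S \<phi>)"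
  unfolding second_diff_def
proof (intro allI)
  fix x z
  let ?D = "shift_op z + shift_op (- z) - 2 *\<^sub>R 1 :: 'a cop"
  have Dx: "ap ?D \<psi> x = \<psi> (x + z) + \<psi> (x - z) - 2 * \<psi> x" for \<psi> x
    by (simp add: ap.add_left ap.diff_left ap.scaleR_left plus_bcontfun.rep_eq minus_bcontfun.rep_eq)
  have "norm (ap ?D \<phi>) \<le> K * (norm z)\<^sup>2"
    by (rule norm_bound) (use \<phi> in \<open>simp add: Dx second_diff_def\<close>)
  then have *: "norm S * norm (ap ?D \<phi>) \<le> k * (K * (norm z)\<^sup>2)"
    by (rule mult_mono[OF n]) (use n norm_ge_zero[of S] in linarith, simp)
  have SD: "S * ?D = ?D * S"
    using comm[of z] comm[of "- z"] by (simp add: algebra_simps)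
  have "\<bar>ap S \<phi> (x + z) + ap S \<phi> (x - z) - 2 * ap S \<phi> x\<bar> = \<bar>ap (?D * S) \<phi> x\<bar>"
    by (simp only: ap_mult Dx)
  also have "\<dots> = \<bar>ap S (ap ?D \<phi>) x\<bar>" by (simp only: SD[symmetric] ap_mult)
  also have "\<dots> \<le> norm S * norm (ap ?D \<phi>)"
    using abs_apply_le_norm norm_ap order_trans by blast
  finally show "\<bar>ap S \<phi> (x + z) + ap S \<phi> (x - z) - 2 * ap S \<phi> x\<bar> \<le> k * K * (norm z)\<^sup>2"
    using * by (simp add: mult.assoc)
qed

lemma second_diff_add:
  assumes "second_diff K \<phi>" "second_diff L \<psi>"
  shows "second_diff (K + L) (\<phi> + \<psi>)"
  unfolding second_diff_def
proof (intro allI)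
  fix x z
  have "\<bar>\<phi> (x + z) + \<phi> (x - z) - 2 * \<phi> x\<bar> \<le> K * (norm z)\<^sup>2" "\<bar>\<psi> (x + z) + \<psi> (x - z) - 2 * \<psi> x\<bar> \<le> L * (norm z)\<^sup>2"
    using assms by (auto simp: second_diff_def)
  then show "\<bar>(\<phi> + \<psi>) (x + z) + (\<phi> + \<psi>) (x - z) - 2 * (\<phi> + \<psi>) x\<bar> \<le> (K + L) * (norm z)\<^sup>2"
    by (simp add: plus_bcontfun.rep_eq distrib_right)
qed

lemma gen_op_apply:
  assumes g: "jump_density g"
  shows "ap (gen_op g) \<phi> x = (LINT z|lborel. g z * (\<phi> (x + z) - \<phi> x))"
    and "ap (gen_op g) \<phi> x = (LINT z|lborel. g z * (\<phi> (x + z) + \<phi> (x - z) - 2 * \<phi> x)) / 2"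
    and "integrable lborel (\<lambda>z. g z * (\<phi> (x + z) + \<phi> (x - z) - 2 * \<phi> x))"
proof -
  note D = jump_densityD[OF g]
  note [measurable] = D(1)
  note i = integrable_mult_bcontfun[OF D(1), of \<phi> x]
  show 1: "ap (gen_op g) \<phi> x = (LINT z|lborel. g z * (\<phi> (x + z) - \<phi> x))"
    using i D(1) by (simp add: gen_op_def ap.diff_left ap.scaleR_left minus_bcontfun.rep_eq conv_op_apply[OF D(1)] right_diff_distrib)
  let ?f = "\<lambda>z. g z * (\<phi> (x + z) - \<phi> x)"
  have i1: "integrable lborel ?f" using i D(1) by (simp add: right_diff_distrib)
  have i2: "integrable lborel (\<lambda>z. ?f (- z))" and e2: "(LINT z|lborel. ?f (- z)) = (LINT z|lborel. ?f z)"
    using integral_lborel_reflect[of ?f] i1 by auto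
  have eq: "g z * (\<phi> (x + z) + \<phi> (x - z) - 2 * \<phi> x) = ?f z + ?f (- z)" for z
    by (simp add: D(3) algebra_simps)
  show "integrable lborel (\<lambda>z. g z * (\<phi> (x + z) + \<phi> (x - z) - 2 * \<phi> x))"
    unfolding eq using i1 i2 by (rule Bochner_Integration.integrable_add)
  have "(LINT z|lborel. g z * (\<phi> (x + z) + \<phi> (x - z) - 2 * \<phi> x)) = 2 * (LINT z|lborel. ?f z)"
    unfolding eq Bochner_Integration.integral_add[OF i1 i2] e2 by simp
  then show "ap (gen_op g) \<phi> x = (LINT z|lborel. g z * (\<phi> (x + z) + \<phi> (x - z) - 2 * \<phi> x)) / 2"
    unfolding 1 by simp
qed

lemma norm_gen_second_diff:
  assumes g: "jump_density g" and \<phi>: "second_diff K \<phi>" and i: "integrable lborel (\<lambda>z. (norm z)\<^sup>2 * g z)"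
  shows "norm (ap (gen_op g) \<phi>) \<le> K / 2 * (LINT z|lborel. (norm z)\<^sup>2 * g z)"
proof (rule norm_bound)
  fix x
  note D = jump_densityD[OF g]
  have "\<bar>LINT z|lborel. g z * (\<phi> (x + z) + \<phi> (x - z) - 2 * \<phi> x)\<bar> \<le> (LINT z|lborel. \<bar>g z * (\<phi> (x + z) + \<phi> (x - z) - 2 * \<phi> x)\<bar>)"
    by (rule integral_abs_bound)
  also have "\<dots> \<le> (LINT z|lborel. K * ((norm z)\<^sup>2 * g z))"
  proof (rule integral_mono)
    show "\<bar>g z * (\<phi> (x + z) + \<phi> (x - z) - 2 * \<phi> x)\<bar> \<le> K * ((norm z)\<^sup>2 * g z)" for z
    proof -
      have "g z * \<bar>\<phi> (x + z) + \<phi> (x - z) - 2 * \<phi> x\<bar> \<le> g z * (K * (norm z)\<^sup>2)"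
        using \<phi> D(2) by (intro mult_left_mono) (auto simp: second_diff_def)
      then show ?thesis using D(2)[of z] by (simp add: abs_mult ac_simps)
    qed
  qed (use i gen_op_apply(3)[OF g, of \<phi> x, THEN integrable_abs] in auto)
  finally show "norm (ap (gen_op g) \<phi> x) \<le> K / 2 * (LINT z|lborel. (norm z)\<^sup>2 * g z)"
    unfolding gen_op_apply(2)[OF g] by simp
qed

section \<open>Markov operators\<close>

text \<open>The common properties of the semigroups above and of their products: contractions in the uniform and in the
  \<open>L\<^sup>1\<close> norm that are positive and symmetric, and commute with translations and convolutions.\<close>
definition markov_op :: "'a::euclidean_space cop \<Rightarrow> bool" where
  "markov_op S \<longleftrightarrow> norm S \<le> 1 \<and> adj_op 1 S \<and> dom_op 0 1 S \<and>
     (\<forall>z. S * shift_op z = shift_op z * S) \<and>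
     (\<forall>k. jump_density k \<longrightarrow> S * conv_op k = conv_op k * S)"

lemma markov_cps: "jump_density g \<Longrightarrow> 0 \<le> t \<Longrightarrow> markov_op (cps g t)"
  by (simp add: markov_op_def norm_cps adj_cps dom_cps0 cps_shift_commute cps_conv_commute)

lemma markov_cps_commute:
  assumes "markov_op S" "jump_density k"
  shows "S * cps k t = cps k t * S"
  using assms by (intro cps_commute[symmetric]) (auto simp: markov_op_def)

lemma markov_mult_cps:
  assumes S: "markov_op S" and k: "jump_density k" and t: "0 \<le> t"
  shows "markov_op (S * cps k t)"
  unfolding markov_op_def
proof (intro conjI allI impI)
  let ?T = "cps k t"
  have T: "markov_op ?T" by (rule markov_cps[OF k t])
  have "norm (S * ?T) \<le> norm S * norm ?T" by (rule norm_mult_ineq)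
  also have "\<dots> \<le> 1 * 1" using S T by (intro mult_mono) (auto simp: markov_op_def)
  finally show "norm (S * ?T) \<le> 1" by simp
  show "adj_op 1 (S * ?T)"
    using adj_op_mult[OF _ _ markov_cps_commute[OF S k], of 1 1] S T by (simp add: markov_op_def)
  show "dom_op 0 1 (S * ?T)" using dom_op_mult[of 0 1 S 1 ?T] S T by (simp add: markov_op_def)
  fix z
  have 1: "?T * shift_op z = shift_op z * ?T" "S * shift_op z = shift_op z * S"
    using S T by (auto simp: markov_op_def)
  have "S * ?T * shift_op z = S * shift_op z * ?T" by (simp only: mult.assoc 1(1))
  then show "S * ?T * shift_op z = shift_op z * (S * ?T)" by (simp only: 1(2) mult.assoc)
next
  let ?T = "cps k t"
  fix j :: "'a \<Rightarrow> real" assume j: "jump_density j"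
  have 1: "?T * conv_op j = conv_op j * ?T" "S * conv_op j = conv_op j * S"
    using S markov_cps[OF k t] j by (auto simp: markov_op_def)
  have "S * ?T * conv_op j = S * conv_op j * ?T" by (simp only: mult.assoc 1(1))
  then show "S * ?T * conv_op j = conv_op j * (S * ?T)" by (simp only: 1(2) mult.assoc)
qed

lemma markov_pos:
  assumes "markov_op S" "\<And>x. 0 \<le> apply_bcontfun \<phi> x"
  shows "0 \<le> ap S \<phi> x"
proof -
  have "dom_op 0 1 S" using assms by (simp add: markov_op_def)
  then show ?thesis
    by (rule dom_opD(1)[where B = "norm \<phi>"]) (use assms(2) abs_apply_le_norm[of \<phi>] in \<open>auto simp: abs_le_iff\<close>)
qed

lemma markov_le:
  assumes "markov_op S" "\<And>x. 0 \<le> apply_bcontfun \<phi> x" "\<And>x. apply_bcontfun \<phi> x \<le> B" "0 \<le> B"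
  shows "ap S \<phi> x \<le> B"
proof -
  have "dom_op 0 1 S" using assms by (simp add: markov_op_def)
  from dom_opD(2)[OF this, of B \<phi> x] assms show ?thesis by simp
qed

lemma markov_abs_le:
  assumes "markov_op S"
  shows "\<bar>ap S \<phi> x\<bar> \<le> norm \<phi>"
proof -
  have "\<bar>ap S \<phi> x\<bar> \<le> norm (ap S \<phi>)" by (rule abs_apply_le_norm)
  also have "\<dots> \<le> norm S * norm \<phi>" by (rule norm_ap)
  also have "\<dots> \<le> 1 * norm \<phi>" using assms by (intro mult_right_mono) (auto simp: markov_op_def)
  finally show ?thesis by simp
qed

lemma ap_shift_zero:
  assumes "S * shift_op x = shift_op x * S"
  shows "ap S \<phi> x = ap S (ap (shift_op x) \<phi>) 0"
proof -
  have "ap S (ap (shift_op x) \<phi>) 0 = ap (shift_op x * S) \<phi> 0" by (simp only: assms[symmetric] ap_mult)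
  then show ?thesis by (simp add: ap_mult)
qed

section \<open>The multi-scale decomposition\<close>

text \<open>The jumps with densities \<open>g n\<close> are added one scale after the other to a process with jump
  density \<open>h\<close>; \<open>Ps t n\<close> is the transition operator over time \<open>t\<close> once the scales below \<open>n\<close> have been added. Each
  \<open>g n\<close> dominates a regular density \<open>\<nu> n\<close> (as a bounded continuous function: \<open>\<nu>b n\<close>), and \<open>Qs t n\<close> is the density
  of the part of the law at time \<open>t\<close> on which some jump of a regular part has occurred; \<open>Am t n\<close> is the
  probability that there was none, and \<open>Zs t n\<close> the transition operator conditioned on this event.\<close>

locale scale_scheme =
  fixes h :: "'a::euclidean_space \<Rightarrow> real" and g \<nu> :: "nat \<Rightarrow> 'a \<Rightarrow> real" and \<nu>b :: "nat \<Rightarrow> 'a \<Rightarrow>\<^sub>C real"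
  assumes h: "jump_density h" and g: "\<And>n. jump_density (g n)" and \<nu>: "\<And>n. jump_density (\<nu> n)"
    and \<nu>_le: "\<And>n z. \<nu> n z \<le> g n z" and \<nu>b: "\<And>n. apply_bcontfun (\<nu>b n) = \<nu> n"
    and \<nu>_mass: "\<And>n. 0 < (LINT z|lborel. \<nu> n z)"
begin

text \<open>The part of the jumps of scale \<open>n\<close> that is not used for regularisation.\<close>
definition eta :: "nat \<Rightarrow> 'a \<Rightarrow> real" where "eta n z = g n z - \<nu> n z"

abbreviation mass :: "nat \<Rightarrow> real" where "mass n \<equiv> LINT z|lborel. \<nu> n z"

definition Am :: "real \<Rightarrow> nat \<Rightarrow> real" where "Am t n = exp (- (t * (\<Sum>k<n. mass k)))"

primrec Zs :: "real \<Rightarrow> nat \<Rightarrow> 'a cop" where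
  "Zs t 0 = cps h t"
| "Zs t (Suc n) = Zs t n * cps (eta n) t"

primrec Ps :: "real \<Rightarrow> nat \<Rightarrow> 'a cop" where
  "Ps t 0 = cps h t"
| "Ps t (Suc n) = Ps t n * cps (g n) t"

primrec Qs :: "real \<Rightarrow> nat \<Rightarrow> 'a \<Rightarrow>\<^sub>C real" where
  "Qs t 0 = 0"
| "Qs t (Suc n) = ap (cps (g n) t) (Qs t n) +
     Am t (Suc n) *\<^sub>R ap (Zs t n * cps (eta n) t * phi_op t (conv_op (\<nu> n))) (\<nu>b n)"

lemma eta: "jump_density (eta n)"
  using g[of n] \<nu>[of n] \<nu>_le[of n] by (simp add: jump_density_def eta_def[abs_def])

lemma g_split: "g n = (\<lambda>z. eta n z + \<nu> n z)"
  by (simp add: eta_def fun_eq_iff)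

lemma Am_Suc: "Am t (Suc n) = Am t n * exp (- (t * mass n))"
  by (simp add: Am_def mult_exp_exp algebra_simps)

lemma Am_pos: "0 < Am t n" by (simp add: Am_def)

lemma markov_Zs: "0 \<le> t \<Longrightarrow> markov_op (Zs t n)"
  by (induction n) (auto intro: markov_cps h eta markov_mult_cps)

lemma markov_Ps: "0 \<le> t \<Longrightarrow> markov_op (Ps t n)"
  by (induction n) (auto intro: markov_cps h g markov_mult_cps)

lemma Ps_eq: "Ps t n = cps (\<lambda>z. h z + (\<Sum>k<n. g k z)) t"
proof (induction n)
  case (Suc n)
  have j: "jump_density (\<lambda>z. h z + (\<Sum>k<n. g k z))"
    using h g by (auto simp: jump_density_def intro!: Bochner_Integration.integrable_add Bochner_Integration.integrable_sum add_nonneg_nonneg sum_nonneg)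
  show ?case using cps_add[OF j g[of n], of t] Suc by (simp add: add.assoc)
qed simp

lemma adj_ZPhi:
  assumes t: "0 \<le> t"
  shows "adj_op (1 * (t * exp (t * mass n))) (Zs t (Suc n) * phi_op t (conv_op (\<nu> n)))"
proof (rule adj_op_mult)
  show "adj_op 1 (Zs t (Suc n))" using markov_Zs[OF t] unfolding markov_op_def by blast
  show "adj_op (t * exp (t * mass n)) (phi_op t (conv_op (\<nu> n)))"
    by (rule adj_phi[OF adj_conv_op t]) (use jump_densityD[OF \<nu>] in auto)
  show "Zs t (Suc n) * phi_op t (conv_op (\<nu> n)) = phi_op t (conv_op (\<nu> n)) * Zs t (Suc n)"
    by (rule phi_commute[symmetric]) (use markov_Zs[OF t, of "Suc n"] \<nu>[of n] in \<open>auto simp only: markov_op_def\<close>)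
qed

lemma decomp0:
  fixes \<phi> :: "'a \<Rightarrow>\<^sub>C real"
  assumes t: "0 \<le> t" and \<phi>: "integrable lborel (apply_bcontfun \<phi>)"
  shows "ap (Ps t n) \<phi> 0 = (LINT y|lborel. Qs t n y * \<phi> y) + Am t n * ap (Zs t n) \<phi> 0"
  using \<phi>
proof (induction n arbitrary: \<phi>)
  case 0
  show ?case by (simp add: Am_def)
next
  case (Suc n)
  let ?T = "cps (g n) t" and ?Z = "Zs t (Suc n)" and ?F = "phi_op t (conv_op (\<nu> n))" and ?C = "conv_op (\<nu> n)"
  note i = jump_densityD(1)[OF \<nu>[of n]]
  have T: "adj_op 1 ?T" by (rule adj_cps[OF g t])
  note AT = adj_opD[OF T Suc.prems]
  note AZ = adj_opD[OF adj_ZPhi[OF t, of n] Suc.prems]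
  have Tsplit: "?T = cps (eta n) t * cps (\<nu> n) t"
    by (subst g_split, rule cps_add[OF eta \<nu>])
  have ZC: "?Z * ?C = ?C * ?Z" using markov_Zs[OF t, of "Suc n"] \<nu>[of n] unfolding markov_op_def by blast
  have "Zs t n * ?T = exp (- (t * mass n)) *\<^sub>R (?Z + ?Z * ?C * ?F)"
    by (simp add: Tsplit cps_decomp[of "\<nu> n"] algebra_simps)
  also have "?Z * ?C * ?F = ?C * (?Z * ?F)" by (simp only: ZC mult.assoc)
  finally have ZT: "Zs t n * ?T = exp (- (t * mass n)) *\<^sub>R (?Z + ?C * (?Z * ?F))" .
  have C0: "ap (?C * (?Z * ?F)) \<phi> 0 = (LINT y|lborel. ap (?Z * ?F) (\<nu>b n) y * \<phi> y)"
  proof -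
    have "ap (?C * (?Z * ?F)) \<phi> 0 = (LINT y|lborel. \<nu>b n y * ap (?Z * ?F) \<phi> y)"
      by (subst ap_mult) (simp add: conv_op_apply[OF i] \<nu>b)
    then show ?thesis by (simp only: AZ(3))
  qed
  have "ap (Ps t (Suc n)) \<phi> 0 = ap (Ps t n) (ap ?T \<phi>) 0" by (simp add: ap_mult)
  also have "\<dots> = (LINT y|lborel. Qs t n y * ap ?T \<phi> y) + Am t n * ap (Zs t n) (ap ?T \<phi>) 0"
    by (rule Suc.IH[OF AT(1)])
  also have "(LINT y|lborel. Qs t n y * ap ?T \<phi> y) = (LINT y|lborel. ap ?T (Qs t n) y * \<phi> y)"
    by (rule AT(3)[symmetric])
  also have "ap (Zs t n) (ap ?T \<phi>) 0 = exp (- (t * mass n)) * (ap ?Z \<phi> 0 + ap (?C * (?Z * ?F)) \<phi> 0)"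
    unfolding ap_mult[of "Zs t n" ?T \<phi>, symmetric] ZT by (simp only: ap.scaleR_left ap.add_left apply_scaleR plus_bcontfun.rep_eq)
  also have "Am t n * \<dots> = Am t (Suc n) * ap ?Z \<phi> 0 + Am t (Suc n) * (LINT y|lborel. ap (?Z * ?F) (\<nu>b n) y * \<phi> y)"
    unfolding Am_Suc C0 by (simp only: ring_distribs mult.assoc)
  also have "(LINT y|lborel. ap ?T (Qs t n) y * \<phi> y) + \<dots> = (LINT y|lborel. Qs t (Suc n) y * \<phi> y) + Am t (Suc n) * ap ?Z \<phi> 0"
  proof -
    have "(LINT y|lborel. Qs t (Suc n) y * \<phi> y) = (LINT y|lborel. ap ?T (Qs t n) y * \<phi> y + Am t (Suc n) * (ap (?Z * ?F) (\<nu>b n) y * \<phi> y))"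
      by (rule Bochner_Integration.integral_cong) (simp_all add: plus_bcontfun.rep_eq ring_distribs)
    also have "\<dots> = (LINT y|lborel. ap ?T (Qs t n) y * \<phi> y) + Am t (Suc n) * (LINT y|lborel. ap (?Z * ?F) (\<nu>b n) y * \<phi> y)"
      by (subst Bochner_Integration.integral_add)
         (use integrable_mult_bcontfun'(2)[OF Suc.prems] in \<open>auto simp del: Zs.simps\<close>)
    finally show ?thesis by simp
  qed
  finally show ?case .
qed

lemma decomp:
  fixes \<phi> :: "'a \<Rightarrow>\<^sub>C real"
  assumes t: "0 \<le> t" and \<phi>: "integrable lborel (apply_bcontfun \<phi>)"
  shows "ap (Ps t n) \<phi> x = (LINT y|lborel. Qs t n y * \<phi> (x + y)) + Am t n * ap (Zs t n) \<phi> x"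
proof -
  have i: "integrable lborel (apply_bcontfun (ap (shift_op x) \<phi>))"
    using \<phi> integral_lborel_translate(1)[of "apply_bcontfun \<phi>" x] by (simp add: shift_op_apply[abs_def])
  have "Ps t n * shift_op x = shift_op x * Ps t n" "Zs t n * shift_op x = shift_op x * Zs t n"
    using markov_Ps[OF t] markov_Zs[OF t] by (auto simp: markov_op_def)
  then show ?thesis
    using decomp0[OF t i, of n] by (simp add: ap_shift_zero[of _ x] add.commute)
qed

lemma Qs_nonneg:
  assumes t: "0 \<le> t"
  shows "0 \<le> Qs t n y"
proof (induction n arbitrary: y)
  case 0 show ?case by simp
next
  case (Suc n)
  have F: "dom_op 0 ((exp (t * mass n) - 1) / mass n) (phi_op t (conv_op (\<nu> n)))"
    using dom_conv_op[OF jump_densityD(1,2)[OF \<nu>], of 0 n] jump_densityD(1)[OF \<nu>, of n] by (intro dom_phi t \<nu>_mass) simp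
  have 1: "0 \<le> ap (phi_op t (conv_op (\<nu> n))) (\<nu>b n) y" for y
    using dom_opD(1)[OF F, of "norm (\<nu>b n)" "\<nu>b n"] abs_apply_le_norm[of "\<nu>b n"] jump_densityD(2)[OF \<nu>, of n]
    by (auto simp: abs_le_iff \<nu>b)
  have "markov_op (Zs t n * cps (eta n) t)" using markov_Zs[OF t, of "Suc n"] by simp
  from markov_pos[OF this 1] markov_pos[OF markov_cps[OF g[of n] t] Suc] Am_pos[of t "Suc n"]
  show ?case by (simp add: plus_bcontfun.rep_eq ap_mult)
qed

lemma integral_exp_minus_one:
  fixes k :: "'a \<Rightarrow> real"
  assumes k: "jump_density k" and e: "integrable lborel (\<lambda>z. exp (- (l \<bullet> z)) * k z)"
  shows "0 \<le> (LINT z|lborel. (exp (- (l \<bullet> z)) - 1) * k z)"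
proof -
  note D = jump_densityD[OF k]
  note [measurable] = D(1)
  let ?f = "\<lambda>z. (exp (- (l \<bullet> z)) - 1) * k z"
  have i: "integrable lborel ?f" using e D(1) by (simp add: left_diff_distrib)
  have i2: "integrable lborel (\<lambda>z. ?f (- z))" and e2: "(LINT z|lborel. ?f (- z)) = (LINT z|lborel. ?f z)"
    using integral_lborel_reflect[of ?f] i by auto
  have "0 \<le> (LINT z|lborel. ?f z + ?f (- z))"
  proof (rule integral_nonneg_AE, rule AE_I2)
    fix z
    have "(exp (l \<bullet> z / 2) - exp (- (l \<bullet> z / 2)))\<^sup>2 = exp (l \<bullet> z) + exp (- (l \<bullet> z)) - 2"
    proof -
      have "exp (l \<bullet> z / 2) * exp (l \<bullet> z / 2) = exp (l \<bullet> z)" "exp (- (l \<bullet> z / 2)) * exp (- (l \<bullet> z / 2)) = exp (- (l \<bullet> z))"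
        "exp (l \<bullet> z / 2) * exp (- (l \<bullet> z / 2)) = 1" by (simp_all add: mult_exp_exp)
      then show ?thesis by (simp add: power2_eq_square left_diff_distrib right_diff_distrib mult.commute)
    qed
    then have "0 \<le> exp (l \<bullet> z) + exp (- (l \<bullet> z)) - 2" by (metis zero_le_power2)
    then have "0 \<le> (exp (l \<bullet> z) + exp (- (l \<bullet> z)) - 2) * k z" using D(2) by simp
    then show "0 \<le> ?f z + ?f (- z)" by (simp add: D(3) algebra_simps)
  qed
  then show ?thesis using i i2 e2 by simp
qed

text \<open>The pointwise bound of the regular density with an exponential weight. The factor with \<open>J\<close> is the
  exponential moment of the whole process; the sum does not depend on the weight except through \<open>V\<close>.\<close>
lemma Qs_weighted_bound:
  fixes l :: 'a
  defines "J \<equiv> \<lambda>k. LINT z|lborel. (exp (- (l \<bullet> z)) - 1) * k z"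
  assumes t: "0 \<le> t"
    and eh: "integrable lborel (\<lambda>z. exp (- (l \<bullet> z)) * h z)"
    and eg: "\<And>n. integrable lborel (\<lambda>z. exp (- (l \<bullet> z)) * g n z)"
    and V: "\<And>n z. \<nu> n z \<le> V n * exp (- (l \<bullet> z))"
  shows "Qs t n y \<le> exp (t * (J h + (\<Sum>k<n. J (g k)))) * (\<Sum>k<n. Am t k * V k / mass k) * exp (- (l \<bullet> y))"
proof -
  have Vpos: "0 \<le> V n" for n
    using V[of n 0] jump_densityD(2)[OF \<nu>, of n 0] by simp
  have e\<nu>: "integrable lborel (\<lambda>z. exp (- (l \<bullet> z)) * \<nu> n z)" for n
    by (rule Bochner_Integration.integrable_bound[OF eg[of n]])
       (use jump_densityD[OF \<nu>, of n] jump_densityD[OF g, of n] \<nu>_le[of n] in \<open>auto simp: abs_mult intro!: mult_left_mono\<close>)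
  have ee: "integrable lborel (\<lambda>z. exp (- (l \<bullet> z)) * eta n z)" for n
    using eg[of n] e\<nu>[of n] by (simp add: eta_def right_diff_distrib)
  have Jn: "0 \<le> J (\<nu> n)" "0 \<le> J (g n)" "0 \<le> J h" for n
    unfolding J_def using e\<nu> eg eh \<nu> g h by (auto intro!: integral_exp_minus_one)
  have Je: "J (eta n) + J (\<nu> n) = J (g n)" for n
  proof -
    have "integrable lborel (\<lambda>z. (exp (- (l \<bullet> z)) - 1) * eta n z)" "integrable lborel (\<lambda>z. (exp (- (l \<bullet> z)) - 1) * \<nu> n z)"
      using e\<nu> ee jump_densityD(1)[OF eta] jump_densityD(1)[OF \<nu>] by (auto simp: left_diff_distrib)
    from Bochner_Integration.integral_add[OF this] show ?thesis
      unfolding J_def by (simp add: eta_def flip: distrib_left)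
  qed
  have Zdom: "dom_op l (exp (t * (J h + (\<Sum>k<n. J (eta k))))) (Zs t n)" for n
  proof (induction n)
    case 0 show ?case using dom_cps[OF h eh t] by (simp add: J_def)
  next
    case (Suc n)
    have "exp (t * (J h + (\<Sum>k<Suc n. J (eta k)))) = exp (t * (J h + (\<Sum>k<n. J (eta k)))) * exp (t * J (eta n))"
      by (simp add: mult_exp_exp algebra_simps)
    then show ?case using dom_op_mult[OF Suc.IH dom_cps[OF eta ee t, of n]] by (simp add: J_def)
  qed
  show ?thesis
  proof (induction n arbitrary: y)
    case 0 show ?case by simp
  next
    case (Suc n)
    let ?E = "\<lambda>n. exp (t * (J h + (\<Sum>k<n. J (g k))))" and ?S = "\<lambda>n. \<Sum>k<n. Am t k * V k / mass k"
    let ?w = "exp (- (l \<bullet> y))"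
    have Spos: "0 \<le> ?S n" by (intro sum_nonneg divide_nonneg_pos mult_nonneg_nonneg Vpos \<nu>_mass less_imp_le[OF Am_pos])
    have 1: "ap (cps (g n) t) (Qs t n) y \<le> exp (t * J (g n)) * (?E n * ?S n) * ?w"
      unfolding J_def by (rule dom_opD(2)[OF dom_cps[OF g eg t]])
       (use Qs_nonneg[OF t] Suc.IH Spos in \<open>auto simp: J_def\<close>)
    let ?ml = "LINT z|lborel. exp (- (l \<bullet> z)) * \<nu> n z" and ?m = "mass n"
    have ml: "J (\<nu> n) = ?ml - ?m"
      unfolding J_def using e\<nu>[of n] jump_densityD(1)[OF \<nu>, of n] by (simp add: left_diff_distrib)
    then have mlm: "?m \<le> ?ml" "0 < ?ml" "0 < ?m" using Jn(1)[of n] \<nu>_mass[of n] by auto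
    have F: "dom_op l ((exp (t * ?ml) - 1) / ?ml) (phi_op t (conv_op (\<nu> n)))"
      using dom_conv_op[OF jump_densityD(1,2)[OF \<nu>] e\<nu>] by (intro dom_phi t mlm(2))
    have F': "dom_op l (exp (t * ?ml) / ?m) (phi_op t (conv_op (\<nu> n)))"
    proof (rule dom_op_mono[OF F])
      have "(exp (t * ?ml) - 1) / ?ml \<le> exp (t * ?ml) / ?ml" using mlm by (intro divide_right_mono) auto
      also have "\<dots> \<le> exp (t * ?ml) / ?m" using mlm by (intro divide_left_mono) auto
      finally show "(exp (t * ?ml) - 1) / ?ml \<le> exp (t * ?ml) / ?m" .
    qed
    let ?EZ = "exp (t * (J h + (\<Sum>k<Suc n. J (eta k))))"
    have ZF: "ap (Zs t (Suc n) * phi_op t (conv_op (\<nu> n))) (\<nu>b n) y \<le> ?EZ * (exp (t * ?ml) / ?m) * V n * ?w"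
      by (rule dom_opD(2)[OF dom_op_mult[OF Zdom F'] Vpos]) (use jump_densityD(2)[OF \<nu>, of n] V in \<open>auto simp: \<nu>b\<close>)
    have exps: "exp (- (t * ?m)) * (?EZ * exp (t * ?ml)) \<le> ?E (Suc n)"
    proof -
      have "exp (- (t * ?m)) * (?EZ * exp (t * ?ml)) = exp (t * (J h + (\<Sum>k<n. J (eta k)) + (J (eta n) + J (\<nu> n))))"
        unfolding ml by (simp add: mult_exp_exp algebra_simps)
      also have "\<dots> \<le> ?E (Suc n)"
      proof -
        have "(\<Sum>k<n. J (eta k)) \<le> (\<Sum>k<n. J (g k))"
          by (rule sum_mono) (use Je Jn(1) in \<open>smt (verit)\<close>)
        then show ?thesis using t unfolding Je by (auto intro!: mult_left_mono)
      qed
      finally show ?thesis .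
    qed
    have "Am t (Suc n) * ap (Zs t (Suc n) * phi_op t (conv_op (\<nu> n))) (\<nu>b n) y
        \<le> Am t (Suc n) * (?EZ * (exp (t * ?ml) / ?m) * V n * ?w)"
      by (rule mult_left_mono[OF ZF less_imp_le[OF Am_pos]])
    also have "\<dots> = (exp (- (t * ?m)) * (?EZ * exp (t * ?ml))) * (Am t n * V n / ?m * ?w)"
      by (simp add: Am_Suc)
    also have "\<dots> \<le> ?E (Suc n) * (Am t n * V n / ?m * ?w)"
      by (rule mult_right_mono[OF exps]) (intro mult_nonneg_nonneg divide_nonneg_pos Vpos mlm less_imp_le[OF Am_pos], simp)
    finally have 2: "Am t (Suc n) * ap (Zs t (Suc n) * phi_op t (conv_op (\<nu> n))) (\<nu>b n) y \<le> ?E (Suc n) * (Am t n * V n / ?m * ?w)" .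
    have 3: "exp (t * J (g n)) * (?E n * ?S n) * ?w = ?E (Suc n) * ?S n * ?w"
      by (simp add: mult_exp_exp algebra_simps)
    have "Qs t (Suc n) y \<le> ?E (Suc n) * ?S n * ?w + ?E (Suc n) * (Am t n * V n / ?m * ?w)"
      using 1 2 unfolding 3 by (simp add: plus_bcontfun.rep_eq)
    also have "\<dots> = ?E (Suc n) * ?S (Suc n) * ?w" by (simp add: ring_distribs)
    finally show ?case .
  qed
qed

lemma norm_ZPhi:
  assumes t: "0 \<le> t"
  shows "norm (Am t (Suc n) *\<^sub>R (Zs t n * cps (eta n) t * phi_op t (conv_op (\<nu> n)))) \<le> t * Am t n"
proof -
  have "norm (Zs t (Suc n) * phi_op t (conv_op (\<nu> n))) \<le> norm (Zs t (Suc n)) * norm (phi_op t (conv_op (\<nu> n)))"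
    by (rule norm_mult_ineq)
  also have "\<dots> \<le> 1 * (t * exp (t * norm (conv_op (\<nu> n))))"
    using markov_Zs[OF t, of "Suc n"] by (intro mult_mono norm_phi_op t) (auto simp: markov_op_def t)
  also have "\<dots> \<le> t * exp (t * mass n)"
    using t norm_conv_jump[OF \<nu>[of n]] by (auto intro!: mult_left_mono)
  finally have "Am t (Suc n) * norm (Zs t (Suc n) * phi_op t (conv_op (\<nu> n))) \<le> Am t (Suc n) * (t * exp (t * mass n))"
    by (intro mult_left_mono less_imp_le[OF Am_pos])
  also have "\<dots> = t * Am t n" by (simp add: Am_Suc exp_minus field_simps)
  finally show ?thesis using Am_pos[of t "Suc n"] by simp
qed

lemma Qs_second_diff:
  assumes t: "0 \<le> t" and K: "\<And>n. second_diff (K n) (\<nu>b n)"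
  shows "second_diff (\<Sum>k<n. t * Am t k * K k) (Qs t n)"
proof (induction n)
  case 0 show ?case by (simp add: second_diff_def)
next
  case (Suc n)
  have "second_diff (1 * (\<Sum>k<n. t * Am t k * K k)) (ap (cps (g n) t) (Qs t n))"
    by (rule second_diff_ap[OF Suc cps_shift_commute[OF g] norm_cps[OF g t]])
  moreover have "second_diff (t * Am t n * K n)
     (ap (Am t (Suc n) *\<^sub>R (Zs t n * cps (eta n) t * phi_op t (conv_op (\<nu> n)))) (\<nu>b n))"
  proof (rule second_diff_ap[OF K _ norm_ZPhi[OF t]])
    fix z
    have 1: "Zs t n * cps (eta n) t * shift_op z = shift_op z * (Zs t n * cps (eta n) t)"
      using markov_Zs[OF t, of "Suc n"] by (simp add: markov_op_def)
    have push: "Zs t n * (cps (eta n) t * (shift_op z * X)) = shift_op z * (Zs t n * (cps (eta n) t * X))" for X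
      using arg_cong[OF 1, of "\<lambda>A. A * X"] by (simp only: mult.assoc)
    have 2: "phi_op t (conv_op (\<nu> n)) * shift_op z = shift_op z * phi_op t (conv_op (\<nu> n))"
      by (rule phi_commute) (rule conv_op_shift_commute[symmetric, OF jump_densityD(1)[OF \<nu>]])
    have "Zs t n * cps (eta n) t * phi_op t (conv_op (\<nu> n)) * shift_op z
        = shift_op z * (Zs t n * cps (eta n) t * phi_op t (conv_op (\<nu> n)))"
      by (simp only: mult.assoc 2 push)
    then show "(Am t (Suc n) *\<^sub>R (Zs t n * cps (eta n) t * phi_op t (conv_op (\<nu> n)))) * shift_op z
        = shift_op z * (Am t (Suc n) *\<^sub>R (Zs t n * cps (eta n) t * phi_op t (conv_op (\<nu> n))))"
      by simp
  qed
  ultimately show ?case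
    using second_diff_add by (fastforce simp: ap.scaleR_left)
qed

lemma Qs_step:
  assumes t: "0 \<le> t" and K: "\<And>n. second_diff (K n) (\<nu>b n)" and V: "\<And>n. norm (\<nu>b n) \<le> V n"
    and i: "\<And>n. integrable lborel (\<lambda>z. (norm z)\<^sup>2 * g n z)"
  shows "norm (Qs t (Suc n) - Qs t n)
    \<le> t * ((\<Sum>k<n. t * Am t k * K k) / 2 * (LINT z|lborel. (norm z)\<^sup>2 * g n z)) + t * (Am t n * V n)"
proof -
  let ?A = "Am t (Suc n) *\<^sub>R (Zs t n * cps (eta n) t * phi_op t (conv_op (\<nu> n)))"
  have "norm (ap (cps (g n) t) (Qs t n) - Qs t n) \<le> t * norm (ap (gen_op (g n)) (Qs t n))"
    by (rule cps_diff_bound[OF g t])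
  also have "\<dots> \<le> t * ((\<Sum>k<n. t * Am t k * K k) / 2 * (LINT z|lborel. (norm z)\<^sup>2 * g n z))"
    by (intro mult_left_mono norm_gen_second_diff g Qs_second_diff t K i)
  finally have 1: "norm (ap (cps (g n) t) (Qs t n) - Qs t n) \<le> t * ((\<Sum>k<n. t * Am t k * K k) / 2 * (LINT z|lborel. (norm z)\<^sup>2 * g n z))" .
  have "norm (ap ?A (\<nu>b n)) \<le> norm ?A * norm (\<nu>b n)" by (rule norm_ap)
  also have "\<dots> \<le> (t * Am t n) * V n"
    by (intro mult_mono norm_ZPhi t V mult_nonneg_nonneg less_imp_le[OF Am_pos]) simp
  finally have 2: "norm (ap ?A (\<nu>b n)) \<le> t * (Am t n * V n)" by simp
  have "norm (Qs t (Suc n) - Qs t n) = norm ((ap (cps (g n) t) (Qs t n) - Qs t n) + ap ?A (\<nu>b n))"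
    by (simp add: ap.scaleR_left algebra_simps)
  then show ?thesis using norm_triangle_ineq[of "ap (cps (g n) t) (Qs t n) - Qs t n" "ap ?A (\<nu>b n)"] 1 2 by linarith
qed

lemma Qs_convergent:
  assumes t: "0 \<le> t" and K: "\<And>n. second_diff (K n) (\<nu>b n)" "\<And>n. 0 \<le> K n" and V: "\<And>n. norm (\<nu>b n) \<le> V n"
    and i: "\<And>n. integrable lborel (\<lambda>z. (norm z)\<^sup>2 * g n z)"
    and sK: "summable (\<lambda>n. Am t n * K n)" and sV: "summable (\<lambda>n. Am t n * V n)"
    and sg: "summable (\<lambda>n. LINT z|lborel. (norm z)\<^sup>2 * g n z)"
  shows "convergent (Qs t)"
proof -
  let ?s = "\<lambda>n. LINT z|lborel. (norm z)\<^sup>2 * g n z" and ?KK = "\<Sum>n. Am t n * K n"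
  have spos: "0 \<le> ?s n" for n using jump_densityD(2)[OF g] by (auto intro!: integral_nonneg_AE)
  have "summable (\<lambda>n. Qs t (Suc n) - Qs t n)"
  proof (rule summable_comparison_test'[where N = 0])
    show "summable (\<lambda>n. t * (t * ?KK / 2 * ?s n) + t * (Am t n * V n))"
      by (intro summable_add summable_mult sg sV)
    fix n
    have "(\<Sum>k<n. t * Am t k * K k) = t * (\<Sum>k<n. Am t k * K k)" by (simp add: sum_distrib_left mult.assoc)
    also have "\<dots> \<le> t * ?KK"
      by (intro mult_left_mono sum_le_suminf sK t) (auto intro!: mult_nonneg_nonneg K(2) less_imp_le[OF Am_pos])
    finally have "(\<Sum>k<n. t * Am t k * K k) / 2 * ?s n \<le> t * ?KK / 2 * ?s n"
      by (intro mult_right_mono spos) simp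
    then have "t * ((\<Sum>k<n. t * Am t k * K k) / 2 * ?s n) \<le> t * (t * ?KK / 2 * ?s n)"
      using t by (rule mult_left_mono)
    then show "norm (Qs t (Suc n) - Qs t n) \<le> t * (t * ?KK / 2 * ?s n) + t * (Am t n * V n)"
      using Qs_step[OF t K(1) V i, of n] by linarith
  qed
  then have "convergent (\<lambda>n. \<Sum>k<n. Qs t (Suc k) - Qs t k)"
    by (simp only: summable_iff_convergent)
  moreover have "(\<lambda>n. \<Sum>k<n. Qs t (Suc k) - Qs t k) = Qs t"
    by (simp add: fun_eq_iff sum_lessThan_telescope del: Qs.simps(2))
  ultimately show ?thesis by simp
qed

lemma continuous_on_Qs: "continuous_on {0..T} (\<lambda>t. Qs t n)"
proof (induction n)
  case (Suc n)
  have A: "continuous_on {0..T} (\<lambda>t. Am t (Suc n))" unfolding Am_def by (intro continuous_intros)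
  have Z: "continuous_on {0..T} (\<lambda>t. Zs t n)" for n
    by (induction n) (auto intro!: continuous_on_cps continuous_on_mult)
  show ?case
    unfolding Qs.simps
    by (intro continuous_on_add ap.continuous_on continuous_on_scaleR continuous_on_cps Suc A Z
        continuous_on_mult continuous_on_phi continuous_on_const)
qed simp

end

section \<open>Approximate solutions of the truncated equation\<close>

text \<open>An approximate solution of the truncated equation stays close to the semigroup. The proof
  divides the time interval into equal steps, uses the defect on each step, and sums up using that the semigroup
  consists of contractions. The constants \<open>K\<close> and \<open>B\<close> do not enter the conclusion: it does not matter that they
  blow up as the truncation is removed.\<close>
lemma cps_duhamel:
  fixes v :: "real \<Rightarrow> ('a::euclidean_space \<Rightarrow>\<^sub>C real)"
  assumes g: "jump_density g" and t: "0 \<le> t" and d: "0 \<le> d" and K: "0 \<le> K"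
    and B: "\<And>s. 0 \<le> s \<Longrightarrow> norm (v s) \<le> B"
    and step: "\<And>s r. 0 \<le> s \<Longrightarrow> 0 \<le> r \<Longrightarrow> norm (v (s + r) - v s - r *\<^sub>R ap (gen_op g) (v s)) \<le> r * d + K * r\<^sup>2"
  shows "norm (v t - ap (cps g t) (v 0)) \<le> t * d"
proof -
  let ?G = "norm (gen_op g)"
  define K' where "K' = K + ?G * (?G * B)"
  have GG: "norm (ap (gen_op g) (ap (gen_op g) (v s))) \<le> ?G * (?G * B)" if "0 \<le> s" for s
  proof -
    have "norm (ap (gen_op g) (v s)) \<le> ?G * B"
      using norm_ap[of "gen_op g" "v s"] mult_left_mono[OF B[OF that], of ?G] by simp
    then show ?thesis
      using norm_ap[of "gen_op g" "ap (gen_op g) (v s)"] mult_left_mono[of _ _ ?G] by (meson norm_ge_zero order_trans)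
  qed
  have one: "norm (v (s + r) - ap (cps g r) (v s)) \<le> r * d + K' * r\<^sup>2" if "0 \<le> s" "0 \<le> r" for s r
  proof -
    have "norm (ap (cps g r) (v s) - v s - r *\<^sub>R ap (gen_op g) (v s)) \<le> r\<^sup>2 * (?G * (?G * B))"
      using cps_taylor_bound[OF g that(2), of "v s"] mult_left_mono[OF GG[OF that(1)], of "r\<^sup>2"] by simp
    moreover have "norm (v (s + r) - ap (cps g r) (v s)) = norm ((v (s + r) - v s - r *\<^sub>R ap (gen_op g) (v s))
        - (ap (cps g r) (v s) - v s - r *\<^sub>R ap (gen_op g) (v s)))" by simp
    moreover have "\<dots> \<le> norm (v (s + r) - v s - r *\<^sub>R ap (gen_op g) (v s))
        + norm (ap (cps g r) (v s) - v s - r *\<^sub>R ap (gen_op g) (v s))" by (rule norm_triangle_ineq4)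
    ultimately have "norm (v (s + r) - ap (cps g r) (v s)) \<le> (r * d + K * r\<^sup>2) + r\<^sup>2 * (?G * (?G * B))"
      using step[OF that] by linarith
    then show ?thesis by (simp add: K'_def algebra_simps)
  qed
  have bd: "norm (v t - ap (cps g t) (v 0)) \<le> t * d + K' * t\<^sup>2 * inverse (real (Suc n))" for n
  proof -
    let ?N = "Suc n" and ?r = "t / real (Suc n)"
    define F where "F i = ap (cps g (t - real i * ?r)) (v (real i * ?r))" for i :: nat
    have r: "0 \<le> ?r" using t by simp
    have st: "norm (F (Suc i) - F i) \<le> ?r * d + K' * ?r\<^sup>2" if "i < ?N" for i
    proof -
      have "real (Suc i) * ?r \<le> real ?N * ?r" using that r by (intro mult_right_mono) auto
      then have q: "0 \<le> t - real (Suc i) * ?r" by simp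
      have "t - real i * ?r = (t - real (Suc i) * ?r) + ?r" by (simp add: algebra_simps add_divide_distrib)
      then have "F i = ap (cps g (t - real (Suc i) * ?r)) (ap (cps g ?r) (v (real i * ?r)))"
        unfolding F_def by (simp only: cps_semigroup ap_mult)
      then have "F (Suc i) - F i = ap (cps g (t - real (Suc i) * ?r)) (v (real (Suc i) * ?r) - ap (cps g ?r) (v (real i * ?r)))"
        unfolding F_def ap.diff_right by (simp only:)
      then have "norm (F (Suc i) - F i) \<le> norm (v (real (Suc i) * ?r) - ap (cps g ?r) (v (real i * ?r)))"
        using norm_ap_cps[OF g q] by simp
      also have "real (Suc i) * ?r = real i * ?r + ?r" by (simp add: algebra_simps add_divide_distrib)
      also have "norm (v (real i * ?r + ?r) - ap (cps g ?r) (v (real i * ?r))) \<le> ?r * d + K' * ?r\<^sup>2"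
        using t by (intro one) auto
      finally show ?thesis .
    qed
    have "norm (F ?N - F 0) \<le> (\<Sum>i<?N. norm (F (Suc i) - F i))"
      unfolding sum_lessThan_telescope[symmetric] by (rule norm_sum)
    also have "\<dots> \<le> (\<Sum>i<?N. ?r * d + K' * ?r\<^sup>2)" by (rule sum_mono) (use st in auto)
    also have "\<dots> = t * d + K' * t\<^sup>2 * inverse (real ?N)"
    proof -
      have "R * (t / R * d + K' * (t / R)\<^sup>2) = t * d + K' * t\<^sup>2 * inverse R" if "0 < R" for R
        using that by (simp add: power2_eq_square field_simps)
      from this[of "real ?N"] show ?thesis by (simp only: sum_constant card_lessThan)
    qed
    finally show ?thesis by (simp add: F_def)
  qed
  have "(\<lambda>n. t * d + K' * t\<^sup>2 * inverse (real (Suc n))) \<longlonglongrightarrow> t * d + K' * t\<^sup>2 * 0"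
    by (intro tendsto_intros LIMSEQ_inverse_real_of_nat)
  then show ?thesis
    using LIMSEQ_le_const[of _ "t * d" "norm (v t - ap (cps g t) (v 0))"] bd by auto
qed

text \<open>The open intervals miss the point \<open>s\<close>, which is a null set.\<close>
lemma set_integral_increment_bound:
  fixes w :: "real \<Rightarrow> real"
  assumes [measurable]: "w \<in> borel_measurable borel" and B: "\<And>\<tau>. \<bar>w \<tau>\<bar> \<le> B"
    and s: "0 \<le> s" "0 \<le> r" and e: "\<And>\<tau>. s < \<tau> \<Longrightarrow> \<tau> < s + r \<Longrightarrow> \<bar>w \<tau> - c\<bar> \<le> e"
  shows "\<bar>(LINT \<tau>:{0<..<s + r}|lborel. w \<tau>) - (LINT \<tau>:{0<..<s}|lborel. w \<tau>) - r * c\<bar> \<le> r * e"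
proof -
  have fin: "emeasure lborel {a<..<b} < \<infinity>" for a b :: real
    by (cases "a \<le> b") auto
  have i: "set_integrable lborel {a<..<b} w" for a b :: real
    unfolding set_integrable_def
    by (rule integrableI_bounded_set[of "{a<..<b}" _ _ B])
       (use B fin[of a b] in \<open>auto simp: indicator_def\<close>)
  have ic: "set_integrable lborel {a<..<b} (\<lambda>_. d::real)" for a b d :: real
    unfolding set_integrable_def
    by (rule integrableI_bounded_set[of "{a<..<b}" _ _ "\<bar>d\<bar>"]) (use fin[of a b] in \<open>auto simp: indicator_def\<close>)
  have "(LINT \<tau>:{0<..<s + r}|lborel. w \<tau>) - (LINT \<tau>:{0<..<s}|lborel. w \<tau>) = (LINT \<tau>:{s<..<s + r}|lborel. w \<tau>)"
  proof -
    have "(LINT \<tau>:{0<..<s + r}|lborel. w \<tau>) = (LINT \<tau>:{0<..<s} \<union> {s<..<s + r}|lborel. w \<tau>)"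
      unfolding set_lebesgue_integral_def
      by (rule integral_cong_AE) (use s AE_lborel_singleton[of s] in \<open>auto simp: indicator_def elim!: eventually_mono\<close>)
    also have "\<dots> = (LINT \<tau>:{0<..<s}|lborel. w \<tau>) + (LINT \<tau>:{s<..<s + r}|lborel. w \<tau>)"
      by (rule set_integral_Un) (use i in auto)
    finally show ?thesis by simp
  qed
  moreover have "r * c = (LINT \<tau>:{s<..<s + r}|lborel. c)" "r * e = (LINT \<tau>:{s<..<s + r}|lborel. e)"
    using s by (simp_all add: set_lebesgue_integral_def)
  ultimately have "\<bar>(LINT \<tau>:{0<..<s + r}|lborel. w \<tau>) - (LINT \<tau>:{0<..<s}|lborel. w \<tau>) - r * c\<bar>
      = \<bar>LINT \<tau>:{s<..<s + r}|lborel. w \<tau> - c\<bar>"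
    using set_integral_diff(2)[OF i ic, of s "s + r" c] by simp
  also have "\<dots> \<le> (LINT \<tau>:{s<..<s + r}|lborel. \<bar>w \<tau> - c\<bar>)"
    using set_integral_norm_bound[OF set_integral_diff(1)[OF i ic]] by simp
  also have "\<dots> \<le> (LINT \<tau>:{s<..<s + r}|lborel. e)"
    by (rule set_integral_mono) (use e set_integrable_abs[OF set_integral_diff(1)[OF i ic]] ic in auto)
  finally show ?thesis using \<open>r * e = _\<close> by simp
qed

section \<open>Test functions\<close>

lemma test_function_continuous: "test_function \<psi> \<Longrightarrow> continuous_on UNIV \<psi>"
  unfolding test_function_def by (metis Ck.simps(1))

lemma test_function_differentiable: "test_function \<psi> \<Longrightarrow> \<psi> differentiable (at x)"
  unfolding test_function_def by (metis Ck.simps(2))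

lemma test_function_measurable: "test_function \<psi> \<Longrightarrow> \<psi> \<in> borel_measurable borel"
  by (intro borel_measurable_continuous_onI test_function_continuous)

lemma test_function_bounded:
  assumes "test_function \<psi>"
  obtains B where "\<And>x. \<bar>\<psi> x\<bar> \<le> B" "0 \<le> B"
proof -
  let ?S = "closure {x. \<psi> x \<noteq> 0}"
  have "compact (\<psi> ` ?S)"
    using assms continuous_on_subset[OF test_function_continuous[OF assms]]
    by (intro compact_continuous_image) (auto simp: test_function_def)
  then obtain B where B: "\<And>x. x \<in> ?S \<Longrightarrow> norm (\<psi> x) \<le> B"
    using compact_imp_bounded bounded_iff by (metis imageI)
  have "\<bar>\<psi> x\<bar> \<le> max B 0" for x
    using B[of x] closure_subset[of "{x. \<psi> x \<noteq> 0}"] by (cases "\<psi> x = 0") (auto simp: max_def)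
  then show ?thesis using that[of "max B 0"] by simp
qed

lemma test_function_integrable:
  assumes "test_function \<psi>"
  shows "integrable lborel \<psi>"
proof -
  let ?S = "closure {x. \<psi> x \<noteq> 0}"
  have "integrable lborel (\<lambda>x. indicator ?S x *\<^sub>R \<psi> x)"
    using assms continuous_on_subset[OF test_function_continuous[OF assms]]
    by (intro borel_integrable_compact) (auto simp: test_function_def)
  also have "(\<lambda>x. indicator ?S x *\<^sub>R \<psi> x) = \<psi>"
    using closure_subset[of "{x. \<psi> x \<noteq> 0}"] by (auto simp: fun_eq_iff indicator_def)
  finally show ?thesis .
qed

lemma test_function_deriv:
  assumes \<psi>: "test_function \<psi>" and b: "b \<in> Basis"
  shows "test_function (\<lambda>x. frechet_derivative \<psi> (at x) b)"
  unfolding test_function_def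
proof (intro conjI allI)
  fix k
  have "Ck (Suc k) \<psi>" using \<psi> unfolding test_function_def by blast
  then show "Ck k (\<lambda>x. frechet_derivative \<psi> (at x) b)" using b by simp
next
  let ?S = "closure {x. \<psi> x \<noteq> 0}"
  have "frechet_derivative \<psi> (at x) b = 0" if "x \<notin> ?S" for x
  proof -
    have "(\<psi> has_derivative (\<lambda>_. 0)) (at x)"
    proof (rule has_derivative_transform_within_open[where f = "\<lambda>_. 0" and s = "- ?S"])
      show "0 = \<psi> y" if "y \<in> - ?S" for y
        using that closure_subset[of "{x. \<psi> x \<noteq> 0}"] by auto
    qed (use that in auto)
    then show ?thesis by (simp add: frechet_derivative_at[symmetric])
  qed
  then have "closure {x. frechet_derivative \<psi> (at x) b \<noteq> 0} \<subseteq> ?S"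
    by (intro closure_minimal) auto
  then have "?S \<inter> closure {x. frechet_derivative \<psi> (at x) b \<noteq> 0} = closure {x. frechet_derivative \<psi> (at x) b \<noteq> 0}"
    by (rule inf.absorb2)
  moreover have "compact (?S \<inter> closure {x. frechet_derivative \<psi> (at x) b \<noteq> 0})"
    using \<psi> by (intro compact_Int_closed) (auto simp: test_function_def)
  ultimately show "compact (closure {x. frechet_derivative \<psi> (at x) b \<noteq> 0})"
    by (simp only:)
qed

lemma frechet_derivative_basis_sum:
  fixes \<psi> :: "'a::euclidean_space \<Rightarrow> real"
  assumes "\<psi> differentiable (at x)"
  shows "frechet_derivative \<psi> (at x) y = (\<Sum>b\<in>Basis. (y \<bullet> b) * frechet_derivative \<psi> (at x) b)"
proof -
  interpret linear "frechet_derivative \<psi> (at x)" by (rule linear_frechet_derivative[OF assms])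
  have "frechet_derivative \<psi> (at x) y = frechet_derivative \<psi> (at x) (\<Sum>b\<in>Basis. (y \<bullet> b) *\<^sub>R b)"
    by (simp add: euclidean_representation)
  then show ?thesis by (simp add: sum scale)
qed

lemma test_function_lipschitz:
  fixes \<psi> :: "'a::euclidean_space \<Rightarrow> real"
  assumes \<psi>: "test_function \<psi>"
  obtains L where "0 \<le> L" "\<And>x y. \<bar>\<psi> x - \<psi> y\<bar> \<le> L * norm (x - y)"
proof -
  have "\<exists>B. \<forall>b\<in>Basis. (\<forall>x. \<bar>frechet_derivative \<psi> (at x) b\<bar> \<le> B b) \<and> 0 \<le> B b"
  proof (intro bchoice ballI)
    fix b :: 'a assume b: "b \<in> Basis"
    obtain B where "\<And>x. \<bar>frechet_derivative \<psi> (at x) b\<bar> \<le> B" "0 \<le> B"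
      by (rule test_function_bounded[OF test_function_deriv[OF \<psi> b]], rule that)
    then show "\<exists>B. (\<forall>x. \<bar>frechet_derivative \<psi> (at x) b\<bar> \<le> B) \<and> 0 \<le> B" by blast
  qed
  then obtain B where B: "\<And>b x. b \<in> Basis \<Longrightarrow> \<bar>frechet_derivative \<psi> (at x) b\<bar> \<le> B b" "\<And>b. b \<in> Basis \<Longrightarrow> 0 \<le> B b"
    by blast
  have "norm (\<psi> x - \<psi> y) \<le> (\<Sum>b\<in>Basis. B b) * norm (x - y)" for x y
  proof (rule differentiable_bound[of UNIV])
    fix x :: 'a
    show "(\<psi> has_derivative frechet_derivative \<psi> (at x)) (at x within UNIV)"
      using test_function_differentiable[OF \<psi>] frechet_derivative_works by blast
    show "onorm (frechet_derivative \<psi> (at x)) \<le> (\<Sum>b\<in>Basis. B b)"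
    proof (rule onorm_bound)
      fix y :: 'a
      have "\<bar>frechet_derivative \<psi> (at x) y\<bar> \<le> (\<Sum>b\<in>Basis. \<bar>(y \<bullet> b) * frechet_derivative \<psi> (at x) b\<bar>)"
        unfolding frechet_derivative_basis_sum[OF test_function_differentiable[OF \<psi>], of x y] by (rule sum_abs)
      also have "\<dots> \<le> (\<Sum>b\<in>Basis. norm y * B b)"
        by (intro sum_mono) (use B in \<open>auto simp: abs_mult Basis_le_norm intro!: mult_mono\<close>)
      finally show "norm (frechet_derivative \<psi> (at x) y) \<le> (\<Sum>b\<in>Basis. B b) * norm y"
        by (simp add: sum_distrib_right mult.commute[of "norm y"])
    qed (use B in \<open>auto intro: sum_nonneg\<close>)
  qed auto
  moreover have "0 \<le> (\<Sum>b\<in>Basis. B b)" using B(2) by (rule sum_nonneg)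
  ultimately show ?thesis using that[of "\<Sum>b\<in>Basis. B b"] by simp
qed

lemma test_function_second_diff:
  fixes \<psi> :: "'a::euclidean_space \<Rightarrow> real"
  assumes \<psi>: "test_function \<psi>"
  obtains K where "0 \<le> K" "\<And>x z. \<bar>\<psi> (x + z) + \<psi> (x - z) - 2 * \<psi> x\<bar> \<le> K * (norm z)\<^sup>2"
proof -
  let ?D = "\<lambda>x. frechet_derivative \<psi> (at x)"
  have "\<exists>L. \<forall>b\<in>Basis. 0 \<le> L b \<and> (\<forall>x y. \<bar>?D x b - ?D y b\<bar> \<le> L b * norm (x - y))"
  proof (intro bchoice ballI)
    fix b :: 'a assume b: "b \<in> Basis"
    obtain L where "0 \<le> L" "\<And>x y. \<bar>?D x b - ?D y b\<bar> \<le> L * norm (x - y)"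
      by (rule test_function_lipschitz[OF test_function_deriv[OF \<psi> b]], rule that)
    then show "\<exists>L. 0 \<le> L \<and> (\<forall>x y. \<bar>?D x b - ?D y b\<bar> \<le> L * norm (x - y))" by blast
  qed
  then obtain L where L: "\<And>b. b \<in> Basis \<Longrightarrow> 0 \<le> L b" "\<And>b x y. b \<in> Basis \<Longrightarrow> \<bar>?D x b - ?D y b\<bar> \<le> L b * norm (x - y)"
    by blast
  have "\<bar>\<psi> (x + z) + \<psi> (x - z) - 2 * \<psi> x\<bar> \<le> (2 * (\<Sum>b\<in>Basis. L b)) * (norm z)\<^sup>2" for x z
  proof -
    let ?F = "\<lambda>s::real. \<psi> (x + s *\<^sub>R z) + \<psi> (x - s *\<^sub>R z)"
    have d: "(\<psi> has_derivative ?D y) (at y)" for y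
      using test_function_differentiable[OF \<psi>] frechet_derivative_works by blast
    have lin: "linear (?D y)" for y by (rule linear_frechet_derivative[OF test_function_differentiable[OF \<psi>]])
    have "norm (?F 1 - ?F 0) \<le> ((2 * (\<Sum>b\<in>Basis. L b)) * (norm z)\<^sup>2) * norm (1 - 0 :: real)"
    proof (rule differentiable_bound[of "{0..1::real}"])
      fix s :: real assume s: "s \<in> {0..1}"
      have "((\<lambda>s. \<psi> (x + s *\<^sub>R z)) has_derivative (\<lambda>h. ?D (x + s *\<^sub>R z) (h *\<^sub>R z))) (at s within {0..1})"
        by (rule has_derivative_compose[OF _ d]) (auto intro!: derivative_eq_intros)
      moreover have "((\<lambda>s. \<psi> (x - s *\<^sub>R z)) has_derivative (\<lambda>h. ?D (x - s *\<^sub>R z) (- (h *\<^sub>R z)))) (at s within {0..1})"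
        by (rule has_derivative_compose[OF _ d]) (auto intro!: derivative_eq_intros)
      ultimately show "(?F has_derivative (\<lambda>h. ?D (x + s *\<^sub>R z) (h *\<^sub>R z) + ?D (x - s *\<^sub>R z) (- (h *\<^sub>R z)))) (at s within {0..1})"
        by (rule has_derivative_add)
      show "onorm (\<lambda>h. ?D (x + s *\<^sub>R z) (h *\<^sub>R z) + ?D (x - s *\<^sub>R z) (- (h *\<^sub>R z))) \<le> (2 * (\<Sum>b\<in>Basis. L b)) * (norm z)\<^sup>2"
      proof (rule onorm_bound)
        fix h :: real
        have "?D (x + s *\<^sub>R z) (h *\<^sub>R z) + ?D (x - s *\<^sub>R z) (- (h *\<^sub>R z)) = h * (?D (x + s *\<^sub>R z) z - ?D (x - s *\<^sub>R z) z)"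
          using lin by (simp add: linear_neg linear_scale right_diff_distrib)
        also have "?D (x + s *\<^sub>R z) z - ?D (x - s *\<^sub>R z) z = (\<Sum>b\<in>Basis. (z \<bullet> b) * (?D (x + s *\<^sub>R z) b - ?D (x - s *\<^sub>R z) b))"
          unfolding frechet_derivative_basis_sum[OF test_function_differentiable[OF \<psi>], of _ z]
          by (simp add: right_diff_distrib sum_subtractf)
        also have "\<bar>h * \<dots>\<bar> \<le> \<bar>h\<bar> * (\<Sum>b\<in>Basis. norm z * (L b * (2 * norm z)))"
        proof -
          have "\<bar>\<Sum>b\<in>Basis. (z \<bullet> b) * (?D (x + s *\<^sub>R z) b - ?D (x - s *\<^sub>R z) b)\<bar> \<le> (\<Sum>b\<in>Basis. \<bar>(z \<bullet> b) * (?D (x + s *\<^sub>R z) b - ?D (x - s *\<^sub>R z) b)\<bar>)"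
            by (rule sum_abs)
          also have "\<dots> \<le> (\<Sum>b\<in>Basis. norm z * (L b * (2 * norm z)))"
          proof (rule sum_mono)
            fix b :: 'a assume b: "b \<in> Basis"
            have "(x + s *\<^sub>R z) - (x - s *\<^sub>R z) = (2 * s) *\<^sub>R z" by (simp add: scaleR_2[symmetric])
            then have "norm ((x + s *\<^sub>R z) - (x - s *\<^sub>R z)) \<le> 2 * norm z"
              using s by (simp add: mult_left_le_one_le)
            then have "\<bar>?D (x + s *\<^sub>R z) b - ?D (x - s *\<^sub>R z) b\<bar> \<le> L b * (2 * norm z)"
              using L(2)[OF b, of "x + s *\<^sub>R z" "x - s *\<^sub>R z"] L(1)[OF b] by (meson mult_left_mono order_trans)
            then show "\<bar>(z \<bullet> b) * (?D (x + s *\<^sub>R z) b - ?D (x - s *\<^sub>R z) b)\<bar> \<le> norm z * (L b * (2 * norm z))"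
              unfolding abs_mult using Basis_le_norm[OF b] by (intro mult_mono) auto
          qed
          finally show ?thesis by (simp add: abs_mult mult_left_mono)
        qed
        also have "\<dots> = (2 * (\<Sum>b\<in>Basis. L b)) * (norm z)\<^sup>2 * norm h"
          by (simp add: sum_distrib_left sum_distrib_right power2_eq_square ac_simps)
        finally show "norm (?D (x + s *\<^sub>R z) (h *\<^sub>R z) + ?D (x - s *\<^sub>R z) (- (h *\<^sub>R z))) \<le> (2 * (\<Sum>b\<in>Basis. L b)) * (norm z)\<^sup>2 * norm h"
          by simp
      qed (use L in \<open>auto intro!: mult_nonneg_nonneg sum_nonneg\<close>)
    qed auto
    then show ?thesis by (simp add: algebra_simps)
  qed
  then show ?thesis using that[of "2 * (\<Sum>b\<in>Basis. L b)"] L by (auto intro!: sum_nonneg)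
qed

lemma Ck_shift: "Ck k \<psi> \<Longrightarrow> Ck k (\<lambda>x. \<psi> (x + a))" for \<psi> :: "'a::euclidean_space \<Rightarrow> real"
proof (induction k arbitrary: \<psi>)
  case 0 then show ?case by (auto intro!: continuous_on_compose2[of UNIV \<psi>] continuous_intros)
next
  case (Suc k)
  have d: "((\<lambda>x. \<psi> (x + a)) has_derivative frechet_derivative \<psi> (at (x + a))) (at x)" for x
  proof -
    have "(\<psi> has_derivative frechet_derivative \<psi> (at (x + a))) (at (x + a))"
      using Suc.prems frechet_derivative_works by auto
    moreover have "((\<lambda>x. x + a) has_derivative (\<lambda>h. h)) (at x)"
      by (auto intro!: derivative_eq_intros)
    ultimately show ?thesis
      using has_derivative_compose[of "\<lambda>x. x + a" "\<lambda>h. h" x UNIV \<psi>] by blast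
  qed
  have "frechet_derivative (\<lambda>x. \<psi> (x + a)) (at x) = frechet_derivative \<psi> (at (x + a))" for x
    using frechet_derivative_at[OF d] by simp
  moreover have "(\<lambda>x. \<psi> (x + a)) differentiable (at x)" for x using d differentiable_def by blast
  moreover have "Ck k (\<lambda>x. frechet_derivative \<psi> (at (x + a)) b)" if "b \<in> Basis" for b
    by (rule Suc.IH) (use Suc.prems that in simp)
  ultimately show ?case by simp
qed

lemma test_function_shift:
  fixes \<psi> :: "'a::euclidean_space \<Rightarrow> real"
  assumes "test_function \<psi>"
  shows "test_function (\<lambda>x. \<psi> (x + a))"
proof -
  have "{x. \<psi> (x + a) \<noteq> 0} = (\<lambda>x. - a + x) ` {x. \<psi> x \<noteq> 0}"
    by (auto simp: image_iff intro!: exI[of _ "_ + a"])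
  then have "closure {x. \<psi> (x + a) \<noteq> 0} = (\<lambda>x. - a + x) ` closure {x. \<psi> x \<noteq> 0}"
    by (simp only: closure_translation)
  then show ?thesis
    using assms compact_translation[of "closure {x. \<psi> x \<noteq> 0}" "- a"] by (simp add: test_function_def Ck_shift)
qed

lemma test_function_bcontfun:
  assumes "test_function \<psi>"
  obtains \<psi>b :: "'a::euclidean_space \<Rightarrow>\<^sub>C real" and K
  where "apply_bcontfun \<psi>b = \<psi>" "0 \<le> K" "second_diff K \<psi>b"
proof -
  obtain B where "\<And>x. \<bar>\<psi> x\<bar> \<le> B" "0 \<le> B" by (rule test_function_bounded[OF assms], rule that)
  then have "\<psi> \<in> bcontfun"
    using test_function_continuous[OF assms] by (intro bcontfun_normI) auto
  then have 1: "apply_bcontfun (Bcontfun \<psi>) = \<psi>" by (rule Bcontfun_inverse)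
  obtain K where "0 \<le> K" "\<And>x z. \<bar>\<psi> (x + z) + \<psi> (x - z) - 2 * \<psi> x\<bar> \<le> K * (norm z)\<^sup>2"
    by (rule test_function_second_diff[OF assms], rule that)
  then show ?thesis using that[OF 1] by (simp add: second_diff_def 1)
qed

section \<open>Smooth bump functions\<close>

text \<open>The functions \<open>s powr (- j) * exp (- a / s)\<close>, extended by zero to \<open>s \<le> 0\<close>: the derivatives of the basic
  smooth function \<open>exp (- a / s)\<close> are combinations of them. The parameter \<open>a\<close> serves to let this function
  tend to the indicator of \<open>s > 0\<close>.\<close>
definition bump_profile :: "real \<Rightarrow> nat \<Rightarrow> real \<Rightarrow> real" where
  "bump_profile a j s = (if 0 < s then exp (- (a / s)) / s ^ j else 0)"

lemma bump_profile_bound: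
  assumes a: "0 < a"
  shows "\<bar>bump_profile a j s\<bar> \<le> fact (j + 2) / a ^ (j + 2) * s\<^sup>2"
proof (cases "0 < s")
  case True
  have "(a / s) ^ (j + 2) / fact (j + 2) \<le> exp (a / s)"
  proof -
    have "(a / s) ^ (j + 2) / fact (j + 2) = (\<Sum>n\<in>{j + 2}. (a / s) ^ n / fact n)" by simp
    also have "\<dots> \<le> (\<Sum>n. (a / s) ^ n / fact n)"
      by (rule sum_le_suminf) (use a True summable_exp_generic[of "a / s"] in \<open>auto simp: divide_inverse mult.commute\<close>)
    also have "\<dots> = exp (a / s)"
      using exp_converges[of "a / s"] by (simp add: sums_iff divide_inverse mult.commute)
    finally show ?thesis .
  qed
  then have "inverse (exp (a / s)) \<le> inverse ((a / s) ^ (j + 2) / fact (j + 2))"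
    using a True by (intro le_imp_inverse_le) auto
  then have "exp (- (a / s)) / s ^ j \<le> inverse ((a / s) ^ (j + 2) / fact (j + 2)) / s ^ j"
    using True by (intro divide_right_mono) (auto simp: exp_minus)
  also have "\<dots> = fact (j + 2) / a ^ (j + 2) * s\<^sup>2"
    using a True by (simp add: field_simps power_add power2_eq_square)
  finally show ?thesis using True by (simp add: bump_profile_def)
qed (use a in \<open>auto simp: bump_profile_def\<close>)

lemma bump_profile_deriv:
  assumes a: "0 < a"
  shows "(bump_profile a j has_real_derivative (a * bump_profile a (j + 2) s - real j * bump_profile a (j + 1) s)) (at s)"
proof -
  consider "0 < s" | "s < 0" | "s = 0" by linarith
  then show ?thesis
  proof cases
    case 1
    have "((\<lambda>s. exp (- (a / s)) * inverse (s ^ j)) has_real_derivative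
       (exp (- (a / s)) * (a / s ^ 2)) * inverse (s ^ j) + exp (- (a / s)) * (- (inverse (s ^ j) * (real j * s ^ (j - 1)) * inverse (s ^ j)))) (at s)"
      by (rule derivative_eq_intros refl | use 1 in \<open>simp add: power2_eq_square\<close>)+
    moreover have "(exp (- (a / s)) * (a / s ^ 2)) * inverse (s ^ j) + exp (- (a / s)) * (- (inverse (s ^ j) * (real j * s ^ (j - 1)) * inverse (s ^ j)))
       = a * bump_profile a (j + 2) s - real j * bump_profile a (j + 1) s"
      using 1 by (cases j) (auto simp: bump_profile_def field_simps power_add power2_eq_square)
    ultimately have "((\<lambda>s. exp (- (a / s)) * inverse (s ^ j)) has_real_derivative
       (a * bump_profile a (j + 2) s - real j * bump_profile a (j + 1) s)) (at s)" by simp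
    then show ?thesis
      by (rule has_field_derivative_transform_within_open[where S = "{0<..}"])
         (use 1 in \<open>auto simp: bump_profile_def divide_inverse\<close>)
  next
    case 2
    have "((\<lambda>s. 0) has_real_derivative 0) (at s)" by simp
    then have "(bump_profile a j has_real_derivative 0) (at s)"
      by (rule has_field_derivative_transform_within_open[where S = "{..<0}"])
         (use 2 in \<open>auto simp: bump_profile_def\<close>)
    then show ?thesis using 2 by (simp add: bump_profile_def)
  next
    case 3
    let ?K = "fact (j + 2) / a ^ (j + 2)"
    have "((\<lambda>h. bump_profile a j h / h) \<longlongrightarrow> 0) (at 0)"
    proof (rule Lim_null_comparison)
      show "\<forall>\<^sub>F h in at 0. norm (bump_profile a j h / h) \<le> ?K * \<bar>h\<bar>"
      proof (rule eventually_at_filter[THEN iffD2], rule always_eventually, safe)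
        fix h :: real assume "h \<noteq> 0"
        moreover have "\<bar>b\<bar> / \<bar>h\<bar> \<le> K * \<bar>h\<bar>" if "\<bar>b\<bar> \<le> K * h\<^sup>2" "h \<noteq> 0" for b K
        proof -
          have "h\<^sup>2 = \<bar>h\<bar> * \<bar>h\<bar>" by (simp add: power2_eq_square)
          then show ?thesis using that by (simp add: divide_le_eq mult.assoc)
        qed
        ultimately show "norm (bump_profile a j h / h) \<le> ?K * \<bar>h\<bar>"
          using bump_profile_bound[OF a, of j h] unfolding real_norm_def abs_divide by blast
      qed
      show "((\<lambda>h. ?K * \<bar>h\<bar>) \<longlongrightarrow> 0) (at 0)"
        by (intro tendsto_mult_right_zero tendsto_rabs_zero tendsto_ident_at)
    qed
    then show ?thesis using 3 by (simp add: DERIV_def bump_profile_def)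
  qed
qed

text \<open>An algebra of functions that is closed under directional derivatives, so that its members are
  infinitely differentiable. It contains a bump for every ball.\<close>
inductive smooth_alg :: "('a::euclidean_space \<Rightarrow> real) \<Rightarrow> bool" where
  const: "smooth_alg (\<lambda>x. c)"
| coord: "smooth_alg (\<lambda>x. x \<bullet> v)"
| add: "smooth_alg f \<Longrightarrow> smooth_alg g \<Longrightarrow> smooth_alg (\<lambda>x. f x + g x)"
| mult: "smooth_alg f \<Longrightarrow> smooth_alg g \<Longrightarrow> smooth_alg (\<lambda>x. f x * g x)"
| bump: "0 < a \<Longrightarrow> smooth_alg (\<lambda>x. bump_profile a j (r - (x - y) \<bullet> (x - y)))"

lemma smooth_alg_derivative:
  assumes "smooth_alg f"
  shows "\<exists>f'. (\<forall>x. (f has_derivative f' x) (at x)) \<and> (\<forall>v. smooth_alg (\<lambda>x. f' x v))"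
  using assms
proof induction
  case (const c)
  show ?case by (intro exI[of _ "\<lambda>x v. 0"]) (auto intro: smooth_alg.const)
next
  case (coord w)
  show ?case by (intro exI[of _ "\<lambda>x v. v \<bullet> w"]) (auto intro: smooth_alg.const intro!: derivative_eq_intros)
next
  case (add f g)
  then obtain f' g' where "\<And>x. (f has_derivative f' x) (at x)" "\<And>v. smooth_alg (\<lambda>x. f' x v)"
    "\<And>x. (g has_derivative g' x) (at x)" "\<And>v. smooth_alg (\<lambda>x. g' x v)" by blast
  then show ?case
    by (intro exI[of _ "\<lambda>x v. f' x v + g' x v"]) (auto intro: smooth_alg.add has_derivative_add)
next
  case (mult f g)
  then obtain f' g' where "\<And>x. (f has_derivative f' x) (at x)" "\<And>v. smooth_alg (\<lambda>x. f' x v)"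
    "\<And>x. (g has_derivative g' x) (at x)" "\<And>v. smooth_alg (\<lambda>x. g' x v)" by blast
  then show ?case using mult.hyps
    by (intro exI[of _ "\<lambda>x v. f x * g' x v + f' x v * g x"])
       (auto intro!: smooth_alg.add smooth_alg.mult has_derivative_mult)
next
  case (bump a j r y)
  let ?s = "\<lambda>x. r - (x - y) \<bullet> (x - y)"
  let ?h = "\<lambda>x. a * bump_profile a (j + 2) (?s x) + (- real j) * bump_profile a (j + 1) (?s x)"
  have "((\<lambda>x. bump_profile a j (?s x)) has_derivative (\<lambda>v. ?h x * ((- 2) * (x \<bullet> v + (- (y \<bullet> v)))))) (at x)" for x
  proof -
    have "(bump_profile a j has_derivative (*) (?h x)) (at (?s x))"
      using bump_profile_deriv[OF bump, of j "?s x"] by (simp add: has_field_derivative_def)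
    moreover have "(?s has_derivative (\<lambda>v. (- 2) * (x \<bullet> v + (- (y \<bullet> v))))) (at x)"
      by (auto intro!: derivative_eq_intros simp: inner_diff_left inner_diff_right inner_commute algebra_simps)
    ultimately show ?thesis
      using has_derivative_compose[of ?s _ x UNIV "bump_profile a j"] by blast
  qed
  moreover have "smooth_alg (\<lambda>x. ?h x * ((- 2) * (x \<bullet> v + (- (y \<bullet> v)))))" for v
    by (intro smooth_alg.intros bump)
  ultimately show ?case by (intro exI[of _ "\<lambda>x v. ?h x * ((- 2) * (x \<bullet> v + (- (y \<bullet> v))))"]) blast
qed

lemma smooth_alg_Ck:
  assumes "smooth_alg f"
  shows "Ck k f"
  using assms
proof (induction k arbitrary: f)
  case 0
  then obtain f' where "\<And>x. (f has_derivative f' x) (at x)" using smooth_alg_derivative by blast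
  then show ?case by (auto intro!: continuous_at_imp_continuous_on has_derivative_continuous)
next
  case (Suc k)
  then obtain f' where f': "\<And>x. (f has_derivative f' x) (at x)" "\<And>v. smooth_alg (\<lambda>x. f' x v)"
    using smooth_alg_derivative by blast
  then have "frechet_derivative f (at x) = f' x" for x using frechet_derivative_at by metis
  moreover have "f differentiable (at x)" for x using f'(1) unfolding differentiable_def by blast
  ultimately show ?case using f'(2) Suc.IH by simp
qed

lemma smooth_alg_prod: "finite I \<Longrightarrow> (\<And>i. i \<in> I \<Longrightarrow> smooth_alg (f i)) \<Longrightarrow> smooth_alg (\<lambda>x. \<Prod>i\<in>I. f i x)"
  by (induction I rule: finite_induct) (auto intro: smooth_alg.intros)

text \<open>The indicator of a bounded open set is a pointwise limit of test functions vanishing outside the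
  set. The set is a countable union of balls, and the \<open>n\<close>-th function is \<open>1 - \<Prod>\<^bsub>i<n\<^esub> (1 - \<beta>\<^sub>i)\<close> with bumps
  \<open>\<beta>\<^sub>i\<close> of the first \<open>n\<close> balls.\<close>
lemma open_test_functions:
  fixes U :: "'a::euclidean_space set"
  assumes U: "open U" "bounded U"
  obtains \<psi> :: "nat \<Rightarrow> 'a \<Rightarrow> real" where "\<And>n. test_function (\<psi> n)" "\<And>n x. 0 \<le> \<psi> n x" "\<And>n x. \<psi> n x \<le> 1"
    "\<And>n x. x \<notin> U \<Longrightarrow> \<psi> n x = 0" "\<And>x. x \<in> U \<Longrightarrow> (\<lambda>n. \<psi> n x) \<longlonglongrightarrow> 1"
proof -
  define F where "F = {B. \<exists>y r. B = ball y r \<and> 0 < r \<and> ball y r \<subseteq> U}"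
  have UF: "\<Union>F = U"
  proof
    show "\<Union>F \<subseteq> U" by (auto simp: F_def)
    show "U \<subseteq> \<Union>F"
    proof
      fix x assume "x \<in> U"
      then obtain e where "0 < e" "ball x e \<subseteq> U" using U(1) openE by blast
      then show "x \<in> \<Union>F" by (auto simp: F_def intro!: exI[of _ "ball x e"])
    qed
  qed
  have op: "open S" if "S \<in> F" for S using that by (auto simp: F_def)
  obtain F' where "F' \<subseteq> F" "countable F'" "\<Union>F' = \<Union>F" by (rule Lindelof[OF op], assumption, rule that)
  then have F': "F' \<subseteq> F" "countable F'" "\<Union>F' = U" using UF by auto
  define G where "G = insert {} F'"
  have G: "countable G" "G \<noteq> {}" "\<Union>G = U" using F' by (auto simp: G_def)
  have "\<exists>y r. from_nat_into G i = ball y r \<and> 0 \<le> r" for i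
  proof -
    have "from_nat_into G i \<in> G" by (rule from_nat_into[OF G(2)])
    then consider "from_nat_into G i = {}" | "from_nat_into G i \<in> F" using F'(1) by (auto simp: G_def)
    then show ?thesis
    proof cases
      case 1
      then show ?thesis by (intro exI[of _ 0]) simp
    next
      case 2
      then obtain y r where "from_nat_into G i = ball y r" "0 < r" by (auto simp: F_def)
      then show ?thesis by (intro exI[of _ y] exI[of _ r]) simp
    qed
  qed
  then obtain y r where yr: "\<And>i. from_nat_into G i = ball (y i) (r i)" "\<And>i::nat. (0::real) \<le> r i" by metis
  have "U = \<Union>(range (from_nat_into G))" using G(3) range_from_nat_into[OF G(2,1)] by simp
  then have Ueq: "U = (\<Union>i. ball (y i) (r i))" by (simp add: yr(1))
  define \<beta> where "\<beta> n i x = bump_profile (inverse (real (Suc n))) 0 ((r i)\<^sup>2 - (x - y i) \<bullet> (x - y i))" for n i x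
  have \<beta>01: "0 \<le> \<beta> n i x" "\<beta> n i x \<le> 1" for n i x
    by (auto simp: \<beta>_def bump_profile_def)
  have in_ball: "0 < (r i)\<^sup>2 - (x - y i) \<bullet> (x - y i) \<longleftrightarrow> x \<in> ball (y i) (r i)" for i x
  proof -
    have "(x - y i) \<bullet> (x - y i) = (dist (y i) x)\<^sup>2"
      by (simp add: dist_norm power2_norm_eq_inner[symmetric] norm_minus_commute)
    then show ?thesis
      using power_strict_mono[of "dist (y i) x" "r i" 2] power2_less_imp_less[OF _ yr(2)[of i], of "dist (y i) x"]
      by auto
  qed
  define \<psi> where "\<psi> n x = 1 + (- 1) * (\<Prod>i\<in>{..<n}. 1 + (- 1) * \<beta> n i x)" for n x
  have sm: "smooth_alg (\<psi> n)" for n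
    unfolding \<psi>_def \<beta>_def by (intro smooth_alg.intros smooth_alg_prod) auto
  have P01: "0 \<le> (\<Prod>i\<in>{..<n}. 1 + (- 1) * \<beta> n i x)" "(\<Prod>i\<in>{..<n}. 1 + (- 1) * \<beta> n i x) \<le> 1" for n x
    using \<beta>01 by (auto intro!: prod_nonneg prod_le_1)
  have out: "\<psi> n x = 0" if "x \<notin> U" for n x
  proof -
    have "\<beta> n i x = 0" for i
      using that in_ball[of i x] unfolding Ueq by (auto simp: \<beta>_def bump_profile_def)
    then show ?thesis by (simp add: \<psi>_def)
  qed
  show ?thesis
  proof (rule that)
    show "test_function (\<psi> n)" for n
      unfolding test_function_def
    proof (intro conjI allI smooth_alg_Ck[OF sm])
      have "{x. \<psi> n x \<noteq> 0} \<subseteq> U" using out by blast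
      then show "compact (closure {x. \<psi> n x \<noteq> 0})"
        using U(2) bounded_subset by (auto simp: compact_closure)
    qed
    show "0 \<le> \<psi> n x" "\<psi> n x \<le> 1" for n x using P01[where n = n and x = x] by (auto simp: \<psi>_def)
    show "\<psi> n x = 0" if "x \<notin> U" for n x by (rule out[OF that])
    show "(\<lambda>n. \<psi> n x) \<longlonglongrightarrow> 1" if x: "x \<in> U" for x
    proof -
      obtain i where i: "x \<in> ball (y i) (r i)" using x Ueq by blast
      let ?s = "(r i)\<^sup>2 - (x - y i) \<bullet> (x - y i)"
      have s: "0 < ?s" using i in_ball by blast
      have "(\<lambda>n. exp (- (inverse (real (Suc n)) / ?s))) \<longlonglongrightarrow> exp (- (0 / ?s))"
        by (intro tendsto_intros LIMSEQ_inverse_real_of_nat) (use s in auto)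
      then have lim: "(\<lambda>n. \<beta> n i x) \<longlonglongrightarrow> 1" using s by (simp add: \<beta>_def bump_profile_def)
      have "\<beta> n i x \<le> \<psi> n x" if "i < n" for n
      proof -
        have "(\<Prod>j\<in>{..<n}. 1 + (- 1) * \<beta> n j x) = (1 + (- 1) * \<beta> n i x) * (\<Prod>j\<in>{..<n} - {i}. 1 + (- 1) * \<beta> n j x)"
          using that by (intro prod.remove) auto
        also have "\<dots> \<le> (1 + (- 1) * \<beta> n i x) * 1"
          using \<beta>01 by (intro mult_left_mono) (auto intro!: prod_le_1)
        finally show ?thesis by (simp add: \<psi>_def)
      qed
      then show ?thesis
        by (intro tendsto_sandwich[OF _ _ lim tendsto_const])
           (use P01[of _ x] in \<open>auto simp: \<psi>_def eventually_sequentially intro!: exI[of _ "Suc i"]\<close>)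
    qed
  qed
qed

text \<open>An upper bound by a constant in the sense of distributions holds almost everywhere. It extends from
  test functions to indicators of bounded open sets, and then to the set where it is violated, by outer
  regularity.\<close>
lemma AE_le_of_test_functions:
  fixes u :: "'a::euclidean_space \<Rightarrow> real"
  assumes u: "integrable lborel u" and V: "open V"
    and le: "\<And>\<psi>. test_function \<psi> \<Longrightarrow> (\<And>x. 0 \<le> \<psi> x) \<Longrightarrow> (\<And>x. x \<notin> V \<Longrightarrow> \<psi> x = 0) \<Longrightarrow>
      (LINT x|lborel. u x * \<psi> x) \<le> c * (LINT x|lborel. \<psi> x)"
  shows "AE x in lborel. x \<in> V \<longrightarrow> u x \<le> c"
proof -
  note [measurable] = u
  have fin: "emeasure lborel U < \<infinity>" if "bounded U" for U :: "'a set"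
    using that by (rule emeasure_bounded_finite)
  have iw: "integrable lborel (\<lambda>x. indicator U x * (u x - c))" if "bounded U" "U \<in> sets borel" for U
  proof -
    have "integrable lborel (\<lambda>x. indicator U x * u x)"
      using integrable_mult_indicator[of U lborel u] u that(2) by simp
    moreover have "integrable lborel (\<lambda>x. indicator U x * c)"
      using fin[OF that(1)] that(2) by (intro integrable_mult_left) (simp add: integrable_indicator_iff)
    ultimately show ?thesis by (simp add: right_diff_distrib)
  qed
  have open_le: "(LINT x|lborel. indicator U x * (u x - c)) \<le> 0" if U: "open U" "bounded U" "U \<subseteq> V" for U
  proof -
    obtain \<psi> :: "nat \<Rightarrow> 'a \<Rightarrow> real" where \<psi>: "\<And>n. test_function (\<psi> n)" "\<And>n x. 0 \<le> \<psi> n x" "\<And>n x. \<psi> n x \<le> 1"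
      "\<And>n x. x \<notin> U \<Longrightarrow> \<psi> n x = 0" "\<And>x. x \<in> U \<Longrightarrow> (\<lambda>n. \<psi> n x) \<longlonglongrightarrow> 1"
      using open_test_functions[OF U(1,2)] by blast
    note [measurable] = test_function_measurable[OF \<psi>(1)]
    have Um: "U \<in> sets borel" using U(1) by simp
    have "(\<lambda>n. LINT x|lborel. \<psi> n x * (u x - c)) \<longlonglongrightarrow> (LINT x|lborel. indicator U x * (u x - c))"
    proof (rule integral_dominated_convergence[where w = "\<lambda>x. \<bar>indicator U x * (u x - c)\<bar>"])
      show "integrable lborel (\<lambda>x. \<bar>indicator U x * (u x - c)\<bar>)" using iw[OF U(2) Um] by (rule integrable_abs)
      show "AE x in lborel. (\<lambda>n. \<psi> n x * (u x - c)) \<longlonglongrightarrow> indicator U x * (u x - c)"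
      proof (rule AE_I2)
        fix x show "(\<lambda>n. \<psi> n x * (u x - c)) \<longlonglongrightarrow> indicator U x * (u x - c)"
          by (cases "x \<in> U") (auto simp: \<psi>(4) intro!: tendsto_mult_right[of _ 1, simplified] tendsto_mult[OF \<psi>(5) tendsto_const, simplified])
      qed
      show "AE x in lborel. norm (\<psi> n x * (u x - c)) \<le> \<bar>indicator U x * (u x - c)\<bar>" for n
      proof (rule AE_I2)
        fix x show "norm (\<psi> n x * (u x - c)) \<le> \<bar>indicator U x * (u x - c)\<bar>"
          using \<psi>(2,3)[of n x] \<psi>(4)[of x n] by (cases "x \<in> U") (auto simp: abs_mult intro: mult_left_le_one_le)
      qed
    qed (use Um in auto)
    moreover have "(LINT x|lborel. \<psi> n x * (u x - c)) \<le> 0" for n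
    proof -
      have i1: "integrable lborel (\<lambda>x. u x * \<psi> n x)"
        by (rule Bochner_Integration.integrable_bound[OF u]) (use \<psi>(2,3) in \<open>auto simp: abs_mult intro!: AE_I2 mult_right_le_one_le\<close>)
      have "(LINT x|lborel. u x * \<psi> n x) \<le> c * (LINT x|lborel. \<psi> n x)"
        by (rule le[OF \<psi>(1,2)]) (use \<psi>(4) U(3) in blast)
      moreover have "(LINT x|lborel. \<psi> n x * (u x - c)) = (LINT x|lborel. u x * \<psi> n x - c * \<psi> n x)"
        by (simp add: algebra_simps)
      moreover have "\<dots> = (LINT x|lborel. u x * \<psi> n x) - c * (LINT x|lborel. \<psi> n x)"
        using i1 test_function_integrable[OF \<psi>(1)] by simp
      ultimately show ?thesis by simp
    qed
    ultimately show ?thesis by (intro LIMSEQ_le_const2) auto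
  qed
  have "AE x in lborel. x \<in> V \<inter> ball 0 (real R) \<longrightarrow> u x \<le> c" for R :: nat
  proof -
    define E where "E = {x. u x > c} \<inter> (V \<inter> ball 0 (real R))"
    have Em[measurable]: "E \<in> sets borel"
    proof -
      have "{x \<in> space lborel. c < u x} \<in> sets lborel" by measurable
      moreover have "V \<inter> ball 0 (real R) \<in> sets borel" using V by (intro borel_open open_Int open_ball)
      ultimately have "{x \<in> space lborel. c < u x} \<inter> (V \<inter> ball 0 (real R)) \<in> sets borel"
        unfolding sets_lborel by (rule sets.Int)
      then show ?thesis unfolding E_def by simp
    qed
    have "\<exists>T. open T \<and> E \<subseteq> T \<and> T \<subseteq> V \<inter> ball 0 (real R) \<and> emeasure lborel (T - E) < ennreal (inverse (real (Suc n)))" for n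
    proof -
      obtain T where T: "open T" "E \<subseteq> T" "emeasure lebesgue (T - E) < ennreal (inverse (real (Suc n)))"
        using sets_lebesgue_outer_open[of E "inverse (real (Suc n))"] Em by auto
      let ?T = "T \<inter> (V \<inter> ball 0 (real R))"
      have "emeasure lborel (?T - E) \<le> emeasure lborel (T - E)"
        using T(1) V by (intro emeasure_mono) auto
      also have "\<dots> = emeasure lebesgue (T - E)" using T(1) by (simp add: emeasure_completion)
      finally show ?thesis using T V by (intro exI[of _ ?T]) (auto simp: E_def)
    qed
    then obtain T where T: "\<And>n. open (T n)" "\<And>n. E \<subseteq> T n" "\<And>n. T n \<subseteq> V \<inter> ball 0 (real R)"
      "\<And>n::nat. emeasure lborel (T n - E) < ennreal (inverse (real (Suc n)))" by metis
    have Tm[measurable]: "T n \<in> sets borel" for n using T(1) by simp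
    define W where "W n = (\<Inter>k\<le>n. T k)" for n
    have W1: "open (W n)" for n unfolding W_def using T(1) by auto
    have W2: "W n \<subseteq> V \<inter> ball 0 (real R)" for n
      by (rule order_trans[OF _ T(3)[of n]]) (auto simp: W_def)
    note W = W1 W2
    have bW: "bounded (W n)" for n
      by (rule bounded_subset[OF bounded_ball[of 0 "real R"]]) (use W2[of n] in blast)
    define D where "D = (\<Inter>k. T k)"
    have "D - E \<in> null_sets lborel"
    proof -
      have Dm: "D - E \<in> sets borel" unfolding D_def by auto
      have "emeasure lborel (D - E) \<le> ennreal (inverse (real (Suc n)))" for n
      proof -
        have "emeasure lborel (D - E) \<le> emeasure lborel (T n - E)"
          by (intro emeasure_mono) (auto simp: D_def)
        then show ?thesis using T(4)[of n] by simp
      qed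
      moreover have "(\<lambda>n. ennreal (inverse (real (Suc n)))) \<longlonglongrightarrow> ennreal 0"
        by (intro tendsto_ennrealI LIMSEQ_inverse_real_of_nat)
      ultimately have "emeasure lborel (D - E) \<le> ennreal 0"
        by (intro LIMSEQ_le_const) auto
      then show ?thesis using Dm by (auto simp: null_sets_def)
    qed
    then have ae: "AE x in lborel. x \<notin> D - E" by (rule AE_not_in)
    have "(\<lambda>n. LINT x|lborel. indicator (W n) x * (u x - c)) \<longlonglongrightarrow> (LINT x|lborel. indicator E x * (u x - c))"
    proof (rule integral_dominated_convergence[where w = "\<lambda>x. \<bar>indicator (W 0) x * (u x - c)\<bar>"])
      show "integrable lborel (\<lambda>x. \<bar>indicator (W 0) x * (u x - c)\<bar>)"
        using W(1)[of 0] by (intro integrable_abs iw bW) auto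
      show "AE x in lborel. (\<lambda>n. indicator (W n) x * (u x - c)) \<longlonglongrightarrow> indicator E x * (u x - c)"
        using ae
      proof eventually_elim
        case (elim x)
        show ?case
        proof (cases "x \<in> E")
          case True
          then have "x \<in> W n" for n using T(2) by (auto simp: W_def)
          then show ?thesis using True by simp
        next
          case False
          then obtain k where k: "x \<notin> T k" using elim by (auto simp: D_def)
          then have "\<forall>\<^sub>F n in sequentially. indicator (W n) x * (u x - c) = 0"
            unfolding eventually_sequentially
            by (intro exI[of _ k]) (auto simp: W_def indicator_def)
          then show ?thesis using False by (simp add: tendsto_eventually)
        qed
      qed
      show "AE x in lborel. norm (indicator (W n) x * (u x - c)) \<le> \<bar>indicator (W 0) x * (u x - c)\<bar>" for n
        by (rule AE_I2) (auto simp: indicator_def W_def)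
    qed (use W(1) in auto)
    moreover have "(LINT x|lborel. indicator (W n) x * (u x - c)) \<le> 0" for n
      using W1[of n] W2[of n] bW[of n] by (intro open_le) auto
    ultimately have E0: "(LINT x|lborel. indicator E x * (u x - c)) \<le> 0" by (intro LIMSEQ_le_const2) auto
    have iE: "integrable lborel (\<lambda>x. indicator E x * (u x - c))"
      by (rule iw[OF bounded_subset[OF bounded_ball[of 0 "real R"]] Em]) (auto simp: E_def)
    have pos: "AE x in lborel. 0 \<le> indicator E x * (u x - c)" by (rule AE_I2) (auto simp: indicator_def E_def)
    have "0 \<le> (LINT x|lborel. indicator E x * (u x - c))" by (rule integral_nonneg_AE[OF pos])
    with E0 have "(LINT x|lborel. indicator E x * (u x - c)) = 0" by simp
    then have "AE x in lborel. indicator E x * (u x - c) = 0"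
      using integral_nonneg_eq_0_iff_AE[OF iE pos] by blast
    then show ?thesis by eventually_elim (auto simp: E_def indicator_def split: if_splits)
  qed
  then have "AE x in lborel. \<forall>R::nat. x \<in> V \<inter> ball 0 (real R) \<longrightarrow> u x \<le> c"
    unfolding AE_all_countable by blast
  then show ?thesis
  proof eventually_elim
    case (elim x)
    obtain R :: nat where "norm x < real R" using reals_Archimedean2 by blast
    with elim show ?case by auto
  qed
qed

section \<open>Truncations of a stable-like jump density\<close>

text \<open>A jump density comparable to that of the isotropic stable process. At \<open>z = 0\<close> the two-sided bound reads
  \<open>f 0 = 0\<close>, since division by zero gives zero; this is harmless and keeps the bounds free of exceptions.\<close>
locale stable_like =
  fixes f :: "'a::euclidean_space \<Rightarrow> real" and \<alpha> c C :: real
  assumes \<alpha>: "0 < \<alpha>" "\<alpha> < 2" and cC: "0 < c" "0 < C"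
    and f_measurable [measurable]: "f \<in> borel_measurable borel"
    and f_sym: "f (- z) = f z"
    and f_lower: "c / norm z powr (real DIM('a) + \<alpha>) \<le> f z"
    and f_upper: "f z \<le> C / norm z powr (real DIM('a) + \<alpha>)"
    and int_small: "integrable lborel (\<lambda>z. indicator {z. norm z \<le> 1} z * ((norm z)\<^sup>2 * f z))"
    and int_large: "integrable lborel (\<lambda>z. indicator {z. 1 < norm z} z * f z)"
begin

text \<open>The jumps larger than \<open>\<epsilon>\<close>, the jumps with sizes between \<open>a\<close> and \<open>b\<close>, and the second moment of the jumps
  of size at most \<open>r\<close>.\<close>
definition tail :: "real \<Rightarrow> 'a \<Rightarrow> real" where
  "tail \<epsilon> z = indicator {z. \<epsilon> < norm z} z * f z"

definition ring :: "real \<Rightarrow> real \<Rightarrow> 'a \<Rightarrow> real" where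
  "ring a b z = indicator {z. a < norm z \<and> norm z \<le> b} z * f z"

definition small_moment :: "real \<Rightarrow> real" where
  "small_moment r = (LINT z|lborel. indicator {z. norm z \<le> r} z * ((norm z)\<^sup>2 * f z))"

lemma f_nonneg: "0 \<le> f z"
  using f_lower[of z] cC(1) by (smt (verit) divide_nonneg_nonneg powr_ge_zero)

lemma measurable_norm_sets [measurable]:
  "{z :: 'a. a < norm z} \<in> sets borel" "{z :: 'a. norm z \<le> a} \<in> sets borel"
  "{z :: 'a. a < norm z \<and> norm z \<le> b} \<in> sets borel"
  by measurable

lemma jump_tail:
  assumes "0 < \<epsilon>"
  shows "jump_density (tail \<epsilon>)"
  unfolding jump_density_def
proof (intro conjI allI)
  show "integrable lborel (tail \<epsilon>)"
  proof (rule Bochner_Integration.integrable_bound)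
    show "integrable lborel (\<lambda>z. inverse (\<epsilon>\<^sup>2) * (indicator {z. norm z \<le> 1} z * ((norm z)\<^sup>2 * f z)) + indicator {z. 1 < norm z} z * f z)"
      using int_small int_large by simp
    show "AE z in lborel. norm (tail \<epsilon> z) \<le> norm (inverse (\<epsilon>\<^sup>2) * (indicator {z. norm z \<le> 1} z * ((norm z)\<^sup>2 * f z)) + indicator {z. 1 < norm z} z * f z)"
    proof (rule AE_I2)
      fix z :: 'a
      have "f z \<le> inverse (\<epsilon>\<^sup>2) * ((norm z)\<^sup>2 * f z)" if "\<epsilon> < norm z"
      proof -
        have "1 \<le> inverse (\<epsilon>\<^sup>2) * (norm z)\<^sup>2"
          using that assms by (simp add: field_simps power_mono)
        from mult_right_mono[OF this f_nonneg[of z]] show ?thesis by simp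
      qed
      then show "norm (tail \<epsilon> z) \<le> norm (inverse (\<epsilon>\<^sup>2) * (indicator {z. norm z \<le> 1} z * ((norm z)\<^sup>2 * f z)) + indicator {z. 1 < norm z} z * f z)"
        using f_nonneg[of z] by (auto simp: tail_def indicator_def abs_mult)
    qed
  qed (simp add: tail_def[abs_def])
qed (auto simp: tail_def indicator_def f_nonneg f_sym)

lemma tail_split: "a \<le> b \<Longrightarrow> tail a = (\<lambda>z. ring a b z + tail b z)"
  by (auto simp: fun_eq_iff tail_def ring_def indicator_def)

lemma jump_ring:
  assumes "0 < a"
  shows "jump_density (ring a b)"
  unfolding jump_density_def
proof (intro conjI allI)
  show "integrable lborel (ring a b)"
    by (rule Bochner_Integration.integrable_bound[OF jump_densityD(1)[OF jump_tail[OF assms]]])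
       (auto simp: ring_def[abs_def] tail_def indicator_def f_nonneg)
qed (auto simp: ring_def indicator_def f_nonneg f_sym)

lemma int_small_moment: "integrable lborel (\<lambda>z. indicator {z. norm z \<le> r} z * ((norm z)\<^sup>2 * f z))"
proof (rule Bochner_Integration.integrable_bound)
  show "integrable lborel (\<lambda>z. (indicator {z. norm z \<le> 1} z * ((norm z)\<^sup>2 * f z)) + r\<^sup>2 * (indicator {z. 1 < norm z} z * f z))"
    using int_small int_large by simp
  show "AE z in lborel. norm (indicator {z. norm z \<le> r} z * ((norm z)\<^sup>2 * f z))
     \<le> norm ((indicator {z. norm z \<le> 1} z * ((norm z)\<^sup>2 * f z)) + r\<^sup>2 * (indicator {z. 1 < norm z} z * f z))"
  proof (rule AE_I2)
    fix z :: 'a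
    have "(norm z)\<^sup>2 * f z \<le> r\<^sup>2 * f z" if "norm z \<le> r"
      using that f_nonneg[of z] by (intro mult_right_mono power_mono) auto
    then show "norm (indicator {z. norm z \<le> r} z * ((norm z)\<^sup>2 * f z))
       \<le> norm ((indicator {z. norm z \<le> 1} z * ((norm z)\<^sup>2 * f z)) + r\<^sup>2 * (indicator {z. 1 < norm z} z * f z))"
      using f_nonneg[of z] by (auto simp: indicator_def abs_mult)
  qed
qed simp

lemma small_moment_nonneg: "0 \<le> small_moment r"
  unfolding small_moment_def using f_nonneg by (auto intro!: integral_nonneg_AE)

lemma small_moment_mono: "a \<le> b \<Longrightarrow> small_moment a \<le> small_moment b"
  unfolding small_moment_def by (rule integral_mono[OF int_small_moment int_small_moment]) (auto simp: indicator_def f_nonneg)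

lemma ring_small_moment:
  shows "integrable lborel (\<lambda>z. (norm z)\<^sup>2 * ring a b z)" and "(LINT z|lborel. (norm z)\<^sup>2 * ring a b z) \<le> small_moment b"
proof -
  show i: "integrable lborel (\<lambda>z. (norm z)\<^sup>2 * ring a b z)"
    by (rule Bochner_Integration.integrable_bound[OF int_small_moment[of b]])
       (auto simp: ring_def[abs_def] indicator_def f_nonneg)
  show "(LINT z|lborel. (norm z)\<^sup>2 * ring a b z) \<le> small_moment b"
    unfolding small_moment_def by (rule integral_mono[OF i int_small_moment]) (auto simp: ring_def indicator_def f_nonneg)
qed

lemma small_moment_tendsto: "(small_moment \<longlongrightarrow> 0) (at_right 0)"
proof -
  have "(\<lambda>n. small_moment (inverse (real (Suc n)))) \<longlonglongrightarrow> (LINT z|(lborel :: 'a measure). 0)"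
    unfolding small_moment_def
  proof (rule integral_dominated_convergence[where w = "\<lambda>z. indicator {z. norm z \<le> 1} z * ((norm z)\<^sup>2 * f z)"])
    show "AE z in lborel. (\<lambda>n. indicator {z. norm z \<le> inverse (real (Suc n))} z * ((norm z)\<^sup>2 * f z)) \<longlonglongrightarrow> 0"
    proof (rule AE_I2)
      fix z :: 'a
      show "(\<lambda>n. indicator {z. norm z \<le> inverse (real (Suc n))} z * ((norm z)\<^sup>2 * f z)) \<longlonglongrightarrow> 0"
      proof (cases "z = 0")
        case False
        then have "\<forall>\<^sub>F n in sequentially. inverse (real (Suc n)) < norm z"
          by (intro order_tendstoD(2)[OF LIMSEQ_inverse_real_of_nat]) simp
        then show ?thesis by (intro tendsto_eventually) (auto elim!: eventually_mono)
      qed simp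
    qed
    show "AE z in lborel. norm (indicator {z. norm z \<le> inverse (real (Suc n))} z * ((norm z)\<^sup>2 * f z))
      \<le> indicator {z. norm z \<le> 1} z * ((norm z)\<^sup>2 * f z)" for n
    proof (rule AE_I2)
      fix z :: 'a
      have "inverse (real (Suc n)) \<le> 1" by (simp add: field_simps)
      then show "norm (indicator {z. norm z \<le> inverse (real (Suc n))} z * ((norm z)\<^sup>2 * f z))
      \<le> indicator {z. norm z \<le> 1} z * ((norm z)\<^sup>2 * f z)"
        using f_nonneg[of z] by (auto simp: indicator_def)
    qed
  qed (use int_small in auto)
  then have lim: "(\<lambda>n. small_moment (inverse (real (Suc n)))) \<longlonglongrightarrow> 0" by simp
  show ?thesis
  proof (rule order_tendstoI)
    fix a :: real assume "a < 0"
    then show "\<forall>\<^sub>F r in at_right 0. a < small_moment r" using small_moment_nonneg by (intro always_eventually) (auto intro: less_le_trans)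
  next
    fix a :: real assume "0 < a"
    then obtain n where n: "small_moment (inverse (real (Suc n))) < a"
      using order_tendstoD(2)[OF lim] by (auto simp: eventually_sequentially)
    show "\<forall>\<^sub>F r in at_right 0. small_moment r < a"
      unfolding eventually_at_right_field
      by (rule exI[of _ "inverse (real (Suc n))"]) (use n small_moment_mono in \<open>auto intro: le_less_trans less_imp_le\<close>)
  qed
qed

lemma gen_tail_diff:
  assumes ab: "0 < a" "a \<le> b" and \<phi>: "second_diff K \<phi>" and K: "0 \<le> K"
  shows "norm (ap (gen_op (tail a)) \<phi> - ap (gen_op (tail b)) \<phi>) \<le> K / 2 * small_moment b"
proof -
  have "gen_op (tail a) = gen_op (ring a b) + gen_op (tail b)"
    unfolding tail_split[OF ab(2)] using ab by (intro gen_op_add jump_ring jump_tail) auto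
  then have "norm (ap (gen_op (tail a)) \<phi> - ap (gen_op (tail b)) \<phi>) = norm (ap (gen_op (ring a b)) \<phi>)"
    by (simp add: ap.add_left)
  also have "\<dots> \<le> K / 2 * (LINT z|lborel. (norm z)\<^sup>2 * ring a b z)"
    by (rule norm_gen_second_diff[OF jump_ring[OF ab(1)] \<phi> ring_small_moment(1)])
  also have "\<dots> \<le> K / 2 * small_moment b" using K by (intro mult_left_mono ring_small_moment) auto
  finally show ?thesis .
qed

lemma gen_tail_limit:
  fixes \<phi> :: "'a \<Rightarrow>\<^sub>C real"
  assumes \<phi>: "second_diff K \<phi>" and K: "0 \<le> K"
  obtains L where "\<And>\<epsilon>. 0 < \<epsilon> \<Longrightarrow> norm (ap (gen_op (tail \<epsilon>)) \<phi> - L) \<le> K / 2 * small_moment \<epsilon>"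
proof -
  let ?e = "\<lambda>n. inverse (real (Suc n))"
  let ?X = "\<lambda>n. ap (gen_op (tail (?e n))) \<phi>"
  have e: "0 < ?e n" "n \<le> m \<Longrightarrow> ?e m \<le> ?e n" for n m by (auto simp: field_simps)
  have lim: "(\<lambda>n. K / 2 * small_moment (?e n)) \<longlonglongrightarrow> K / 2 * 0"
    by (intro tendsto_intros filterlim_compose[OF small_moment_tendsto])
       (auto simp: filterlim_at LIMSEQ_inverse_real_of_nat simp del: of_nat_Suc)
  have "Cauchy ?X"
  proof (rule metric_CauchyI)
    fix r :: real assume "0 < r"
    then obtain N where N: "K / 2 * small_moment (?e N) < r / 2"
      using order_tendstoD(2)[OF lim, of "r / 2"] by (auto simp: eventually_sequentially)
    have "dist (?X m) (?X n) < r" if "N \<le> m" "N \<le> n" for m n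
    proof -
      have "norm (?X m - ?X N) \<le> K / 2 * small_moment (?e N)" "norm (?X n - ?X N) \<le> K / 2 * small_moment (?e N)"
        by (rule gen_tail_diff[OF e(1) e(2) \<phi> K], rule that)+
      then show ?thesis using N dist_triangle2[of "?X m" "?X n" "?X N"] by (simp add: dist_norm)
    qed
    then show "\<exists>M. \<forall>m\<ge>M. \<forall>n\<ge>M. dist (?X m) (?X n) < r" by blast
  qed
  then have "convergent ?X" by (rule Cauchy_convergent)
  then obtain L where L: "?X \<longlonglongrightarrow> L" unfolding convergent_def by (elim exE)
  show ?thesis
  proof (rule that)
    fix \<epsilon> :: real assume \<epsilon>: "0 < \<epsilon>"
    have "(\<lambda>n. norm (ap (gen_op (tail \<epsilon>)) \<phi> - ?X n)) \<longlonglongrightarrow> norm (ap (gen_op (tail \<epsilon>)) \<phi> - L)"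
      by (intro tendsto_intros L)
    moreover have "\<forall>\<^sub>F n in sequentially. ?e n < \<epsilon>"
      by (rule order_tendstoD(2)[OF LIMSEQ_inverse_real_of_nat \<epsilon>])
    then have "\<forall>\<^sub>F n in sequentially. norm (ap (gen_op (tail \<epsilon>)) \<phi> - ?X n) \<le> K / 2 * small_moment \<epsilon>"
    proof eventually_elim
      case (elim n)
      then show ?case
        using gen_tail_diff[OF e(1) less_imp_le[OF elim] \<phi> K] by (simp add: norm_minus_commute)
    qed
    ultimately show "norm (ap (gen_op (tail \<epsilon>)) \<phi> - L) \<le> K / 2 * small_moment \<epsilon>"
      by (rule tendsto_upperbound) simp
  qed
qed

section \<open>Weak solutions as limits of compound Poisson semigroups\<close>

abbreviation levy :: "'a measure" where "levy \<equiv> density lborel (\<lambda>z. ennreal (f z))"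

text \<open>The principal value is the limit of the truncated generators, which is uniform for \<open>C\<^sup>1\<^sup>,\<^sup>1\<close> functions.\<close>
lemma levy_operator_eq:
  fixes \<psi>b :: "'a \<Rightarrow>\<^sub>C real"
  assumes L: "\<And>\<epsilon>. 0 < \<epsilon> \<Longrightarrow> norm (ap (gen_op (tail \<epsilon>)) \<psi>b - L) \<le> K / 2 * small_moment \<epsilon>"
  shows "levy_operator levy (apply_bcontfun \<psi>b) x = L x"
proof -
  have eq: "(LINT z:{z. \<epsilon> < norm z}|levy. (\<psi>b (x + z) - \<psi>b x)) = ap (gen_op (tail \<epsilon>)) \<psi>b x" if "0 < \<epsilon>" for \<epsilon>
  proof -
    have "(LINT z:{z. \<epsilon> < norm z}|levy. (\<psi>b (x + z) - \<psi>b x)) =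
        (LINT z|lborel. f z *\<^sub>R (indicator {z. \<epsilon> < norm z} z *\<^sub>R (\<psi>b (x + z) - \<psi>b x)))"
      unfolding set_lebesgue_integral_def by (rule integral_density) (auto simp: f_nonneg)
    also have "\<dots> = (LINT z|lborel. tail \<epsilon> z * (\<psi>b (x + z) - \<psi>b x))"
      by (simp add: tail_def ac_simps)
    finally show ?thesis by (simp add: gen_op_apply(1)[OF jump_tail[OF that]])
  qed
  have "((\<lambda>\<epsilon>. ap (gen_op (tail \<epsilon>)) \<psi>b - L) \<longlongrightarrow> 0) (at_right 0)"
  proof (rule Lim_null_comparison)
    show "\<forall>\<^sub>F \<epsilon> in at_right 0. norm (ap (gen_op (tail \<epsilon>)) \<psi>b - L) \<le> K / 2 * small_moment \<epsilon>"
      unfolding eventually_at_right_field by (intro exI[of _ 1] conjI allI impI L) simp_all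
    show "((\<lambda>\<epsilon>. K / 2 * small_moment \<epsilon>) \<longlongrightarrow> 0) (at_right 0)" by (rule tendsto_mult_right_zero[OF small_moment_tendsto])
  qed
  then have "((\<lambda>\<epsilon>. ap (gen_op (tail \<epsilon>)) \<psi>b) \<longlongrightarrow> L) (at_right 0)" by (simp add: LIM_zero_iff)
  then have "((\<lambda>\<epsilon>. ap (gen_op (tail \<epsilon>)) \<psi>b x) \<longlongrightarrow> L x) (at_right 0)" by (rule tendsto_apply_bcontfun)
  moreover have "\<forall>\<^sub>F \<epsilon> in at_right 0. ap (gen_op (tail \<epsilon>)) \<psi>b x = (LINT z:{z. \<epsilon> < norm z}|levy. (\<psi>b (x + z) - \<psi>b x))"
    by (auto simp: eventually_at_right_field eq intro!: exI[of _ 1])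
  ultimately have "((\<lambda>\<epsilon>. LINT z:{z. \<epsilon> < norm z}|levy. (\<psi>b (x + z) - \<psi>b x)) \<longlongrightarrow> L x) (at_right 0)"
    by (rule Lim_transform_eventually)
  then show ?thesis unfolding levy_operator_def by (intro tendsto_Lim) auto
qed

lemma levy_operator_shift: "levy_operator \<mu> (\<lambda>y. \<psi> (y + a)) x = levy_operator \<mu> \<psi> (x + a)"
  by (simp add: levy_operator_def algebra_simps)

lemma measurable_time_integral:
  fixes u :: "'a \<Rightarrow> real \<Rightarrow> real"
  assumes u: "(\<lambda>(x, t). u x t) \<in> borel_measurable (borel \<Otimes>\<^sub>M restrict_space borel {0<..})"
    and l [measurable]: "l \<in> borel_measurable borel"
  shows "(\<lambda>t. indicator {0<..} t * (LINT y|lborel. u y t * l y)) \<in> borel_measurable borel"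
proof -
  let ?R = "restrict_space borel {0<..} :: real measure"
  have "(\<lambda>(x, t). u x t) \<in> borel_measurable (lborel \<Otimes>\<^sub>M ?R)"
    using u by (simp cong: measurable_cong_sets sets_pair_measure_cong)
  then have "(\<lambda>(t, x). u x t) \<in> borel_measurable (?R \<Otimes>\<^sub>M lborel)"
    by (subst measurable_pair_swap_iff) (simp add: case_prod_beta')
  then have "(\<lambda>p. u (snd p) (fst p)) \<in> borel_measurable (?R \<Otimes>\<^sub>M lborel)" by (simp add: case_prod_beta')
  moreover have "(\<lambda>p. l (snd p)) \<in> borel_measurable (?R \<Otimes>\<^sub>M lborel)" by measurable
  ultimately have "(\<lambda>(t, x). u x t * l x) \<in> borel_measurable (?R \<Otimes>\<^sub>M lborel)"
    by (simp add: case_prod_beta')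
  then have "(\<lambda>t. LINT y|lborel. u y t * l y) \<in> borel_measurable ?R"
    by (rule lborel.borel_measurable_lebesgue_integral)
  then show ?thesis
    by (subst (asm) borel_measurable_restrict_space_iff) auto
qed

text \<open>Tested against \<open>\<psi>\<close>, a weak solution differs from the truncated semigroups by at most the error
  made in the generator. In particular it is determined by them.\<close>
lemma fundamental_solution_approx:
  fixes \<psi>b :: "'a \<Rightarrow>\<^sub>C real"
  assumes u: "fundamental_solution levy x0 u" and \<psi>: "test_function \<psi>"
    and \<psi>b: "apply_bcontfun \<psi>b = \<psi>" and K: "second_diff K \<psi>b" "0 \<le> K"
  obtains M where "0 \<le> M" "\<And>t \<epsilon>. 0 < t \<Longrightarrow> 0 < \<epsilon> \<Longrightarrow>
    \<bar>(LINT x|lborel. u x t * \<psi> x) - ap (cps (tail \<epsilon>) t) \<psi>b x0\<bar> \<le> t * (M * (K / 2 * small_moment \<epsilon>))"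
proof -
  obtain L where L: "\<And>\<epsilon>. 0 < \<epsilon> \<Longrightarrow> norm (ap (gen_op (tail \<epsilon>)) \<psi>b - L) \<le> K / 2 * small_moment \<epsilon>"
    by (rule gen_tail_limit[OF K], rule that)
  obtain M0 where M0: "\<And>t. 0 < t \<Longrightarrow> integrable lborel (\<lambda>x. u x t)" "\<And>t. 0 < t \<Longrightarrow> (LINT x|lborel. u x t) \<le> M0"
    using u unfolding fundamental_solution_def by blast
  have u0: "\<And>x t. 0 < t \<Longrightarrow> 0 \<le> u x t"
    and um: "(\<lambda>(x, t). u x t) \<in> borel_measurable (borel \<Otimes>\<^sub>M restrict_space borel {0<..})"
    and weak: "\<And>\<psi> t. test_function \<psi> \<Longrightarrow> 0 < t \<Longrightarrow> (LINT x|lborel. u x t * \<psi> x) =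
          \<psi> x0 + (LINT s:{0<..<t}|lborel. (LINT x|lborel. u x s * levy_operator levy \<psi> x))"
    using u unfolding fundamental_solution_def by blast+
  define M where "M = max M0 1"
  have M: "0 \<le> M" "1 \<le> M" by (auto simp: M_def)
  define U where "U s = (if 0 < s then conv_op (\<lambda>y. u y s) else shift_op x0)" for s
  define v where "v s = ap (U s) \<psi>b" for s
  have U_apply: "ap (U s) \<phi> x = (LINT y|lborel. u y s * \<phi> (x + y))" if "0 < s" for s \<phi> x
    using that by (simp add: U_def conv_op_apply[OF M0(1)])
  have nU: "norm (U s) \<le> M" for s
  proof (cases "0 < s")
    case True
    have "norm (U s) \<le> (LINT y|lborel. \<bar>u y s\<bar>)" using True norm_conv_op[OF M0(1)[OF True]] by (simp add: U_def)
    also have "(\<lambda>y. \<bar>u y s\<bar>) = (\<lambda>y. u y s)" using u0[OF True] by simp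
    finally show ?thesis using M0(2)[OF True] by (simp add: M_def)
  next
    case False
    then show ?thesis using norm_shift_op[of x0] M(2) by (simp add: U_def)
  qed
  have UM: "norm (ap (U s) \<phi>) \<le> M * norm \<phi>" for s \<phi>
    using norm_ap[of "U s" \<phi>] mult_right_mono[OF nU[of s] norm_ge_zero[of \<phi>]] by linarith
  define W where "W x \<tau> = indicator {0<..} \<tau> * (LINT y|lborel. u y \<tau> * L (x + y))" for x \<tau>
  have Wm: "W x \<in> borel_measurable borel" for x
    unfolding W_def by (rule measurable_time_integral[OF um]) simp
  have WU: "W x \<tau> = ap (U \<tau>) L x" if "0 < \<tau>" for x \<tau> using that by (simp add: W_def U_apply)
  have Wb: "\<bar>W x \<tau>\<bar> \<le> M * norm L" for x \<tau>
  proof (cases "0 < \<tau>")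
    case True
    have "\<bar>ap (U \<tau>) L x\<bar> \<le> norm (ap (U \<tau>) L)" by (rule abs_apply_le_norm)
    then show ?thesis using UM[of \<tau> L] WU[OF True] by simp
  qed (use M in \<open>simp add: W_def\<close>)
  have vx: "v s x = \<psi> (x0 + x) + (LINT \<tau>:{0<..<s}|lborel. W x \<tau>)" if "0 \<le> s" for s x
  proof (cases "s = 0")
    case True
    then show ?thesis by (simp add: v_def U_def \<psi>b add.commute set_lebesgue_integral_def)
  next
    case False
    then have s: "0 < s" using that by simp
    have lev: "levy_operator levy (\<lambda>y. \<psi> (y + x)) y = L (y + x)" for y
      using levy_operator_eq[OF L] by (simp add: levy_operator_shift \<psi>b)
    have "v s x = (LINT y|lborel. u y s * \<psi> (y + x))" by (simp add: v_def U_apply[OF s] \<psi>b add.commute)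
    also have "\<dots> = \<psi> (x0 + x) + (LINT \<tau>:{0<..<s}|lborel. (LINT y|lborel. u y \<tau> * L (y + x)))"
      using weak[OF test_function_shift[OF \<psi>, of x] s] by (simp add: lev)
    also have "(LINT \<tau>:{0<..<s}|lborel. (LINT y|lborel. u y \<tau> * L (y + x))) = (LINT \<tau>:{0<..<s}|lborel. W x \<tau>)"
      unfolding set_lebesgue_integral_def
      by (rule Bochner_Integration.integral_cong) (auto simp: W_def indicator_def add.commute)
    finally show ?thesis .
  qed
  have vinc: "\<bar>(v (s + r) - v s - r *\<^sub>R k) x\<bar> \<le> r * e"
    if "0 \<le> s" "0 \<le> r" "\<And>\<tau>. s < \<tau> \<Longrightarrow> \<tau> < s + r \<Longrightarrow> \<bar>ap (U \<tau>) L x - k x\<bar> \<le> e" for s r x e and k :: "'a \<Rightarrow>\<^sub>C real"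
  proof -
    have "\<bar>(LINT \<tau>:{0<..<s + r}|lborel. W x \<tau>) - (LINT \<tau>:{0<..<s}|lborel. W x \<tau>) - r * k x\<bar> \<le> r * e"
      by (rule set_integral_increment_bound[OF Wm Wb]) (use that WU in auto)
    then show ?thesis using that vx[of s x] vx[of "s + r" x] by (simp add: minus_bcontfun.rep_eq)
  qed
  have lip: "norm (v (s + r) - v s) \<le> r * (M * norm L)" if "0 \<le> s" "0 \<le> r" for s r
  proof (rule norm_bound)
    fix x
    have "\<bar>ap (U \<tau>) L x\<bar> \<le> M * norm L" for \<tau>
      using abs_apply_le_norm[of "ap (U \<tau>) L" x] UM[of \<tau> L] by linarith
    then have "\<bar>(v (s + r) - v s - r *\<^sub>R 0) x\<bar> \<le> r * (M * norm L)"
      by (intro vinc that) simp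
    then show "norm ((v (s + r) - v s) x) \<le> r * (M * norm L)" by simp
  qed
  have "\<bar>(LINT x|lborel. u x t * \<psi> x) - ap (cps (tail \<epsilon>) t) \<psi>b x0\<bar> \<le> t * (M * (K / 2 * small_moment \<epsilon>))"
    if t: "0 < t" and \<epsilon>: "0 < \<epsilon>" for t \<epsilon>
  proof -
    note J = jump_tail[OF \<epsilon>]
    let ?G = "gen_op (tail \<epsilon>)" and ?d = "K / 2 * small_moment \<epsilon>"
    have comm: "U \<tau> * ?G = ?G * U \<tau>" for \<tau>
      using jump_densityD(1)[OF J]
      by (intro conv_gen_commute J) (auto simp: U_def conv_op_commute M0(1) conv_op_shift_commute)
    have step: "norm (v (s + r) - v s - r *\<^sub>R ap ?G (v s)) \<le> r * (M * ?d) + (norm ?G * (M * norm L)) * r\<^sup>2"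
      if s: "0 \<le> s" "0 \<le> r" for s r
    proof (rule norm_bound)
      fix x
      have "\<bar>ap (U \<tau>) L x - ap ?G (v s) x\<bar> \<le> M * ?d + norm ?G * (r * (M * norm L))" if \<tau>: "s < \<tau>" "\<tau> < s + r" for \<tau>
      proof -
        have "ap ?G (v \<tau>) = ap (U \<tau>) (ap ?G \<psi>b)" unfolding v_def by (simp only: ap_mult[symmetric] comm)
        then have "norm (ap (U \<tau>) L - ap ?G (v \<tau>)) = norm (ap (U \<tau>) (L - ap ?G \<psi>b))" by (simp add: ap.diff_right)
        also have "\<dots> \<le> M * norm (L - ap ?G \<psi>b)" by (rule UM)
        also have "\<dots> \<le> M * ?d" using L[OF \<epsilon>] M by (intro mult_left_mono) (auto simp: norm_minus_commute)
        finally have 1: "norm (ap (U \<tau>) L - ap ?G (v \<tau>)) \<le> M * ?d" .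
        have "norm (ap ?G (v \<tau>) - ap ?G (v s)) = norm (ap ?G (v \<tau> - v s))" by (simp add: ap.diff_right)
        also have "\<dots> \<le> norm ?G * norm (v \<tau> - v s)" by (rule norm_ap)
        also have "\<dots> \<le> norm ?G * (r * (M * norm L))"
        proof (rule mult_left_mono)
          have "norm (v (s + (\<tau> - s)) - v s) \<le> (\<tau> - s) * (M * norm L)" using \<tau> s by (intro lip) auto
          also have "\<dots> \<le> r * (M * norm L)" using \<tau> M by (intro mult_right_mono) auto
          finally show "norm (v \<tau> - v s) \<le> r * (M * norm L)" by simp
        qed simp
        finally have 2: "norm (ap ?G (v \<tau>) - ap ?G (v s)) \<le> norm ?G * (r * (M * norm L))" .
        have "\<bar>ap (U \<tau>) L x - ap ?G (v s) x\<bar> \<le> norm (ap (U \<tau>) L - ap ?G (v s))"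
          using abs_apply_le_norm[of "ap (U \<tau>) L - ap ?G (v s)" x] by (simp add: minus_bcontfun.rep_eq)
        also have "\<dots> \<le> norm (ap (U \<tau>) L - ap ?G (v \<tau>)) + norm (ap ?G (v \<tau>) - ap ?G (v s))"
          using norm_triangle_ineq[of "ap (U \<tau>) L - ap ?G (v \<tau>)" "ap ?G (v \<tau>) - ap ?G (v s)"] by simp
        finally show ?thesis using 1 2 by linarith
      qed
      from vinc[OF s this] show "norm ((v (s + r) - v s - r *\<^sub>R ap ?G (v s)) x) \<le> r * (M * ?d) + (norm ?G * (M * norm L)) * r\<^sup>2"
        by (simp add: power2_eq_square algebra_simps)
    qed
    have "norm (v t - ap (cps (tail \<epsilon>) t) (v 0)) \<le> t * (M * ?d)"
      by (rule cps_duhamel[OF J _ _ _ _ step, of _ "M * norm \<psi>b"])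
         (use t M K(2) small_moment_nonneg[of \<epsilon>] UM in \<open>auto simp: v_def\<close>)
    then have "\<bar>(v t - ap (cps (tail \<epsilon>) t) (v 0)) 0\<bar> \<le> t * (M * ?d)"
      by (rule order_trans[OF abs_apply_le_norm])
    moreover have "v t 0 = (LINT x|lborel. u x t * \<psi> x)" using t by (simp add: v_def U_apply \<psi>b)
    moreover have "ap (cps (tail \<epsilon>) t) (v 0) 0 = ap (cps (tail \<epsilon>) t) \<psi>b x0"
      unfolding v_def U_def by (simp add: ap_shift_zero[OF cps_shift_commute[OF J], where \<phi> = \<psi>b and x = x0])
    ultimately show ?thesis by (simp add: minus_bcontfun.rep_eq)
  qed
  then show ?thesis using that[OF M(1)] by blast
qed

end

section \<open>A regular bump in an annulus\<close>

lemma pos_part_square_taylor: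
  fixes u v :: real
  shows "\<bar>(max 0 v)\<^sup>2 - (max 0 u)\<^sup>2 - 2 * max 0 u * (v - u)\<bar> \<le> (v - u)\<^sup>2"
proof (cases "0 \<le> u")
  case True
  show ?thesis
  proof (cases "0 \<le> v")
    case True
    have "v\<^sup>2 - u\<^sup>2 - 2 * u * (v - u) = (v - u)\<^sup>2" by (simp add: power2_eq_square algebra_simps)
    then show ?thesis using \<open>0 \<le> u\<close> True by simp
  next
    case False
    then have "0 \<le> u * (- v)" using True by (intro mult_nonneg_nonneg) auto
    moreover have "(max 0 v)\<^sup>2 - (max 0 u)\<^sup>2 - 2 * max 0 u * (v - u) = u\<^sup>2 + 2 * (u * (- v))"
      using True False by (simp add: max_def power2_eq_square algebra_simps)
    moreover have "(v - u)\<^sup>2 = v\<^sup>2 + 2 * (u * (- v)) + u\<^sup>2" by (simp add: power2_eq_square algebra_simps)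
    moreover have "0 \<le> u\<^sup>2" "0 \<le> v\<^sup>2" by simp_all
    ultimately show ?thesis by linarith
  qed
next
  case False
  show ?thesis
  proof (cases "0 \<le> v")
    case True
    have "v\<^sup>2 \<le> (v - u)\<^sup>2" using False True by (intro power_mono) auto
    then show ?thesis using False True by simp
  next
    case v: False
    then show ?thesis using False by simp
  qed
qed

text \<open>A bump supported in the ball of radius \<open>1/2\<close>. Being the square of the positive part of a polynomial, it
  has bounded second differences.\<close>
definition ball_bump :: "'a::euclidean_space \<Rightarrow> real" where
  "ball_bump y = (max 0 (1 - 4 * (norm y)\<^sup>2))\<^sup>2"

lemma ball_bump_range: "0 \<le> ball_bump y" "ball_bump y \<le> 1"
proof -
  have "max 0 (1 - 4 * (norm y)\<^sup>2) \<le> 1" by simp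
  then show "ball_bump y \<le> 1" unfolding ball_bump_def by (intro power_le_one) auto
qed (simp add: ball_bump_def)

lemma ball_bump_support: "ball_bump y \<noteq> 0 \<Longrightarrow> norm y < 1 / 2"
proof (rule ccontr)
  assume "ball_bump y \<noteq> 0" "\<not> norm y < 1 / 2"
  then have "(1 / 2)\<^sup>2 \<le> (norm y)\<^sup>2" by (intro power_mono) auto
  then show False using \<open>ball_bump y \<noteq> 0\<close> by (simp add: ball_bump_def power2_eq_square)
qed

lemma ball_bump_second_diff: "\<bar>ball_bump (x + z) + ball_bump (x - z) - 2 * ball_bump x\<bar> \<le> 816 * (norm z)\<^sup>2"
proof (cases "norm z \<le> 1")
  case True
  show ?thesis
  proof (cases "norm x \<le> 2")
    case x: True
    let ?p = "\<lambda>y :: 'a. 1 - 4 * (norm y)\<^sup>2"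
    have e1: "?p (x + z) - ?p x = - 8 * (x \<bullet> z) - 4 * (norm z)\<^sup>2"
      and e2: "?p (x - z) - ?p x = 8 * (x \<bullet> z) - 4 * (norm z)\<^sup>2"
      by (simp_all add: power2_norm_eq_inner inner_add_left inner_add_right inner_diff_left inner_diff_right inner_commute)
    have xz: "\<bar>x \<bullet> z\<bar> \<le> 2 * norm z"
      using Cauchy_Schwarz_ineq2[of x z] mult_right_mono[OF x norm_ge_zero[of z]] by linarith
    have zz: "(norm z)\<^sup>2 \<le> norm z" using True by (simp add: power2_eq_square mult_left_le_one_le)
    have b: "\<bar>?p (x + z) - ?p x\<bar> \<le> 20 * norm z" "\<bar>?p (x - z) - ?p x\<bar> \<le> 20 * norm z"
      unfolding e1 e2 using xz zz zero_le_power2[of "norm z"] by linarith+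
    have quad: "d\<^sup>2 \<le> 400 * (norm z)\<^sup>2" if "\<bar>d\<bar> \<le> 20 * norm z" for d
      using power_mono[OF that, of 2] by (simp add: power_mult_distrib)
    let ?u = "max 0 (?p x)"
    have u: "0 \<le> ?u" "?u \<le> 1" by auto
    have e: "ball_bump (x + z) + ball_bump (x - z) - 2 * ball_bump x
       = ((max 0 (?p (x + z)))\<^sup>2 - ?u\<^sup>2 - 2 * ?u * (?p (x + z) - ?p x)) + ((max 0 (?p (x - z)))\<^sup>2 - ?u\<^sup>2 - 2 * ?u * (?p (x - z) - ?p x))
         + 2 * ?u * (- 8 * (norm z)\<^sup>2)"
      unfolding ball_bump_def e1 e2 by (simp add: algebra_simps)
    have d: "\<bar>2 * ?u * (- 8 * (norm z)\<^sup>2)\<bar> \<le> 16 * (norm z)\<^sup>2"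
      using u mult_right_mono[OF u(2), of "16 * (norm z)\<^sup>2"] by (simp add: abs_mult)
    have "\<bar>S\<bar> \<le> 816 * m" if "S = A + B + D" "\<bar>A\<bar> \<le> p" "p \<le> 400 * m" "\<bar>B\<bar> \<le> q" "q \<le> 400 * m" "\<bar>D\<bar> \<le> 16 * m"
      for S A B D p q m :: real using that by linarith
    from this[OF e pos_part_square_taylor quad[OF b(1)] pos_part_square_taylor quad[OF b(2)] d] show ?thesis .
  next
    case False
    have "norm x - norm z \<le> norm (x + z)" "norm x - norm z \<le> norm (x - z)"
      using norm_triangle_ineq2[of x "- z"] norm_triangle_ineq2[of x z] by auto
    then have "ball_bump (x + z) = 0" "ball_bump (x - z) = 0" "ball_bump x = 0"
      using False True ball_bump_support[of "x + z"] ball_bump_support[of "x - z"] ball_bump_support[of x] by force+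
    then show ?thesis by simp
  qed
next
  case False
  then have "1 \<le> (norm z)\<^sup>2" by simp
  then show ?thesis
    using ball_bump_range[of "x + z"] ball_bump_range[of "x - z"] ball_bump_range[of x] by (simp add: abs_le_iff)
qed

text \<open>The sum of two translates, which is symmetric and supported in the annulus between radii 1 and 2.\<close>
definition axis_point :: "'a::euclidean_space" where "axis_point = (3 / 2) *\<^sub>R (SOME b. b \<in> Basis)"

definition annulus_bump :: "'a::euclidean_space \<Rightarrow> real" where
  "annulus_bump z = ball_bump (z - axis_point) + ball_bump (z + axis_point)"

lemma norm_axis_point: "norm (axis_point :: 'a::euclidean_space) = 3 / 2"
proof -
  have "(SOME b. b \<in> Basis) \<in> (Basis :: 'a set)" by (rule someI_ex) (use nonempty_Basis in blast)
  then show ?thesis by (simp add: axis_point_def)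
qed

lemma annulus_bump_range: "0 \<le> annulus_bump z" "annulus_bump z \<le> 2"
  using ball_bump_range[of "z - axis_point"] ball_bump_range[of "z + axis_point"] by (auto simp: annulus_bump_def)

lemma annulus_bump_sym: "annulus_bump (- z) = annulus_bump z"
proof -
  have "- z - axis_point = - (z + axis_point)" "- z + axis_point = - (z - axis_point)" by simp_all
  then have "ball_bump (- z - axis_point) = ball_bump (z + axis_point)" "ball_bump (- z + axis_point) = ball_bump (z - axis_point)"
    by (simp_all only: ball_bump_def norm_minus_cancel)
  then show ?thesis by (simp add: annulus_bump_def)
qed

lemma annulus_bump_support:
  assumes "annulus_bump z \<noteq> 0"
  shows "1 < norm z" "norm z < 2"
proof -
  have "norm (z - axis_point) < 1 / 2 \<or> norm (z - (- axis_point)) < 1 / 2"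
    using assms ball_bump_support[of "z - axis_point"] ball_bump_support[of "z + axis_point"]
    by (cases "ball_bump (z - axis_point) = 0") (auto simp: annulus_bump_def)
  then have "\<exists>a :: 'a. norm a = 3 / 2 \<and> norm (z - a) < 1 / 2"
  proof
    assume "norm (z - axis_point) < 1 / 2"
    then show ?thesis using norm_axis_point by blast
  next
    assume "norm (z - (- axis_point)) < 1 / 2"
    moreover have "norm (- axis_point :: 'a) = 3 / 2" by (simp add: norm_axis_point)
    ultimately show ?thesis by blast
  qed
  then obtain a :: 'a where "norm a = 3 / 2" "norm (z - a) < 1 / 2" by blast
  then show "1 < norm z" "norm z < 2"
    using norm_triangle_ineq2[of z a] norm_triangle_ineq2[of a z] by (auto simp: norm_minus_commute)
qed

lemma annulus_bump_second_diff: "\<bar>annulus_bump (x + z) + annulus_bump (x - z) - 2 * annulus_bump x\<bar> \<le> 1632 * (norm z)\<^sup>2"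
  using ball_bump_second_diff[of "x - axis_point" z] ball_bump_second_diff[of "x + axis_point" z]
  by (simp add: annulus_bump_def algebra_simps)

lemma continuous_annulus_bump: "continuous_on UNIV annulus_bump"
  unfolding annulus_bump_def[abs_def] ball_bump_def by (intro continuous_intros)

lemma annulus_bump_measurable [measurable]: "annulus_bump \<in> borel_measurable borel"
  by (rule borel_measurable_continuous_onI[OF continuous_annulus_bump])

lemma integrable_annulus_bump: "integrable lborel (annulus_bump :: 'a::euclidean_space \<Rightarrow> real)"
proof (rule integrableI_bounded_set[of "ball 0 2" _ _ 2])
  show "emeasure lborel (ball (0 :: 'a) 2) < \<infinity>" by (rule emeasure_bounded_finite) simp
  show "AE z \<in> ball (0 :: 'a) 2 in lborel. norm (annulus_bump z :: real) \<le> 2"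
  proof (rule AE_I2, rule impI)
    fix z :: 'a show "norm (annulus_bump z) \<le> 2" using annulus_bump_range[of z] by simp
  qed
  show "AE z in lborel. z \<notin> ball (0 :: 'a) 2 \<longrightarrow> annulus_bump z = (0::real)"
    using annulus_bump_support(2) by (intro AE_I2) auto
qed auto

lemma integral_annulus_bump_pos: "0 < (LINT z|(lborel :: 'a::euclidean_space measure). annulus_bump z)"
proof -
  let ?B = "ball (axis_point :: 'a) (1 / 4)"
  have fin: "emeasure lborel ?B < \<infinity>" by (rule emeasure_bounded_finite) simp
  have "0 < 9 / 16 * measure lborel ?B" by (simp add: content_ball_pos)
  also have "\<dots> = (LINT z|lborel. 9 / 16 * indicator ?B z)" by simp
  also have "\<dots> \<le> (LINT z|(lborel :: 'a measure). annulus_bump z)"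
  proof (rule integral_mono)
    show "integrable lborel (annulus_bump :: 'a \<Rightarrow> real)" by (rule integrable_annulus_bump)
    show "integrable lborel (\<lambda>z. 9 / 16 * indicator ?B z :: real)"
      using fin by (intro integrable_mult_right) (simp add: integrable_indicator_iff)
    fix z :: 'a
    show "9 / 16 * indicator ?B z \<le> annulus_bump z"
    proof (cases "z \<in> ?B")
      case True
      then have "norm (z - axis_point) \<le> 1 / 4" by (simp add: dist_norm norm_minus_commute)
      then have "(norm (z - axis_point))\<^sup>2 \<le> (1 / 4)\<^sup>2" by (intro power_mono) auto
      then have "3 / 4 \<le> max 0 (1 - 4 * (norm (z - axis_point))\<^sup>2)" by (simp add: power2_eq_square)
      then have "(3 / 4)\<^sup>2 \<le> ball_bump (z - axis_point)" unfolding ball_bump_def by (rule power_mono) simp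
      then show ?thesis using True ball_bump_range(1)[of "z + axis_point"] by (simp add: annulus_bump_def power2_eq_square)
    qed (use annulus_bump_range(1) in simp)
  qed
  finally show ?thesis .
qed

text \<open>The mass of the bump with the numerical factors of its rescaling in \<open>regular_jumps\<close> below.\<close>
definition annulus_mass :: "'a::euclidean_space itself \<Rightarrow> real" where
  "annulus_mass _ = (LINT z|(lborel :: 'a measure). annulus_bump z) / (2 * 2 ^ DIM('a))"

lemma annulus_mass_pos: "0 < annulus_mass TYPE('a::euclidean_space)"
  using integral_annulus_bump_pos[where 'a = 'a] by (simp add: annulus_mass_def)

section \<open>A doubly exponential sum\<close>

lemma exp_minus_le_power:
  fixes y :: real
  assumes "0 < y"
  shows "exp (- y) \<le> fact j / y ^ j"
proof -
  have "y ^ j / fact j = (\<Sum>n\<in>{j}. y ^ n / fact n)" by simp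
  also have "\<dots> \<le> (\<Sum>n. y ^ n / fact n)"
    by (rule sum_le_suminf) (use assms summable_exp_generic[of y] in \<open>auto simp: divide_inverse mult.commute\<close>)
  also have "\<dots> = exp y" using exp_converges[of y] by (simp add: sums_iff divide_inverse mult.commute)
  finally have "inverse (exp y) \<le> inverse (y ^ j / fact j)" using assms by (intro le_imp_inverse_le) auto
  then show ?thesis by (simp add: exp_minus)
qed

lemma summable_doubly_exponential:
  fixes B q w :: real
  assumes "0 < B" "1 < q" "0 < w"
  shows "summable (\<lambda>n. B ^ n * exp (- (w * q ^ n)))"
proof -
  obtain j where j: "B < q ^ j" using real_arch_pow[OF assms(2)] by blast
  have pos: "0 < q ^ j" using assms by simp
  show ?thesis
  proof (rule summable_comparison_test'[where N = 0])
    show "summable (\<lambda>n. fact j / w ^ j * (B / q ^ j) ^ n)"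
      by (intro summable_mult summable_geometric) (use assms j pos in simp)
    fix n
    have "exp (- (w * q ^ n)) \<le> fact j / (w * q ^ n) ^ j" using assms by (intro exp_minus_le_power) simp
    then have "B ^ n * exp (- (w * q ^ n)) \<le> B ^ n * (fact j / (w * q ^ n) ^ j)"
      using assms by (intro mult_left_mono) auto
    also have "\<dots> = fact j / w ^ j * (B / q ^ j) ^ n"
      by (simp add: power_mult_distrib power_divide power_mult[symmetric] mult.commute)
    finally show "norm (B ^ n * exp (- (w * q ^ n))) \<le> fact j / w ^ j * (B / q ^ j) ^ n"
      using assms by simp
  qed
qed

section \<open>The dyadic scales\<close>

context stable_like
begin

text \<open>The \<open>n\<close>-th scale covers the jumps with sizes between \<open>radius r (Suc n)\<close> and \<open>radius r n\<close>; the regular jumps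
  are a rescaled bump with values at most \<open>c * radius r n powr (- (N + \<alpha>))\<close>, which is a lower bound of \<open>f\<close> on this
  annulus. Their mass grows by the factor \<open>mass_ratio\<close> from one scale to the next.\<close>
definition radius :: "real \<Rightarrow> nat \<Rightarrow> real" where "radius r n = r / 2 ^ n"

definition annulus_jumps :: "real \<Rightarrow> nat \<Rightarrow> 'a \<Rightarrow> real" where "annulus_jumps r n = ring (radius r (Suc n)) (radius r n)"

definition regular_jumps :: "real \<Rightarrow> nat \<Rightarrow> 'a \<Rightarrow> real" where
  "regular_jumps r n z = c / 2 * radius r n powr (- (real DIM('a) + \<alpha>)) * annulus_bump (inverse (radius r (Suc n)) *\<^sub>R z)"

definition regular_bcont :: "real \<Rightarrow> nat \<Rightarrow> 'a \<Rightarrow>\<^sub>C real" where "regular_bcont r n = Bcontfun (regular_jumps r n)"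

definition mass_ratio :: real where "mass_ratio = 2 powr \<alpha>"

lemma radius_pos: "0 < r \<Longrightarrow> 0 < radius r n" by (simp add: radius_def)
lemma radius_le: "0 < r \<Longrightarrow> radius r n \<le> r"
  using divide_left_mono[of 1 "2 ^ n" r] by (simp add: radius_def)
lemma radius_double: "2 * radius r (Suc n) = radius r n" by (simp add: radius_def)
lemma mass_ratio_gt1: "1 < mass_ratio" using \<alpha> by (simp add: mass_ratio_def)

lemma radius_powr: "0 < r \<Longrightarrow> radius r n powr (- \<alpha>) = r powr (- \<alpha>) * mass_ratio ^ n"
  by (simp add: radius_def mass_ratio_def powr_divide powr_minus powr_powr powr_realpow[symmetric] field_simps)

lemma regular_jumps_range: "0 \<le> regular_jumps r n z" "regular_jumps r n z \<le> c * radius r n powr (- (real DIM('a) + \<alpha>))"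
proof -
  have "0 \<le> c / 2 * radius r n powr (- (real DIM('a) + \<alpha>))" using cC by simp
  then show "0 \<le> regular_jumps r n z" "regular_jumps r n z \<le> c * radius r n powr (- (real DIM('a) + \<alpha>))"
    using annulus_bump_range[of "inverse (radius r (Suc n)) *\<^sub>R z"] mult_left_mono[of "annulus_bump (inverse (radius r (Suc n)) *\<^sub>R z)" 2 "c / 2 * radius r n powr (- (real DIM('a) + \<alpha>))"]
    by (auto simp: regular_jumps_def)
qed

lemma regular_jumps_support:
  assumes r: "0 < r" and z: "regular_jumps r n z \<noteq> 0"
  shows "radius r (Suc n) < norm z" "norm z < radius r n"
proof -
  have "annulus_bump (inverse (radius r (Suc n)) *\<^sub>R z) \<noteq> 0" using z by (auto simp: regular_jumps_def)
  from annulus_bump_support[OF this] show "radius r (Suc n) < norm z" "norm z < radius r n"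
    using radius_pos[OF r, of "Suc n"] unfolding radius_double[of r n, symmetric] by (auto simp: field_simps)
qed

lemma regular_jumps_le_annulus_jumps:
  assumes r: "0 < r"
  shows "regular_jumps r n z \<le> annulus_jumps r n z"
proof (cases "regular_jumps r n z = 0")
  case True then show ?thesis by (simp add: annulus_jumps_def ring_def indicator_def f_nonneg)
next
  case False
  note S = regular_jumps_support[OF r False]
  have "regular_jumps r n z \<le> c * radius r n powr (- (real DIM('a) + \<alpha>))" by (rule regular_jumps_range)
  also have "\<dots> \<le> c * norm z powr (- (real DIM('a) + \<alpha>))"
  proof -
    have "norm z \<le> radius r n" "0 < norm z" using S radius_pos[OF r, of "Suc n"] by auto
    then show ?thesis using cC \<alpha> by (intro mult_left_mono powr_mono2') auto
  qed
  also have "\<dots> \<le> f z" using f_lower[of z] unfolding powr_minus divide_inverse .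
  also have "f z = annulus_jumps r n z" using S by (simp add: annulus_jumps_def ring_def)
  finally show ?thesis .
qed

lemma regular_bcont_apply:
  assumes r: "0 < r"
  shows "apply_bcontfun (regular_bcont r n) = regular_jumps r n"
proof -
  have "continuous_on UNIV (regular_jumps r n)"
    unfolding regular_jumps_def[abs_def]
    by (intro continuous_intros continuous_on_compose2[OF continuous_annulus_bump]) auto
  moreover have "norm (regular_jumps r n z) \<le> c * radius r n powr (- (real DIM('a) + \<alpha>))" for z
    using regular_jumps_range[of r n z] by simp
  ultimately have "regular_jumps r n \<in> bcontfun" by (rule bcontfun_normI)
  then show ?thesis by (simp add: regular_bcont_def Bcontfun_inverse)
qed

lemma regular_jumps_integral:
  assumes r: "0 < r"
  shows "integrable lborel (regular_jumps r n)" "(LINT z|lborel. regular_jumps r n z) = c * annulus_mass TYPE('a) * r powr (- \<alpha>) * mass_ratio ^ n"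
proof -
  let ?s = "radius r (Suc n)"
  have s: "0 < ?s" by (rule radius_pos[OF r])
  have m: "(\<lambda>z :: 'a. annulus_bump (inverse ?s *\<^sub>R z)) \<in> borel_measurable borel" by measurable
  have i: "integrable lborel (\<lambda>z :: 'a. annulus_bump (inverse ?s *\<^sub>R z))"
    using has_bochner_integral_lborel_affine(1)[OF m, of ?s 0] s integrable_annulus_bump[where 'a = 'a] by simp
  then show "integrable lborel (regular_jumps r n)" unfolding regular_jumps_def[abs_def] by simp
  have e: "(LINT z|lborel. annulus_bump (inverse ?s *\<^sub>R z :: 'a)) = radius r n ^ DIM('a) * (2 * annulus_mass TYPE('a))"
    using has_bochner_integral_lborel_affine(2)[OF m, of ?s 0] s
    by (simp add: annulus_mass_def radius_double[symmetric, of r n] power_mult_distrib)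
  have "(LINT z|lborel. regular_jumps r n z) = c / 2 * radius r n powr (- (real DIM('a) + \<alpha>)) * (radius r n ^ DIM('a) * (2 * annulus_mass TYPE('a)))"
    unfolding regular_jumps_def using e by simp
  also have "\<dots> = c * annulus_mass TYPE('a) * radius r n powr (- \<alpha>)"
  proof -
    have "radius r n powr (- (real DIM('a) + \<alpha>)) * radius r n ^ DIM('a) = radius r n powr (- \<alpha>)"
      using radius_pos[OF r, of n] by (simp add: powr_realpow[symmetric] powr_add[symmetric])
    then show ?thesis by (simp add: mult.assoc[symmetric])
  qed
  finally show "(LINT z|lborel. regular_jumps r n z) = c * annulus_mass TYPE('a) * r powr (- \<alpha>) * mass_ratio ^ n"
    by (simp add: radius_powr[OF r] mult.assoc)
qed

lemma jump_regular_jumps: "0 < r \<Longrightarrow> jump_density (regular_jumps r n)"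
  using regular_jumps_integral regular_jumps_range(1)[of r n] unfolding jump_density_def
  by (auto simp: regular_jumps_def annulus_bump_sym)

lemma jump_annulus_jumps: "0 < r \<Longrightarrow> jump_density (annulus_jumps r n)"
  unfolding annulus_jumps_def by (rule jump_ring[OF radius_pos])

lemma scheme:
  assumes "0 < r" "jump_density h"
  shows "scale_scheme h (annulus_jumps r) (regular_jumps r) (regular_bcont r)"
proof
  show "0 < (LINT z|lborel. regular_jumps r n z)" for n
    using assms cC annulus_mass_pos[where 'a = 'a] mass_ratio_gt1 by (simp add: regular_jumps_integral)
qed (use assms in \<open>auto intro: jump_annulus_jumps jump_regular_jumps regular_jumps_le_annulus_jumps regular_bcont_apply\<close>)

lemma ring_sum:
  assumes "0 < r" "r \<le> \<rho>"
  shows "(\<lambda>z. ring r \<rho> z + (\<Sum>k<n. annulus_jumps r k z)) = ring (radius r n) \<rho>"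
proof (induction n)
  case 0 show ?case by (simp add: radius_def)
next
  case (Suc n)
  have "radius r (Suc n) \<le> radius r n" using radius_double[of r n] radius_pos[OF assms(1), of "Suc n"] by linarith
  moreover have "radius r n \<le> \<rho>"
    using radius_le[OF assms(1), of n] assms(2) by linarith
  ultimately have "ring (radius r n) \<rho> z + annulus_jumps r n z = ring (radius r (Suc n)) \<rho> z" for z
    unfolding annulus_jumps_def ring_def by (auto simp: indicator_def)
  then show ?case using fun_cong[OF Suc] by (simp add: fun_eq_iff add.assoc[symmetric])
qed

lemma tail_sum:
  assumes "0 < r"
  shows "(\<lambda>z. tail r z + (\<Sum>k<n. annulus_jumps r k z)) = tail (radius r n)"
proof (induction n)
  case 0 show ?case by (simp add: radius_def)
next
  case (Suc n)
  have "radius r (Suc n) \<le> radius r n" using radius_double[of r n] radius_pos[OF assms(1), of "Suc n"] by linarith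
  then have "tail (radius r n) z + annulus_jumps r n z = tail (radius r (Suc n)) z" for z
    by (subst tail_split[of "radius r (Suc n)" "radius r n"]) (auto simp: annulus_jumps_def)
  then show ?case using fun_cong[OF Suc] by (simp add: fun_eq_iff add.assoc[symmetric])
qed

lemma radius_tendsto: "0 < r \<Longrightarrow> filterlim (radius r) (at_right 0) sequentially"
proof -
  assume r: "0 < r"
  have "(\<lambda>n. r * (1 / 2) ^ n) \<longlonglongrightarrow> r * 0" by (intro tendsto_intros LIMSEQ_power_zero) auto
  then have "radius r \<longlonglongrightarrow> 0" by (simp add: radius_def[abs_def] power_divide)
  moreover have "radius r n \<in> {0<..} \<and> radius r n \<noteq> 0" for n using radius_pos[OF r, of n] by simp
  ultimately show ?thesis unfolding filterlim_at by (simp add: always_eventually)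
qed

text \<open>The factor \<open>exp w\<close> accounts for the scale \<open>n = 0\<close>, where the probability is 1.\<close>
lemma Am_bound:
  fixes h :: "'a \<Rightarrow> real"
  assumes r: "0 < r" and h: "jump_density h" and t: "0 \<le> t"
  defines "w \<equiv> t * (c * annulus_mass TYPE('a) * r powr (- \<alpha>)) / mass_ratio"
  shows "scale_scheme.Am (regular_jumps r) t n \<le> exp w * exp (- (w * mass_ratio ^ n))"
proof -
  interpret scale_scheme h "annulus_jumps r" "regular_jumps r" "regular_bcont r" by (rule scheme[OF r h])
  have w: "0 \<le> w" using t cC annulus_mass_pos[where 'a = 'a] mass_ratio_gt1 by (simp add: w_def)
  show ?thesis
  proof (cases n)
    case 0 then show ?thesis by (simp add: Am_def mult_exp_exp)
  next
    case (Suc k)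
    have "mass k \<le> (\<Sum>k<n. mass k)"
      by (rule member_le_sum) (use Suc \<nu>_mass less_imp_le in auto)
    then have "t * mass k \<le> t * (\<Sum>k<n. mass k)" using t by (rule mult_left_mono)
    moreover have "t * mass k = w * mass_ratio ^ n" using mass_ratio_gt1 by (simp add: regular_jumps_integral[OF r] w_def Suc)
    ultimately have "Am t n \<le> exp (- (w * mass_ratio ^ n))" by (simp add: Am_def)
    also have "\<dots> \<le> exp w * exp (- (w * mass_ratio ^ n))" using w by simp
    finally show ?thesis .
  qed
qed

lemma summable_Am:
  fixes h :: "'a \<Rightarrow> real"
  assumes r: "0 < r" and h: "jump_density h" and t: "0 < t" and B: "0 < B"
  shows "summable (\<lambda>n. scale_scheme.Am (regular_jumps r) t n * B ^ n)"
proof -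
  interpret scale_scheme h "annulus_jumps r" "regular_jumps r" "regular_bcont r" by (rule scheme[OF r h])
  let ?w = "t * (c * annulus_mass TYPE('a) * r powr (- \<alpha>)) / mass_ratio"
  have w: "0 < ?w" using t cC annulus_mass_pos[where 'a = 'a] r mass_ratio_gt1 by simp
  show ?thesis
  proof (rule summable_comparison_test'[where N = 0])
    show "summable (\<lambda>n. exp ?w * (B ^ n * exp (- (?w * mass_ratio ^ n))))"
      by (intro summable_mult summable_doubly_exponential B mass_ratio_gt1 w)
    fix n
    show "norm (Am t n * B ^ n) \<le> exp ?w * (B ^ n * exp (- (?w * mass_ratio ^ n)))"
      using mult_right_mono[OF Am_bound[OF r h less_imp_le[OF t], of n], of "B ^ n"] B Am_pos[of t n] by (simp add: ac_simps)
  qed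
qed

lemma radius_powr_general:
  assumes "0 < r"
  shows "radius r n powr (- a) = r powr (- a) * (2 powr a) ^ n"
  using assms by (simp add: radius_def powr_divide powr_minus powr_realpow[symmetric] powr_powr field_simps)

end

section \<open>Upper bounds\<close>

lemma exp_symmetric_bound: "exp y + exp (- y) - 2 \<le> y\<^sup>2 * exp \<bar>y\<bar>" for y :: real
proof -
  have *: "exp y + exp (- y) - 2 \<le> y\<^sup>2 * exp y" if "0 \<le> y" for y :: real
  proof -
    have "exp y * (1 - y) \<le> exp y * exp (- y)" using exp_ge_add_one_self[of "- y"] by (intro mult_left_mono) auto
    then have "exp y - 1 \<le> y * exp y" by (simp add: mult_exp_exp algebra_simps)
    moreover have "0 \<le> exp y - 1" using that by simp
    ultimately have "(exp y - 1)\<^sup>2 \<le> (y * exp y)\<^sup>2" by (intro power_mono)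
    then have "exp (- y) * (exp y - 1)\<^sup>2 \<le> exp (- y) * (y * exp y)\<^sup>2" by (intro mult_left_mono) auto
    moreover have "exp (- y) * (exp y - 1)\<^sup>2 = exp y + exp (- y) - 2"
    proof -
      have "b * (a - 1)\<^sup>2 = (b * a) * a - 2 * (b * a) + b" for a b :: real
        by (simp add: power2_eq_square algebra_simps)
      from this[of "exp (- y)" "exp y"] show ?thesis by (simp add: mult_exp_exp)
    qed
    moreover have "exp (- y) * (y * exp y)\<^sup>2 = y\<^sup>2 * exp y"
    proof -
      have "exp (- y) * (y * exp y)\<^sup>2 = y\<^sup>2 * (exp (- y) * exp y * exp y)" by (simp add: power2_eq_square)
      then show ?thesis by (simp add: mult_exp_exp)
    qed
    ultimately show ?thesis by simp
  qed
  show ?thesis using *[of y] *[of "- y"] by (cases "0 \<le> y") (auto simp: add.commute)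
qed

context stable_like
begin

lemma ring_exp_integrable:
  assumes a: "0 < a"
  shows "integrable lborel (\<lambda>z. exp (- (l \<bullet> z)) * ring a b z)"
proof (rule Bochner_Integration.integrable_bound)
  show "integrable lborel (\<lambda>z. exp (norm l * b) * ring a b z)"
    using jump_densityD(1)[OF jump_ring[OF a]] by simp
  show "AE z in lborel. norm (exp (- (l \<bullet> z)) * ring a b z) \<le> norm (exp (norm l * b) * ring a b z)"
  proof (rule AE_I2)
    fix z :: 'a
    show "norm (exp (- (l \<bullet> z)) * ring a b z) \<le> norm (exp (norm l * b) * ring a b z)"
    proof (cases "norm z \<le> b")
      case True
      have "- (l \<bullet> z) \<le> norm l * b"
        using Cauchy_Schwarz_ineq2[of l z] mult_left_mono[OF True norm_ge_zero[of l]] by linarith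
      then show ?thesis by (auto simp: abs_mult intro!: mult_right_mono)
    qed (simp add: ring_def)
  qed
qed (simp add: ring_def[abs_def])

text \<open>By symmetry only the even part of the exponential matters, which is quadratic near zero.\<close>
lemma ring_exp_bound:
  assumes a: "0 < a"
  shows "(LINT z|lborel. (exp (- (l \<bullet> z)) - 1) * ring a b z) \<le> (norm l)\<^sup>2 / 2 * exp (norm l * b) * small_moment b"
proof -
  note D = jump_densityD[OF jump_ring[OF a, of b]]
  note [measurable] = D(1)
  let ?f = "\<lambda>z. (exp (- (l \<bullet> z)) - 1) * ring a b z"
  have i: "integrable lborel ?f" using ring_exp_integrable[OF a] D(1) by (simp add: left_diff_distrib)
  have i2: "integrable lborel (\<lambda>z. ?f (- z))" and e2: "(LINT z|lborel. ?f (- z)) = (LINT z|lborel. ?f z)"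
    using integral_lborel_reflect[of ?f] i by auto
  have "2 * (LINT z|lborel. ?f z) = (LINT z|lborel. ?f z + ?f (- z))" using i i2 e2 by simp
  also have "\<dots> \<le> (LINT z|lborel. ((norm l)\<^sup>2 * exp (norm l * b)) * ((norm z)\<^sup>2 * ring a b z))"
  proof (rule integral_mono)
    fix z :: 'a
    have "?f z + ?f (- z) = (exp (l \<bullet> z) + exp (- (l \<bullet> z)) - 2) * ring a b z"
      by (simp add: D(3) algebra_simps)
    also have "\<dots> \<le> ((norm l)\<^sup>2 * exp (norm l * b) * (norm z)\<^sup>2) * ring a b z"
    proof (cases "norm z \<le> b")
      case True
      have "\<bar>l \<bullet> z\<bar> \<le> norm l * norm z" by (rule Cauchy_Schwarz_ineq2)
      moreover have "\<dots> \<le> norm l * b" using True by (intro mult_left_mono) auto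
      ultimately have "exp (l \<bullet> z) + exp (- (l \<bullet> z)) - 2 \<le> (norm l * norm z)\<^sup>2 * exp (norm l * b)"
        using exp_symmetric_bound[of "l \<bullet> z"] power_mono[of "\<bar>l \<bullet> z\<bar>" "norm l * norm z" 2]
          mult_mono[of "(l \<bullet> z)\<^sup>2" "(norm l * norm z)\<^sup>2" "exp \<bar>l \<bullet> z\<bar>" "exp (norm l * b)"] by simp
      then show ?thesis using D(2) by (intro mult_right_mono) (auto simp: power_mult_distrib ac_simps)
    qed (simp add: ring_def)
    finally show "?f z + ?f (- z) \<le> ((norm l)\<^sup>2 * exp (norm l * b)) * ((norm z)\<^sup>2 * ring a b z)"
      by (simp add: mult.assoc)
  qed (use i i2 ring_small_moment(1) in auto)
  also have "\<dots> \<le> ((norm l)\<^sup>2 * exp (norm l * b)) * small_moment b"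
    by (simp add: ring_small_moment mult_left_mono)
  finally show ?thesis by simp
qed

text \<open>By scaling it suffices to know the second moment for one radius, where the lower bound of \<open>f\<close> controls it.\<close>
lemma small_moment_scaling:
  obtains I where "0 \<le> I" "\<And>\<rho>. 0 < \<rho> \<Longrightarrow> small_moment \<rho> \<le> I * \<rho> powr (2 - \<alpha>)"
proof -
  define k where "k z = (norm z)\<^sup>2 * (1 / norm z powr (real DIM('a) + \<alpha>))" for z :: 'a
  have [measurable]: "k \<in> borel_measurable borel" unfolding k_def[abs_def] by measurable
  have kpos: "0 \<le> k z" for z by (simp add: k_def)
  have fk: "c * k z \<le> (norm z)\<^sup>2 * f z" "(norm z)\<^sup>2 * f z \<le> C * k z" for z
    using mult_left_mono[OF f_lower[of z], of "(norm z)\<^sup>2"] mult_left_mono[OF f_upper[of z], of "(norm z)\<^sup>2"] by (auto simp: k_def ac_simps)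
  have ik: "integrable lborel (\<lambda>z. indicator {z. norm z \<le> 1} z * k z)"
  proof (rule Bochner_Integration.integrable_bound)
    show "integrable lborel (\<lambda>z. inverse c * (indicator {z. norm z \<le> 1} z * ((norm z)\<^sup>2 * f z)))" using int_small by simp
    show "AE z in lborel. norm (indicator {z. norm z \<le> 1} z * k z) \<le> norm (inverse c * (indicator {z. norm z \<le> 1} z * ((norm z)\<^sup>2 * f z)))"
    proof (rule AE_I2)
      fix z :: 'a
      have "k z \<le> inverse c * ((norm z)\<^sup>2 * f z)" using fk(1)[of z] cC by (simp add: field_simps)
      then show "norm (indicator {z. norm z \<le> 1} z * k z) \<le> norm (inverse c * (indicator {z. norm z \<le> 1} z * ((norm z)\<^sup>2 * f z)))"
        using kpos[of z] cC f_nonneg[of z] by (auto simp: indicator_def abs_mult)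
    qed
  qed simp
  define I1 where "I1 = (LINT z|lborel. indicator {z. norm z \<le> 1} z * k z)"
  have I1: "0 \<le> I1" unfolding I1_def using kpos by (auto intro!: integral_nonneg_AE)
  have "small_moment \<rho> \<le> (C * I1) * \<rho> powr (2 - \<alpha>)" if \<rho>: "0 < \<rho>" for \<rho>
  proof -
    let ?g = "\<lambda>z. indicator {z. norm z \<le> \<rho>} z * k z"
    have gm: "?g \<in> borel_measurable borel" by measurable
    have sc: "?g (0 + \<rho> *\<^sub>R z) = \<rho> powr (2 - \<alpha> - real DIM('a)) * (indicator {z. norm z \<le> 1} z * k z)" for z
    proof -
      have "k (\<rho> *\<^sub>R z) = \<rho> powr (2 - \<alpha> - real DIM('a)) * k z"
      proof -
        have "\<rho>\<^sup>2 = \<rho> powr 2" using \<rho> by (simp add: powr_numeral)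
        then have "\<rho>\<^sup>2 / \<rho> powr (real DIM('a) + \<alpha>) = \<rho> powr (2 - \<alpha> - real DIM('a))"
        proof -
          have "\<rho> powr 2 / \<rho> powr (real DIM('a) + \<alpha>) = \<rho> powr (2 - (real DIM('a) + \<alpha>))" by (simp only: powr_diff)
          moreover have "2 - (real DIM('a) + \<alpha>) = 2 - \<alpha> - real DIM('a)" by simp
          ultimately show ?thesis using \<open>\<rho>\<^sup>2 = \<rho> powr 2\<close> by (simp only:)
        qed
        then show ?thesis using \<rho> by (simp add: k_def powr_mult power_mult_distrib field_simps)
      qed
      moreover have "norm (\<rho> *\<^sub>R z) \<le> \<rho> \<longleftrightarrow> norm z \<le> 1" using \<rho> by simp
      ultimately show ?thesis by (simp add: indicator_def)
    qed
    have gi: "integrable lborel ?g"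
      using has_bochner_integral_lborel_affine(1)[OF gm, of \<rho> 0] ik \<rho> unfolding sc by simp
    have "small_moment \<rho> \<le> (LINT z|lborel. C * ?g z)"
      unfolding small_moment_def by (rule integral_mono[OF int_small_moment]) (use gi fk(2) in \<open>auto simp: indicator_def\<close>)
    also have "\<dots> = C * (\<rho> ^ DIM('a) * (\<rho> powr (2 - \<alpha> - real DIM('a)) * I1))"
      using has_bochner_integral_lborel_affine(2)[OF gm, of \<rho> 0] \<rho> unfolding sc I1_def by simp
    also have "\<dots> = (C * I1) * (\<rho> ^ DIM('a) * \<rho> powr (2 - \<alpha> - real DIM('a)))" by simp
    also have "\<rho> ^ DIM('a) * \<rho> powr (2 - \<alpha> - real DIM('a)) = \<rho> powr (2 - \<alpha>)"
      using \<rho> by (simp add: powr_realpow[symmetric] powr_add[symmetric])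
    finally show ?thesis .
  qed
  then show ?thesis using that[of "C * I1"] I1 cC by simp
qed

lemma tail_upper: "0 < \<rho> \<Longrightarrow> tail \<rho> z \<le> C * \<rho> powr (- (real DIM('a) + \<alpha>))"
proof (cases "\<rho> < norm z")
  case True
  assume \<rho>: "0 < \<rho>"
  have "f z \<le> C * norm z powr (- (real DIM('a) + \<alpha>))" using f_upper[of z] unfolding powr_minus divide_inverse .
  also have "\<dots> \<le> C * \<rho> powr (- (real DIM('a) + \<alpha>))"
    using True \<rho> cC \<alpha> by (intro mult_left_mono powr_mono2') auto
  finally show ?thesis using True by (simp add: tail_def)
qed (use cC in \<open>simp add: tail_def\<close>)

text \<open>At the scale \<open>r = t powr (1 / \<alpha>)\<close> the masses of the regular jumps, multiplied by \<open>t\<close>, do not depend on \<open>t\<close>, so that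
  the constant \<open>S\<close> is uniform.\<close>
lemma regular_density_bound:
  obtains S where "0 < S" "\<And>t \<rho> l n y. 0 < t \<Longrightarrow> t powr (1 / \<alpha>) \<le> \<rho> \<Longrightarrow> norm l * t powr (1 / \<alpha>) \<le> 2 \<Longrightarrow>
    apply_bcontfun (scale_scheme.Qs (ring (t powr (1 / \<alpha>)) \<rho>) (annulus_jumps (t powr (1 / \<alpha>))) (regular_jumps (t powr (1 / \<alpha>))) (regular_bcont (t powr (1 / \<alpha>))) t n) y
      \<le> exp (t * ((norm l)\<^sup>2 / 2 * exp (norm l * \<rho>) * small_moment \<rho>)) * (S * t powr (- (real DIM('a) / \<alpha>))) * exp (- (l \<bullet> y))"
proof -
  let ?am = "annulus_mass TYPE('a)"
  define w where "w = c * ?am / mass_ratio"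
  have am: "0 < ?am" by (rule annulus_mass_pos)
  have w: "0 < w" using am cC mass_ratio_gt1 by (simp add: w_def)
  let ?X = "\<lambda>n. (2 ^ DIM('a)) ^ n * exp (- (w * mass_ratio ^ n))"
  have sX: "summable ?X" by (rule summable_doubly_exponential[OF _ mass_ratio_gt1 w]) simp
  have Xpos: "0 < ?X n" for n by simp
  define S where "S = exp 2 / ?am * (exp w * suminf ?X)"
  have S: "0 < S" using am suminf_pos[OF sX Xpos] by (simp add: S_def)
  have main: "apply_bcontfun (scale_scheme.Qs (ring (t powr (1 / \<alpha>)) \<rho>) (annulus_jumps (t powr (1 / \<alpha>))) (regular_jumps (t powr (1 / \<alpha>))) (regular_bcont (t powr (1 / \<alpha>))) t n) y
      \<le> exp (t * ((norm l)\<^sup>2 / 2 * exp (norm l * \<rho>) * small_moment \<rho>)) * (S * t powr (- (real DIM('a) / \<alpha>))) * exp (- (l \<bullet> y))"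
    if t: "0 < t" and \<rho>: "t powr (1 / \<alpha>) \<le> \<rho>" and l: "norm l * t powr (1 / \<alpha>) \<le> 2" for t \<rho> l n y
  proof -
    define r where "r = t powr (1 / \<alpha>)"
    have r: "0 < r" using t by (simp add: r_def)
    have r\<alpha>: "r powr (- \<alpha>) = 1 / t" using t \<alpha> by (simp add: r_def powr_powr powr_minus divide_inverse)
    note jr = jump_ring[OF r, of \<rho>]
    interpret scale_scheme "ring r \<rho>" "annulus_jumps r" "regular_jumps r" "regular_bcont r" by (rule scheme[OF r jr])
    let ?V = "\<lambda>n. exp 2 * (c * radius r n powr (- (real DIM('a) + \<alpha>)))"
    let ?J = "\<lambda>k. LINT z|lborel. (exp (- (l \<bullet> z)) - 1) * k z"
    have V: "regular_jumps r n z \<le> ?V n * exp (- (l \<bullet> z))" for n z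
    proof (cases "regular_jumps r n z = 0")
      case False
      have "norm z \<le> r" using regular_jumps_support(2)[OF r False] radius_le[OF r, of n] by linarith
      then have "norm l * norm z \<le> norm l * r" by (intro mult_left_mono) auto
      then have "l \<bullet> z \<le> 2" using norm_cauchy_schwarz[of l z] l by (simp add: r_def)
      then have "1 \<le> exp 2 * exp (- (l \<bullet> z))" by (simp add: mult_exp_exp)
      then have "1 * (c * radius r n powr (- (real DIM('a) + \<alpha>))) \<le> (exp 2 * exp (- (l \<bullet> z))) * (c * radius r n powr (- (real DIM('a) + \<alpha>)))"
        using cC by (intro mult_right_mono) auto
      then show ?thesis using regular_jumps_range(2)[of r n z] by (simp add: ac_simps)
    qed (use cC in simp)
    have eg: "integrable lborel (\<lambda>z. exp (- (l \<bullet> z)) * annulus_jumps r n z)" for n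
      unfolding annulus_jumps_def by (rule ring_exp_integrable[OF radius_pos[OF r]])
    have eh: "integrable lborel (\<lambda>z. exp (- (l \<bullet> z)) * ring r \<rho> z)" by (rule ring_exp_integrable[OF r])
    have Jsum: "?J (ring r \<rho>) + (\<Sum>k<n. ?J (annulus_jumps r k)) = ?J (ring (radius r n) \<rho>)"
    proof -
      have 1: "integrable lborel (\<lambda>z. (exp (- (l \<bullet> z)) - 1) * annulus_jumps r k z)" for k
        using eg[of k] jump_densityD(1)[OF jump_annulus_jumps[OF r, of k]] by (simp add: left_diff_distrib)
      have 2: "integrable lborel (\<lambda>z. (exp (- (l \<bullet> z)) - 1) * ring r \<rho> z)"
        using eh jump_densityD(1)[OF jr] by (simp add: left_diff_distrib)
      have "?J (ring r \<rho>) + (\<Sum>k<n. ?J (annulus_jumps r k)) = (LINT z|lborel. (exp (- (l \<bullet> z)) - 1) * ring r \<rho> z + (\<Sum>k<n. (exp (- (l \<bullet> z)) - 1) * annulus_jumps r k z))"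
        by (subst Bochner_Integration.integral_add[OF 2]) (use 1 in \<open>auto simp: Bochner_Integration.integral_sum\<close>)
      also have "\<dots> = ?J (\<lambda>z. ring r \<rho> z + (\<Sum>k<n. annulus_jumps r k z))" by (simp add: distrib_left sum_distrib_left)
      also have "\<dots> = ?J (ring (radius r n) \<rho>)"
      proof -
        have "ring r \<rho> z + (\<Sum>k<n. annulus_jumps r k z) = ring (radius r n) \<rho> z" for z
          using fun_cong[OF ring_sum[OF r, of \<rho> n]] \<rho> by (simp add: r_def)
        then show ?thesis by (simp only:)
      qed
      finally show ?thesis .
    qed
    have Jle: "?J (ring (radius r n) \<rho>) \<le> (norm l)\<^sup>2 / 2 * exp (norm l * \<rho>) * small_moment \<rho>"
      by (rule ring_exp_bound[OF radius_pos[OF r]])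
    have ratio: "?V k / mass k = exp 2 / ?am * r powr (- real DIM('a)) * (2 ^ DIM('a)) ^ k" for k
    proof -
      have "radius r k powr (- (real DIM('a) + \<alpha>)) = radius r k powr (- real DIM('a)) * radius r k powr (- \<alpha>)"
        using radius_pos[OF r, of k] by (simp add: powr_add[symmetric])
      also have "\<dots> = r powr (- real DIM('a)) * (2 ^ DIM('a)) ^ k * (r powr (- \<alpha>) * mass_ratio ^ k)"
        by (simp add: radius_powr[OF r] radius_powr_general[OF r, of k "real DIM('a)"] powr_realpow)
      finally have e: "radius r k powr (- (real DIM('a) + \<alpha>)) = r powr (- real DIM('a)) * (2 ^ DIM('a)) ^ k * (r powr (- \<alpha>) * mass_ratio ^ k)" .
      have "a / (c * ?am * p * q) * (exp 2 * (c * (b * (p * q)))) = a * exp 2 / ?am * b" if "0 < p" "0 < q" for a b p q :: real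
        using that cC am by simp
      from this[of "r powr (- \<alpha>)" "mass_ratio ^ k" 1] show ?thesis
        using r mass_ratio_gt1 cC unfolding e regular_jumps_integral(2)[OF r] by (simp add: mult.assoc)
    qed
    have "(\<Sum>k<n. Am t k * ?V k / mass k) \<le> S * r powr (- real DIM('a))"
    proof -
      have "Am t k * ?V k / mass k \<le> exp 2 / ?am * r powr (- real DIM('a)) * (exp w * ?X k)" for k
      proof -
        have "Am t k \<le> exp w * exp (- (w * mass_ratio ^ k))"
          using Am_bound[OF r jr less_imp_le[OF t], of k] t by (simp add: r\<alpha> w_def)
        then have "Am t k * (?V k / mass k) \<le> (exp w * exp (- (w * mass_ratio ^ k))) * (?V k / mass k)"
          by (rule mult_right_mono) (unfold ratio, use am in auto)
        moreover have "Am t k * ?V k / mass k = Am t k * (?V k / mass k)" by (simp only: times_divide_eq_right)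
        moreover have "(exp w * exp (- (w * mass_ratio ^ k))) * (?V k / mass k) = exp 2 / ?am * r powr (- real DIM('a)) * (exp w * ?X k)"
          unfolding ratio by (simp only: ac_simps)
        ultimately show ?thesis by (simp only:)
      qed
      then have "(\<Sum>k<n. Am t k * ?V k / mass k) \<le> (\<Sum>k<n. exp 2 / ?am * r powr (- real DIM('a)) * (exp w * ?X k))"
        by (rule sum_mono)
      also have "\<dots> = exp 2 / ?am * r powr (- real DIM('a)) * (exp w * (\<Sum>k<n. ?X k))" by (simp add: sum_distrib_left)
      also have "\<dots> \<le> exp 2 / ?am * r powr (- real DIM('a)) * (exp w * suminf ?X)"
        using am by (intro mult_left_mono sum_le_suminf sX) auto
      finally show ?thesis by (simp add: S_def ac_simps)
    qed
    moreover have "r powr (- real DIM('a)) = t powr (- (real DIM('a) / \<alpha>))" by (simp add: r_def powr_powr)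
    ultimately have sumle: "(\<Sum>k<n. Am t k * ?V k / mass k) \<le> S * t powr (- (real DIM('a) / \<alpha>))" by simp
    have sumpos: "0 \<le> (\<Sum>k<n. Am t k * ?V k / mass k)"
      using cC by (intro sum_nonneg divide_nonneg_pos mult_nonneg_nonneg \<nu>_mass less_imp_le[OF Am_pos]) auto
    have "Qs t n y \<le> exp (t * ?J (ring (radius r n) \<rho>)) * (\<Sum>k<n. Am t k * ?V k / mass k) * exp (- (l \<bullet> y))"
      using Qs_weighted_bound[OF less_imp_le[OF t] eh eg V, of n y] unfolding Jsum .
    also have "\<dots> \<le> exp (t * ((norm l)\<^sup>2 / 2 * exp (norm l * \<rho>) * small_moment \<rho>)) * (S * t powr (- (real DIM('a) / \<alpha>))) * exp (- (l \<bullet> y))"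
      using t Jle sumle sumpos by (intro mult_right_mono mult_mono) auto
    finally show ?thesis by (simp add: r_def)
  qed
  show ?thesis by (rule that[OF S main])
qed

lemma Am_tendsto:
  fixes h :: "'a \<Rightarrow> real"
  assumes "0 < r" "jump_density h" "0 < t"
  shows "(\<lambda>n. scale_scheme.Am (regular_jumps r) t n) \<longlonglongrightarrow> 0"
  using summable_LIMSEQ_zero[OF summable_Am[OF assms, of 1]] by simp

text \<open>A bound on the regular part of the small jumps gives a bound on every weak solution.\<close>
lemma solution_bound:
  assumes u: "fundamental_solution levy x0 u" and t: "0 < t" and r: "0 < r" "r \<le> \<rho>" and B: "0 \<le> B" and V: "open V"
    and Q: "\<And>n y. x0 + y \<in> V \<Longrightarrow> apply_bcontfun (scale_scheme.Qs (ring r \<rho>) (annulus_jumps r) (regular_jumps r) (regular_bcont r) t n) y \<le> B"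
  shows "AE x in lborel. x \<in> V \<longrightarrow> u x t \<le> B + t * (C * \<rho> powr (- (real DIM('a) + \<alpha>)))"
proof (rule AE_le_of_test_functions[OF _ V])
  show "integrable lborel (\<lambda>x. u x t)" using u t unfolding fundamental_solution_def by blast
next
  fix \<psi> :: "'a \<Rightarrow> real"
  assume \<psi>: "test_function \<psi>" and pos: "\<And>x. 0 \<le> \<psi> x" and supp: "\<And>x. x \<notin> V \<Longrightarrow> \<psi> x = 0"
  have \<rho>: "0 < \<rho>" using r by simp
  note t0 = less_imp_le[OF t]
  note jr = jump_ring[OF r(1), of \<rho>]
  interpret scale_scheme "ring r \<rho>" "annulus_jumps r" "regular_jumps r" "regular_bcont r" by (rule scheme[OF r(1) jr])
  obtain \<psi>b K where \<psi>b: "apply_bcontfun \<psi>b = \<psi>" and K: "0 \<le> K" "second_diff K \<psi>b"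
    by (rule test_function_bcontfun[OF \<psi>], rule that)
  obtain M where M: "0 \<le> M" "\<And>t \<epsilon>. 0 < t \<Longrightarrow> 0 < \<epsilon> \<Longrightarrow>
    \<bar>(LINT x|lborel. u x t * \<psi> x) - ap (cps (tail \<epsilon>) t) \<psi>b x0\<bar> \<le> t * (M * (K / 2 * small_moment \<epsilon>))"
    by (rule fundamental_solution_approx[OF u \<psi> \<psi>b K(2,1)], rule that)
  let ?I = "LINT x|lborel. \<psi> x" and ?W = "C * \<rho> powr (- (real DIM('a) + \<alpha>))"
  have i\<psi>: "integrable lborel (apply_bcontfun \<psi>b)" using test_function_integrable[OF \<psi>] by (simp add: \<psi>b)
  have le: "(LINT x|lborel. u x t * \<psi> x) \<le> (B + t * ?W) * ?I + Am t n * norm \<psi>b + t * (M * (K / 2 * small_moment (radius r n)))" for n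
  proof -
    have rn: "0 < radius r n" "radius r n \<le> \<rho>" using radius_pos[OF r(1)] radius_le[OF r(1), of n] r by (auto intro: order_trans)
    have P: "Ps t n = cps (ring (radius r n) \<rho>) t" by (simp add: Ps_eq ring_sum[OF r])
    have mP: "markov_op (Ps t n)" by (rule markov_Ps[OF t0])
    have "cps (tail (radius r n)) t = Ps t n * cps (tail \<rho>) t"
      unfolding tail_split[OF rn(2)] P by (rule cps_add[OF jump_ring[OF rn(1)] jump_tail[OF \<rho>]])
    also have "\<dots> = cps (tail \<rho>) t * Ps t n" by (rule markov_cps_commute[OF mP jump_tail[OF \<rho>]])
    finally have split: "ap (cps (tail (radius r n)) t) \<psi>b x0 = ap (cps (tail \<rho>) t) (ap (Ps t n) \<psi>b) x0"
      by (simp add: ap_mult)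
    have adP: "adj_op 1 (Ps t n)" using mP by (simp add: markov_op_def)
    note A = adj_opD[OF adP i\<psi>]
    have Ppos: "0 \<le> ap (Ps t n) \<psi>b x" for x by (rule markov_pos[OF mP]) (simp add: \<psi>b pos)
    have IP: "(LINT x|lborel. ap (Ps t n) \<psi>b x) \<le> ?I" using A(2) Ppos pos by (simp add: \<psi>b)
    have "ap (Ps t n) \<psi>b x0 \<le> B * ?I + Am t n * norm \<psi>b"
    proof -
      have tr: "integrable lborel (\<lambda>y. \<psi> (y + x0))" "(LINT y|lborel. \<psi> (y + x0)) = ?I"
        using integral_lborel_translate[OF test_function_measurable[OF \<psi>], of x0] test_function_integrable[OF \<psi>] by auto
      have "(LINT y|lborel. Qs t n y * \<psi> (x0 + y)) \<le> (LINT y|lborel. B * \<psi> (x0 + y))"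
      proof (rule integral_mono)
        have tr': "integrable lborel (\<lambda>y. \<psi> (x0 + y))" using tr(1) by (simp add: add.commute)
        show "integrable lborel (\<lambda>y. Qs t n y * \<psi> (x0 + y))" by (rule integrable_mult_bcontfun'(2)[OF tr'])
        show "integrable lborel (\<lambda>y. B * \<psi> (x0 + y))" using tr' by simp
        fix y
        show "Qs t n y * \<psi> (x0 + y) \<le> B * \<psi> (x0 + y)"
          using Q[of y n] supp[of "x0 + y"] pos by (cases "x0 + y \<in> V") (auto intro: mult_right_mono)
      qed
      also have "\<dots> = B * ?I" using tr(2) by (simp add: add.commute)
      finally have 1: "(LINT y|lborel. Qs t n y * \<psi> (x0 + y)) \<le> B * ?I" .
      have "Am t n * ap (Zs t n) \<psi>b x0 \<le> Am t n * norm \<psi>b"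
        using markov_abs_le[OF markov_Zs[OF t0, of n], of \<psi>b x0] by (intro mult_left_mono less_imp_le[OF Am_pos]) auto
      then show ?thesis using decomp[OF t0 i\<psi>, of n x0] 1 by (simp add: \<psi>b)
    qed
    moreover have "ap (cps (tail \<rho>) t) (ap (Ps t n) \<psi>b) x0 \<le> ap (Ps t n) \<psi>b x0 + t * ?W * (LINT y|lborel. ap (Ps t n) \<psi>b y)"
      by (rule cps_bounded_density[OF jump_tail[OF \<rho>] t0 tail_upper[OF \<rho>] A(1) Ppos])
    moreover have "t * ?W * (LINT y|lborel. ap (Ps t n) \<psi>b y) \<le> t * ?W * ?I"
      using t cC by (intro mult_left_mono IP) auto
    ultimately have "ap (cps (tail (radius r n)) t) \<psi>b x0 \<le> (B + t * ?W) * ?I + Am t n * norm \<psi>b"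
      unfolding split by (simp add: distrib_right)
    then show ?thesis using M(2)[OF t rn(1)] by linarith
  qed
  have "(\<lambda>n. (B + t * ?W) * ?I + Am t n * norm \<psi>b + t * (M * (K / 2 * small_moment (radius r n))))
      \<longlonglongrightarrow> (B + t * ?W) * ?I + 0 * norm \<psi>b + t * (M * (K / 2 * 0))"
    by (intro tendsto_intros Am_tendsto[OF r(1) jr t] filterlim_compose[OF small_moment_tendsto radius_tendsto[OF r(1)]])
  from LIMSEQ_le_const[OF this] show "(LINT x|lborel. u x t * \<psi> x) \<le> (B + t * ?W) * ?I"
    using le by auto
qed

text \<open>The off-diagonal bound comes from tilting with an exponential weight of the logarithmic size
  that balances the cost of the small jumps against the gain in the weight.\<close>
lemma heat_kernel_bounds:
  obtains D where "0 < D"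
    "\<And>x0 u t. fundamental_solution levy x0 u \<Longrightarrow> 0 < t \<Longrightarrow> AE x in lborel. u x t \<le> D * t powr (- (real DIM('a) / \<alpha>))"
    "\<And>x0 u t R. fundamental_solution levy x0 u \<Longrightarrow> 0 < t \<Longrightarrow> 0 < R \<Longrightarrow>
      AE x in lborel. R < norm (x - x0) \<longrightarrow> u x t \<le> D * (t * R powr (- (real DIM('a) + \<alpha>)))"
proof -
  let ?N = "real DIM('a)"
  obtain S where S: "0 < S" "\<And>t \<rho> l n y. 0 < t \<Longrightarrow> t powr (1 / \<alpha>) \<le> \<rho> \<Longrightarrow> norm l * t powr (1 / \<alpha>) \<le> 2 \<Longrightarrow>
    apply_bcontfun (scale_scheme.Qs (ring (t powr (1 / \<alpha>)) \<rho>) (annulus_jumps (t powr (1 / \<alpha>))) (regular_jumps (t powr (1 / \<alpha>))) (regular_bcont (t powr (1 / \<alpha>))) t n) y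
      \<le> exp (t * ((norm l)\<^sup>2 / 2 * exp (norm l * \<rho>) * small_moment \<rho>)) * (S * t powr (- (?N / \<alpha>))) * exp (- (l \<bullet> y))"
    by (rule regular_density_bound, rule that)
  obtain I where I: "0 \<le> I" "\<And>\<rho>. 0 < \<rho> \<Longrightarrow> small_moment \<rho> \<le> I * \<rho> powr (2 - \<alpha>)" by (rule small_moment_scaling, rule that)
  \<comment> \<open>a gain of the power \<open>p\<close> of \<open>t / \<rho> powr \<alpha>\<close> turns the on-diagonal bound into the off-diagonal one;
    \<open>k = R / \<rho>\<close> is chosen so that the weight yields this gain\<close>
  define p where "p = (?N + \<alpha>) / \<alpha>"
  define k where "k = 2 * ?N * p"
  define D1 where "D1 = S + C"
  define D2 where "D2 = exp I * S + C"
  have N: "1 \<le> ?N" using DIM_positive[where 'a = 'a] by (simp add: Suc_le_eq)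
  have pk: "0 < p" "0 < k" using N \<alpha> by (auto simp: p_def k_def)
  have D: "0 < D1" "0 < D2" using S(1) cC by (auto simp: D1_def D2_def intro: add_pos_pos)
  have on: "AE x in lborel. u x t \<le> D1 * t powr (- (?N / \<alpha>))" if u: "fundamental_solution levy x0 u" and t: "0 < t" for x0 u t
  proof -
    let ?r = "t powr (1 / \<alpha>)"
    have "AE x in lborel. x \<in> UNIV \<longrightarrow> u x t \<le> S * t powr (- (?N / \<alpha>)) + t * (C * ?r powr (- (?N + \<alpha>)))"
    proof (rule solution_bound[OF u t])
      fix n y
      show "apply_bcontfun (scale_scheme.Qs (ring ?r ?r) (annulus_jumps ?r) (regular_jumps ?r) (regular_bcont ?r) t n) y \<le> S * t powr (- (?N / \<alpha>))"
        using S(2)[of t ?r 0 n y] t by simp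
    qed (use t S(1) in auto)
    moreover have "t * ?r powr (- (?N + \<alpha>)) = t powr (- (?N / \<alpha>))"
    proof -
      have "t * ?r powr (- (?N + \<alpha>)) = t powr 1 * t powr (- ((?N + \<alpha>) / \<alpha>))"
      proof -
        have "1 / \<alpha> * (- x) = - (x / \<alpha>)" for x :: real by simp
        then show ?thesis using t by (simp only: powr_powr powr_one)
      qed
      also have "\<dots> = t powr (1 - (?N + \<alpha>) / \<alpha>)" unfolding powr_add[symmetric] by simp
      also have "1 - (?N + \<alpha>) / \<alpha> = - (?N / \<alpha>)" using \<alpha> by (simp add: field_simps)
      finally show ?thesis .
    qed
    ultimately show ?thesis by (simp add: D1_def distrib_right mult.left_commute[of t])
  qed
  have off: "AE x in lborel. R < norm (x - x0) \<longrightarrow> u x t \<le> max D1 D2 * (t * (R / k) powr (- (?N + \<alpha>)))"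
    if u: "fundamental_solution levy x0 u" and t: "0 < t" and R: "0 < R" for x0 u t R
  proof -
    define \<rho> where "\<rho> = R / k"
    have \<rho>: "0 < \<rho>" using R pk by (simp add: \<rho>_def)
    show ?thesis
    proof (cases "t \<le> \<rho> powr \<alpha>")
      case False
      have "t powr (- (?N / \<alpha>)) = t * t powr (- p)"
      proof -
        have "t * t powr (- p) = t powr 1 * t powr (- p)" using t by simp
        also have "\<dots> = t powr (1 - p)" unfolding powr_add[symmetric] by simp
        also have "1 - p = - (?N / \<alpha>)" using \<alpha> by (simp add: p_def field_simps)
        finally show ?thesis by simp
      qed
      also have "\<dots> \<le> t * (\<rho> powr \<alpha>) powr (- p)"
        using False t \<rho> pk by (intro mult_left_mono powr_mono2') auto
      also have "(\<rho> powr \<alpha>) powr (- p) = \<rho> powr (- (?N + \<alpha>))" using \<alpha> by (simp add: powr_powr p_def)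
      finally have le: "t powr (- (?N / \<alpha>)) \<le> t * \<rho> powr (- (?N + \<alpha>))" .
      have "D1 * t powr (- (?N / \<alpha>)) \<le> max D1 D2 * (t * \<rho> powr (- (?N + \<alpha>)))"
        by (rule mult_mono[OF _ le]) (use D in auto)
      with on[OF u t] show ?thesis by (auto simp: \<rho>_def elim!: eventually_mono)
    next
      case True
      let ?r = "t powr (1 / \<alpha>)"
      define lg where "lg = ln (\<rho> powr \<alpha> / t)"
      have lg0: "0 \<le> lg" using True t by (simp add: lg_def)
      have t_lg: "t = \<rho> powr \<alpha> * exp (- lg)" using t \<rho> by (simp add: lg_def exp_minus)
      have r_lg: "?r = \<rho> * exp (- (lg / \<alpha>))"
        using \<rho> \<alpha> unfolding t_lg by (simp add: powr_mult powr_powr exp_powr_real)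
      have r\<rho>: "?r \<le> \<rho>" unfolding r_lg using lg0 \<rho> \<alpha> by (simp add: mult_le_cancel_left1)
      have V: "open {x. R < norm (x - x0)}" by (intro open_Collect_less continuous_intros)
      have Bpos: "0 \<le> exp I * S * (t * \<rho> powr (- (?N + \<alpha>)))" using S(1) t by simp
      have "AE x in lborel. x \<in> {x. R < norm (x - x0)} \<longrightarrow> u x t \<le> exp I * S * (t * \<rho> powr (- (?N + \<alpha>))) + t * (C * \<rho> powr (- (?N + \<alpha>)))"
      proof (rule solution_bound[OF u t _ r\<rho> Bpos V])
        show "0 < ?r" using t by simp
        fix n :: nat and y :: 'a assume "x0 + y \<in> {x. R < norm (x - x0)}"
        then have y: "R < norm y" by simp
        have "\<exists>i\<in>Basis. norm y / ?N \<le> \<bar>y \<bullet> i\<bar>"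
        proof (rule ccontr)
          assume "\<not> ?thesis"
          then have "(\<Sum>i\<in>Basis. \<bar>y \<bullet> i\<bar>) < (\<Sum>i\<in>(Basis :: 'a set). norm y / ?N)"
            by (intro sum_strict_mono) (auto simp: not_le)
          then show False using norm_le_l1[of y] by simp
        qed
        then obtain i where i: "i \<in> Basis" "norm y / ?N \<le> \<bar>y \<bullet> i\<bar>" by blast
        \<comment> \<open>the weight acts along a coordinate axis in whose direction \<open>y\<close> is large\<close>
        define l where "l = (lg / (2 * \<rho>) * sgn (y \<bullet> i)) *\<^sub>R i"
        have yi: "y \<bullet> i \<noteq> 0" using i(2) y R N by (auto simp: divide_le_0_iff)
        then have nl: "norm l = lg / (2 * \<rho>)" using lg0 \<rho> i(1) by (simp add: l_def abs_mult abs_sgn_eq)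
        have ly: "lg * p \<le> l \<bullet> y"
        proof -
          have "l \<bullet> y = lg / (2 * \<rho>) * \<bar>y \<bullet> i\<bar>" by (simp add: l_def inner_commute abs_sgn mult.commute)
          moreover have "lg / (2 * \<rho>) * (R / ?N) \<le> lg / (2 * \<rho>) * \<bar>y \<bullet> i\<bar>"
          proof (rule mult_left_mono)
            show "R / ?N \<le> \<bar>y \<bullet> i\<bar>" using i(2) y divide_right_mono[of R "norm y" ?N] N by linarith
          qed (use lg0 \<rho> in simp)
          moreover have "lg / (2 * \<rho>) * (R / ?N) = lg * p"
            using R pk N by (simp add: \<rho>_def k_def field_simps)
          ultimately show ?thesis by simp
        qed
        have lr: "norm l * ?r \<le> 2"
        proof -
          have "norm l * ?r = \<alpha> / 2 * ((lg / \<alpha>) * exp (- (lg / \<alpha>)))" unfolding nl r_lg using \<rho> \<alpha> by simp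
          moreover have "(lg / \<alpha>) * exp (- (lg / \<alpha>)) \<le> 1"
          proof -
            have "x * exp (- x) \<le> 1" for x :: real
            proof -
              have "x \<le> exp x" using exp_ge_add_one_self[of x] by linarith
              then have "x * exp (- x) \<le> exp x * exp (- x)" by (rule mult_right_mono) simp
              then show ?thesis by (simp add: mult_exp_exp)
            qed
            then show ?thesis .
          qed
          moreover have "0 \<le> (lg / \<alpha>) * exp (- (lg / \<alpha>))" using lg0 \<alpha> by simp
          ultimately show ?thesis using \<alpha> mult_mono[of "\<alpha> / 2" 1 "(lg / \<alpha>) * exp (- (lg / \<alpha>))" 1] by simp
        qed
        have tJ: "t * ((norm l)\<^sup>2 / 2 * exp (norm l * \<rho>) * small_moment \<rho>) \<le> I"
        proof -
          have "t * ((norm l)\<^sup>2 / 2 * exp (norm l * \<rho>) * small_moment \<rho>) \<le> t * ((norm l)\<^sup>2 / 2 * exp (norm l * \<rho>) * (I * \<rho> powr (2 - \<alpha>)))"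
            using t by (intro mult_left_mono I(2) \<rho>) auto
          also have "\<rho> powr (2 - \<alpha>) = \<rho>\<^sup>2 / \<rho> powr \<alpha>" using \<rho> by (simp add: powr_diff powr_numeral)
          also have "t * ((norm l)\<^sup>2 / 2 * exp (norm l * \<rho>) * (I * (\<rho>\<^sup>2 / \<rho> powr \<alpha>))) = I * (lg\<^sup>2 / 8 * (exp (- lg) * exp (lg / 2)))"
            unfolding nl t_lg using \<rho> by (simp add: power2_eq_square)
          also have "exp (- lg) * exp (lg / 2) = exp (- (lg / 2))" by (simp add: mult_exp_exp)
          also have "I * (lg\<^sup>2 / 8 * exp (- (lg / 2))) \<le> I * 1"
          proof (intro mult_left_mono I(1))
            show "lg\<^sup>2 / 8 * exp (- (lg / 2)) \<le> 1"
            proof (cases "lg = 0")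
              case False
              then have "exp (- (lg / 2)) \<le> fact 2 / (lg / 2) ^ 2" using lg0 by (intro exp_minus_le_power) auto
              then have "lg\<^sup>2 / 8 * exp (- (lg / 2)) \<le> lg\<^sup>2 / 8 * (fact 2 / (lg / 2) ^ 2)" by (intro mult_left_mono) auto
              also have "\<dots> = 1" using False by (simp add: power2_eq_square)
              finally show ?thesis .
            qed simp
          qed
          finally show ?thesis by simp
        qed
        have gain: "t powr (- (?N / \<alpha>)) * exp (- (lg * p)) = t * \<rho> powr (- (?N + \<alpha>))"
        proof -
          have "exp (- (lg * p)) = (t * \<rho> powr (- \<alpha>)) powr p"
          proof -
            have "t * \<rho> powr (- \<alpha>) = exp (- lg)" unfolding t_lg using \<rho> by (simp add: powr_minus field_simps)
            then show ?thesis by (simp add: exp_powr_real)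
          qed
          also have "\<dots> = t powr p * \<rho> powr (- (?N + \<alpha>))"
            using t \<rho> \<alpha> by (simp add: powr_mult powr_powr p_def)
          finally have "t powr (- (?N / \<alpha>)) * exp (- (lg * p)) = (t powr (- (?N / \<alpha>)) * t powr p) * \<rho> powr (- (?N + \<alpha>))" by simp
          also have "t powr (- (?N / \<alpha>)) * t powr p = t powr 1"
            unfolding powr_add[symmetric] using \<alpha> by (simp add: p_def field_simps)
          finally show ?thesis using t by simp
        qed
        have "apply_bcontfun (scale_scheme.Qs (ring ?r \<rho>) (annulus_jumps ?r) (regular_jumps ?r) (regular_bcont ?r) t n) y
          \<le> exp (t * ((norm l)\<^sup>2 / 2 * exp (norm l * \<rho>) * small_moment \<rho>)) * (S * t powr (- (?N / \<alpha>))) * exp (- (l \<bullet> y))"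
          by (rule S(2)[OF t r\<rho> lr])
        also have "\<dots> \<le> exp I * (S * t powr (- (?N / \<alpha>))) * exp (- (lg * p))"
          using tJ ly S(1) by (intro mult_mono) auto
        also have "\<dots> = exp I * S * (t powr (- (?N / \<alpha>)) * exp (- (lg * p)))" by simp
        finally show "apply_bcontfun (scale_scheme.Qs (ring ?r \<rho>) (annulus_jumps ?r) (regular_jumps ?r) (regular_bcont ?r) t n) y \<le> exp I * S * (t * \<rho> powr (- (?N + \<alpha>)))"
          unfolding gain .
      qed
      moreover have "exp I * S * (t * \<rho> powr (- (?N + \<alpha>))) + t * (C * \<rho> powr (- (?N + \<alpha>))) \<le> max D1 D2 * (t * \<rho> powr (- (?N + \<alpha>)))"
      proof -
        have "D2 * (t * \<rho> powr (- (?N + \<alpha>))) \<le> max D1 D2 * (t * \<rho> powr (- (?N + \<alpha>)))"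
          using t by (intro mult_right_mono) auto
        then show ?thesis by (simp add: D2_def algebra_simps)
      qed
      ultimately show ?thesis by (auto simp: \<rho>_def elim!: eventually_mono)
    qed
  qed
  define D where "D = max D1 D2 * max 1 (k powr (?N + \<alpha>))"
  have Dge: "D1 \<le> D" "max D1 D2 * k powr (?N + \<alpha>) \<le> D"
  proof -
    have "max D1 D2 * 1 \<le> D" unfolding D_def using D by (intro mult_left_mono) auto
    then show "D1 \<le> D" by simp
    show "max D1 D2 * k powr (?N + \<alpha>) \<le> D" unfolding D_def using D by (intro mult_left_mono) auto
  qed
  show ?thesis
  proof (rule that)
    show "0 < D" using Dge(1) D(1) by simp
    show "AE x in lborel. u x t \<le> D * t powr (- (?N / \<alpha>))" if "fundamental_solution levy x0 u" "0 < t" for x0 u t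
    proof -
      have "D1 * t powr (- (?N / \<alpha>)) \<le> D * t powr (- (?N / \<alpha>))" using Dge(1) by (rule mult_right_mono) simp
      with on[OF that] show ?thesis by (auto elim!: eventually_mono)
    qed
    show "AE x in lborel. R < norm (x - x0) \<longrightarrow> u x t \<le> D * (t * R powr (- (?N + \<alpha>)))"
      if "fundamental_solution levy x0 u" "0 < t" "0 < R" for x0 u t R
    proof -
      have "(R / k) powr (- (?N + \<alpha>)) = k powr (?N + \<alpha>) * R powr (- (?N + \<alpha>))"
        using that(3) pk by (simp only: powr_minus powr_divide) (simp add: field_simps)
      then have "max D1 D2 * (t * (R / k) powr (- (?N + \<alpha>))) = (max D1 D2 * k powr (?N + \<alpha>)) * (t * R powr (- (?N + \<alpha>)))" by simp
      also have "\<dots> \<le> D * (t * R powr (- (?N + \<alpha>)))" using Dge(2) that(2) by (intro mult_right_mono) auto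
      finally show ?thesis using off[OF that] by (auto elim!: eventually_mono)
    qed
  qed
qed

end

section \<open>Existence of the heat kernel\<close>

lemma cps_integral_equation:
  fixes \<phi> :: "'a::euclidean_space \<Rightarrow>\<^sub>C real"
  assumes t: "0 \<le> t"
  shows "ap (cps g t) \<phi> x = \<phi> x + (LINT s:{0<..<t}|lborel. ap (cps g s) (ap (gen_op g) \<phi>) x)"
proof -
  let ?f = "\<lambda>s. ap (cps g s) (ap (gen_op g) \<phi>) x"
  have d: "((\<lambda>s. ap (cps g s) \<phi> x) has_vector_derivative ?f s) (at s within {0..t})" for s
    by (rule bounded_linear.has_vector_derivative[OF apply_bounded_linear cps_deriv])
  have c: "continuous_on {0..t} ?f"
    by (rule continuous_on_vector_derivative, rule bounded_linear.has_vector_derivative[OF apply_bounded_linear cps_deriv])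
  have "(LINT s|lborel. indicator {0..t} s *\<^sub>R ?f s) = ap (cps g t) \<phi> x - ap (cps g 0) \<phi> x"
    by (rule integral_FTC_atLeastAtMost[OF t d c])
  moreover have "(LINT s:{0<..<t}|lborel. ?f s) = (LINT s|lborel. indicator {0..t} s *\<^sub>R ?f s)"
    unfolding set_lebesgue_integral_def
  proof (rule integral_cong_AE)
    show "AE s in lborel. indicator {0<..<t} s *\<^sub>R ?f s = indicator {0..t} s *\<^sub>R ?f s"
      using AE_lborel_singleton[of 0] AE_lborel_singleton[of t] by eventually_elim (auto simp: indicator_def)
    have "(\<lambda>s. indicator {0..t} s *\<^sub>R ?f s) \<in> borel_measurable borel"
      by (rule borel_measurable_continuous_on_indicator[OF _ c]) simp
    then show "(\<lambda>s. indicator {0..t} s *\<^sub>R ?f s) \<in> borel_measurable lborel" by simp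
    have "(\<lambda>s. indicator {0<..<t} s *\<^sub>R ?f s) \<in> borel_measurable borel"
      by (rule borel_measurable_continuous_on_indicator) (auto intro: continuous_on_subset[OF c])
    then show "(\<lambda>s. indicator {0<..<t} s *\<^sub>R ?f s) \<in> borel_measurable lborel" by simp
  qed
  ultimately show ?thesis by simp
qed

lemma continuous_on_ap_cps: "continuous_on T (\<lambda>s. ap (cps g s) \<phi> x)"
  by (rule continuous_on_vector_derivative, rule bounded_linear.has_vector_derivative[OF apply_bounded_linear cps_deriv])

lemma tendsto_apply_moving:
  fixes F :: "nat \<Rightarrow> ('a::euclidean_space \<Rightarrow>\<^sub>C real)"
  assumes F: "F \<longlonglongrightarrow> G" and y: "y \<longlonglongrightarrow> z"
  shows "(\<lambda>n. F n (y n)) \<longlonglongrightarrow> G z"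
proof -
  have "(\<lambda>n. (F n - G) (y n)) \<longlonglongrightarrow> 0"
  proof (rule Lim_null_comparison)
    show "\<forall>\<^sub>F n in sequentially. norm ((F n - G) (y n)) \<le> norm (F n - G)"
      unfolding real_norm_def by (intro always_eventually allI abs_apply_le_norm)
    show "(\<lambda>n. norm (F n - G)) \<longlonglongrightarrow> 0" using F by (simp add: LIM_zero tendsto_norm_zero)
  qed
  moreover have "(\<lambda>n. G (y n)) \<longlonglongrightarrow> G z"
    using y by (auto intro!: continuous_on_tendsto_compose[of UNIV "apply_bcontfun G"])
  ultimately have "(\<lambda>n. (F n - G) (y n) + G (y n)) \<longlonglongrightarrow> 0 + G z" by (rule tendsto_add)
  then show ?thesis by (simp add: minus_bcontfun.rep_eq)
qed

text \<open>Integrable continuous functions increasing to 1.\<close>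
lemma cutoff_functions:
  obtains \<phi> :: "nat \<Rightarrow> ('a::euclidean_space \<Rightarrow>\<^sub>C real)" where
    "\<And>k. integrable lborel (apply_bcontfun (\<phi> k))" "\<And>k x. 0 \<le> \<phi> k x" "\<And>k x. \<phi> k x \<le> 1"
    "\<And>j k x. j \<le> k \<Longrightarrow> \<phi> j x \<le> \<phi> k x" "\<And>x. (\<lambda>k. \<phi> k x) \<longlonglongrightarrow> 1"
proof -
  define p where "p k x = max 0 (min 1 (real k - norm x))" for k and x :: 'a
  have c: "continuous_on UNIV (p k)" for k unfolding p_def by (intro continuous_intros)
  have "p k \<in> bcontfun" for k by (rule bcontfun_normI[OF c, of _ 1]) (simp add: p_def)
  then have b: "apply_bcontfun (Bcontfun (p k)) = p k" for k by (rule Bcontfun_inverse)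
  have i: "integrable lborel (p k)" for k
  proof (rule integrableI_bounded_set[of "cball 0 (real k)" _ _ 1])
    show "emeasure lborel (cball (0 :: 'a) (real k)) < \<infinity>" by (rule emeasure_bounded_finite) simp
    show "p k \<in> borel_measurable lborel" using borel_measurable_continuous_onI[OF c] by simp
  qed (auto simp: p_def intro!: AE_I2)
  have l: "(\<lambda>k. p k x) \<longlonglongrightarrow> 1" for x
  proof (rule tendsto_eventually)
    obtain m where m: "norm x + 1 < real m" using reals_Archimedean2 by blast
    have "p k x = 1" if "m \<le> k" for k
    proof -
      have "real m \<le> real k" using that by simp
      then have "1 \<le> real k - norm x" using m by linarith
      then show ?thesis by (simp add: p_def)
    qed
    then show "\<forall>\<^sub>F k in sequentially. p k x = 1" by (rule eventually_sequentiallyI)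
  qed
  show ?thesis
    by (rule that[of "\<lambda>k. Bcontfun (p k)"]; unfold b) (use i l in \<open>auto simp: p_def\<close>)
qed

context stable_like
begin

lemma regular_bcont_second_diff:
  assumes r: "0 < r"
  shows "second_diff (816 * c * radius r n powr (- (real DIM('a) + \<alpha>)) * (inverse (radius r (Suc n)))\<^sup>2) (regular_bcont r n)"
  unfolding second_diff_def regular_bcont_apply[OF r]
proof (intro allI)
  fix x z :: 'a
  let ?i = "inverse (radius r (Suc n))" and ?k = "c / 2 * radius r n powr (- (real DIM('a) + \<alpha>))"
  let ?b = "annulus_bump :: 'a \<Rightarrow> real"
  have k: "0 \<le> ?k" using cC by simp
  have "\<bar>regular_jumps r n (x + z) + regular_jumps r n (x - z) - 2 * regular_jumps r n x\<bar>
     = \<bar>?k * (?b (?i *\<^sub>R x + ?i *\<^sub>R z) + ?b (?i *\<^sub>R x - ?i *\<^sub>R z) - 2 * ?b (?i *\<^sub>R x))\<bar>"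
    by (simp only: regular_jumps_def scaleR_add_right scaleR_diff_right ring_distribs mult.left_commute[of 2])
  also have "\<dots> = ?k * \<bar>?b (?i *\<^sub>R x + ?i *\<^sub>R z) + ?b (?i *\<^sub>R x - ?i *\<^sub>R z) - 2 * ?b (?i *\<^sub>R x)\<bar>"
    by (subst abs_mult, subst abs_of_nonneg[OF k], rule refl)
  also have "\<dots> \<le> ?k * (1632 * (norm (?i *\<^sub>R z))\<^sup>2)"
    by (rule mult_left_mono[OF annulus_bump_second_diff k])
  also have "\<dots> = 816 * c * radius r n powr (- (real DIM('a) + \<alpha>)) * ?i\<^sup>2 * (norm z)\<^sup>2"
  proof -
    have "c / 2 * p * (1632 * (i * m)\<^sup>2) = 816 * c * p * i\<^sup>2 * m\<^sup>2" for p i m :: real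
      by (simp add: power_mult_distrib)
    moreover have "norm (?i *\<^sub>R z) = ?i * norm z" using radius_pos[OF r, of "Suc n"] by simp
    ultimately show ?thesis by (simp only:)
  qed
  finally show "\<bar>regular_jumps r n (x + z) + regular_jumps r n (x - z) - 2 * regular_jumps r n x\<bar>
     \<le> 816 * c * radius r n powr (- (real DIM('a) + \<alpha>)) * ?i\<^sup>2 * (norm z)\<^sup>2" .
qed

lemma jump_tail1: "jump_density (tail 1)" by (rule jump_tail) simp

interpretation ex: scale_scheme "tail 1" "annulus_jumps 1" "regular_jumps 1" "regular_bcont 1"
  by (rule scheme[OF _ jump_tail1]) simp

text \<open>The density of the full process with pole at the origin.\<close>
definition limit_density :: "real \<Rightarrow> 'a \<Rightarrow>\<^sub>C real" where "limit_density t = lim (ex.Qs t)"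

lemma Ps_tail: "ex.Ps t n = cps (tail (radius 1 n)) t"
  using tail_sum[of 1 n] by (simp add: ex.Ps_eq)

lemma Qs_tendsto:
  assumes t: "0 < t"
  shows "ex.Qs t \<longlonglongrightarrow> limit_density t"
proof -
  let ?p = "2 powr (real DIM('a) + \<alpha>)"
  have rp: "radius 1 n powr (- (real DIM('a) + \<alpha>)) = ?p ^ n" for n
    using radius_powr_general[of 1 n "real DIM('a) + \<alpha>"] by simp
  have ri: "(inverse (radius 1 (Suc n)))\<^sup>2 = 4 * 4 ^ n" for n
    by (simp add: radius_def power2_eq_square power_mult_distrib[symmetric])
  have "convergent (ex.Qs t)"
  proof (rule ex.Qs_convergent[OF less_imp_le[OF t] regular_bcont_second_diff])
    show "norm (regular_bcont 1 n) \<le> c * radius 1 n powr (- (real DIM('a) + \<alpha>))" for n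
      by (rule norm_bound) (use regular_jumps_range[of 1 n] in \<open>simp add: regular_bcont_apply\<close>)
    show "integrable lborel (\<lambda>z. (norm z)\<^sup>2 * annulus_jumps 1 n z)" for n
      unfolding annulus_jumps_def by (rule ring_small_moment(1))
    show "summable (\<lambda>n. ex.Am t n * (816 * c * radius 1 n powr (- (real DIM('a) + \<alpha>)) * (inverse (radius 1 (Suc n)))\<^sup>2))"
    proof -
      have "summable (\<lambda>n. (816 * c * 4) * (ex.Am t n * (?p * 4) ^ n))"
        by (intro summable_mult summable_Am[OF _ jump_tail1 t]) auto
      then show ?thesis unfolding rp ri by (simp add: power_mult_distrib ac_simps)
    qed
    show "summable (\<lambda>n. ex.Am t n * (c * radius 1 n powr (- (real DIM('a) + \<alpha>))))"
    proof -
      have "summable (\<lambda>n. c * (ex.Am t n * ?p ^ n))"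
        by (intro summable_mult summable_Am[OF _ jump_tail1 t]) auto
      then show ?thesis unfolding rp by (simp add: ac_simps)
    qed
    show "summable (\<lambda>n. LINT z|lborel. (norm z)\<^sup>2 * annulus_jumps 1 n z)"
    proof (rule summableI_nonneg_bounded)
      show "0 \<le> (LINT z|lborel. (norm z)\<^sup>2 * annulus_jumps 1 n z)" for n
        using jump_densityD(2)[OF jump_annulus_jumps[of 1 n]] by (auto intro!: integral_nonneg_AE)
      fix n
      have "(\<Sum>k<n. LINT z|lborel. (norm z)\<^sup>2 * annulus_jumps 1 k z) = (LINT z|lborel. (\<Sum>k<n. (norm z)\<^sup>2 * annulus_jumps 1 k z))"
        by (rule Bochner_Integration.integral_sum[symmetric]) (unfold annulus_jumps_def, rule ring_small_moment(1))
      also have "\<dots> = (LINT z|lborel. (norm z)\<^sup>2 * ring (radius 1 n) 1 z)"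
      proof -
        have "(\<Sum>k<n. annulus_jumps 1 k z) = ring (radius 1 n) 1 z" for z
          using fun_cong[OF ring_sum[of 1 1 n], of z] by (simp add: ring_def)
        then show ?thesis by (simp flip: sum_distrib_left)
      qed
      also have "\<dots> \<le> small_moment 1" by (rule ring_small_moment(2))
      finally show "(\<Sum>k<n. LINT z|lborel. (norm z)\<^sup>2 * annulus_jumps 1 k z) \<le> small_moment 1" .
    qed
  qed (use cC in auto)
  then show ?thesis unfolding limit_density_def by (simp add: convergent_LIMSEQ_iff)
qed

lemma limit_density_limit:
  fixes \<phi> :: "'a \<Rightarrow>\<^sub>C real"
  assumes t: "0 < t" and \<phi>: "integrable lborel (apply_bcontfun \<phi>)"
  shows "(\<lambda>n. ap (ex.Ps t n) \<phi> x) \<longlonglongrightarrow> (LINT y|lborel. limit_density t y * \<phi> (x + y))"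
proof -
  have i: "integrable lborel (\<lambda>y. \<phi> (x + y))"
    using \<phi> integral_lborel_translate(1)[of "apply_bcontfun \<phi>" x] by (simp add: add.commute)
  note i2 = integrable_mult_bcontfun'(2)[OF i]
  let ?I = "LINT y|lborel. \<bar>\<phi> (x + y)\<bar>"
  have "(\<lambda>n. (LINT y|lborel. ex.Qs t n y * \<phi> (x + y)) - (LINT y|lborel. limit_density t y * \<phi> (x + y))) \<longlonglongrightarrow> 0"
  proof (rule Lim_null_comparison, rule always_eventually, rule allI)
    fix n
    have eq: "(LINT y|lborel. ex.Qs t n y * \<phi> (x + y)) - (LINT y|lborel. limit_density t y * \<phi> (x + y))
        = (LINT y|lborel. (ex.Qs t n - limit_density t) y * \<phi> (x + y))"
      unfolding Bochner_Integration.integral_diff[OF i2 i2, symmetric] by (simp add: minus_bcontfun.rep_eq left_diff_distrib)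
    have "norm (LINT y|lborel. (ex.Qs t n - limit_density t) y * \<phi> (x + y)) \<le> (LINT y|lborel. norm ((ex.Qs t n - limit_density t) y * \<phi> (x + y)))"
      by (rule integral_norm_bound)
    also have "\<dots> \<le> (LINT y|lborel. norm (ex.Qs t n - limit_density t) * \<bar>\<phi> (x + y)\<bar>)"
    proof (rule integral_mono)
      show "integrable lborel (\<lambda>y. norm ((ex.Qs t n - limit_density t) y * \<phi> (x + y)))" by (rule integrable_norm[OF i2])
      show "integrable lborel (\<lambda>y. norm (ex.Qs t n - limit_density t) * \<bar>\<phi> (x + y)\<bar>)" using i by simp
      show "norm ((ex.Qs t n - limit_density t) y * \<phi> (x + y)) \<le> norm (ex.Qs t n - limit_density t) * \<bar>\<phi> (x + y)\<bar>" for y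
        unfolding real_norm_def abs_mult by (intro mult_right_mono abs_apply_le_norm abs_ge_zero)
    qed
    also have "\<dots> = norm (ex.Qs t n - limit_density t) * ?I" by (rule integral_mult_right_zero)
    finally show "norm ((LINT y|lborel. ex.Qs t n y * \<phi> (x + y)) - (LINT y|lborel. limit_density t y * \<phi> (x + y))) \<le> norm (ex.Qs t n - limit_density t) * ?I"
      unfolding eq .
  next
    have "(\<lambda>n. norm (ex.Qs t n - limit_density t)) \<longlonglongrightarrow> 0" using Qs_tendsto[OF t] by (simp add: LIM_zero tendsto_norm_zero)
    then show "(\<lambda>n. norm (ex.Qs t n - limit_density t) * ?I) \<longlonglongrightarrow> 0" by (rule tendsto_mult_left_zero)
  qed
  then have 1: "(\<lambda>n. LINT y|lborel. ex.Qs t n y * \<phi> (x + y)) \<longlonglongrightarrow> (LINT y|lborel. limit_density t y * \<phi> (x + y))"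
    by (rule LIM_zero_cancel)
  have 2: "(\<lambda>n. ex.Am t n * ap (ex.Zs t n) \<phi> x) \<longlonglongrightarrow> 0"
  proof (rule Lim_null_comparison, rule always_eventually, rule allI)
    fix n
    show "norm (ex.Am t n * ap (ex.Zs t n) \<phi> x) \<le> ex.Am t n * norm \<phi>"
      using markov_abs_le[OF ex.markov_Zs[OF less_imp_le[OF t], of n], of \<phi> x] ex.Am_pos[of t n]
      by (simp add: abs_mult mult_left_mono)
  next
    show "(\<lambda>n. ex.Am t n * norm \<phi>) \<longlonglongrightarrow> 0"
      by (rule tendsto_mult_left_zero[OF Am_tendsto[OF _ jump_tail1 t]]) simp
  qed
  show ?thesis unfolding ex.decomp[OF less_imp_le[OF t] \<phi>] using tendsto_add[OF 1 2] by simp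
qed

lemma limit_density_nonneg: "0 < t \<Longrightarrow> 0 \<le> limit_density t x"
  by (rule LIMSEQ_le_const[OF tendsto_apply_bcontfun[OF Qs_tendsto]]) (use ex.Qs_nonneg[OF less_imp_le] in blast)+

lemma limit_density_integrable:
  assumes t: "0 < t"
  shows "integrable lborel (apply_bcontfun (limit_density t))" "(LINT x|lborel. limit_density t x) \<le> 1"
proof -
  obtain \<phi> :: "nat \<Rightarrow> ('a \<Rightarrow>\<^sub>C real)" where \<phi>: "\<And>k. integrable lborel (apply_bcontfun (\<phi> k))" "\<And>k x. 0 \<le> \<phi> k x" "\<And>k x. \<phi> k x \<le> 1"
    "\<And>j k x. j \<le> k \<Longrightarrow> \<phi> j x \<le> \<phi> k x" "\<And>x. (\<lambda>k. \<phi> k x) \<longlonglongrightarrow> 1"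
    by (rule cutoff_functions, rule that)
  have i: "integrable lborel (\<lambda>y. limit_density t y * \<phi> k y)" for k by (rule integrable_mult_bcontfun'(2)[OF \<phi>(1)])
  have le: "(LINT y|lborel. limit_density t y * \<phi> k y) \<le> 1" for k
  proof -
    have "ap (ex.Ps t n) (\<phi> k) 0 \<le> 1" for n
      using markov_le[OF ex.markov_Ps[OF less_imp_le[OF t], of n] \<phi>(2,3)] by simp
    then show ?thesis using LIMSEQ_le_const2[OF limit_density_limit[OF t \<phi>(1), of k 0], of 1] by simp
  qed
  have m: "mono (\<lambda>k. limit_density t y * \<phi> k y)" for y
    by (rule monoI) (intro mult_left_mono \<phi>(4) limit_density_nonneg t)
  have l: "(\<lambda>k. limit_density t y * \<phi> k y) \<longlonglongrightarrow> limit_density t y" for y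
    using tendsto_mult[OF tendsto_const \<phi>(5)[of y], of "limit_density t y"] by simp
  let ?X = "\<lambda>k. LINT y|lborel. limit_density t y * \<phi> k y"
  have "incseq ?X" by (intro incseq_SucI integral_mono i) (intro mult_left_mono \<phi>(4) limit_density_nonneg t, simp)
  then obtain a where a: "?X \<longlonglongrightarrow> a" using incseq_convergent[of ?X 1] le by blast
  have mon: "AE y in lborel. mono (\<lambda>k. limit_density t y * \<phi> k y)" using m by simp
  have lim: "AE y in lborel. (\<lambda>k. limit_density t y * \<phi> k y) \<longlonglongrightarrow> limit_density t y" using l by simp
  show "integrable lborel (apply_bcontfun (limit_density t))"
    by (rule integrable_monotone_convergence[OF i mon lim a]) simp
  have "(LINT x|lborel. limit_density t x) = a"
    by (rule integral_monotone_convergence[OF i mon lim a]) simp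
  then show "(LINT x|lborel. limit_density t x) \<le> 1" using LIMSEQ_le_const2[OF a, of 1] le by auto
qed

lemma limit_density_measurable:
  "(\<lambda>(x, t). limit_density t (x - x0)) \<in> borel_measurable (borel \<Otimes>\<^sub>M restrict_space borel {0<..})"
proof -
  let ?R = "restrict_space borel {0<..} :: real measure"
  have sp: "space (borel \<Otimes>\<^sub>M ?R) = (UNIV :: 'a set) \<times> {0<..}" by (simp add: space_pair_measure space_restrict_space)
  have Qc: "continuous_on (UNIV \<times> {0<..}) (\<lambda>p. ex.Qs (snd p) n (fst p - x0))" for n
  proof (rule continuous_on_sequentiallyI)
    fix u :: "nat \<Rightarrow> 'a \<times> real" and a
    assume a: "a \<in> UNIV \<times> {0<..}" and u: "u \<longlonglongrightarrow> a"
    have "isCont (\<lambda>t. ex.Qs t n) (snd a)"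
      by (rule continuous_on_interior[OF ex.continuous_on_Qs[of "snd a + 1"]]) (use a in \<open>auto simp: interior_atLeastAtMost_real\<close>)
    then have "(\<lambda>k. ex.Qs (snd (u k)) n) \<longlonglongrightarrow> ex.Qs (snd a) n"
      by (rule isCont_tendsto_compose) (rule tendsto_snd[OF u])
    then show "(\<lambda>k. ex.Qs (snd (u k)) n (fst (u k) - x0)) \<longlonglongrightarrow> ex.Qs (snd a) n (fst a - x0)"
      by (rule tendsto_apply_moving) (intro tendsto_intros u)
  qed
  have id: "(\<lambda>p. p) \<in> (borel \<Otimes>\<^sub>M ?R) \<rightarrow>\<^sub>M restrict_space (borel :: ('a \<times> real) measure) (UNIV \<times> {0<..})"
  proof (rule measurable_restrict_space2)
    show "(\<lambda>p. p) \<in> space (borel \<Otimes>\<^sub>M ?R) \<rightarrow> (UNIV :: 'a set) \<times> {0<..}" unfolding sp by simp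
    have s: "(\<lambda>t. t) \<in> ?R \<rightarrow>\<^sub>M borel" by (rule measurable_restrict_space1) simp
    have "(\<lambda>p. (fst p, snd p)) \<in> (borel \<Otimes>\<^sub>M ?R) \<rightarrow>\<^sub>M ((borel :: 'a measure) \<Otimes>\<^sub>M (borel :: real measure))"
      by (rule measurable_Pair[OF measurable_fst measurable_compose[OF measurable_snd s]])
    then show "(\<lambda>p. p) \<in> (borel \<Otimes>\<^sub>M ?R) \<rightarrow>\<^sub>M (borel :: ('a \<times> real) measure)" by (simp add: borel_prod)
  qed
  have Qm: "(\<lambda>p. ex.Qs (snd p) n (fst p - x0)) \<in> borel_measurable (borel \<Otimes>\<^sub>M ?R)" for n
    using measurable_compose[OF id borel_measurable_continuous_on_restrict[OF Qc]] by simp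
  have "(\<lambda>p. limit_density (snd p) (fst p - x0)) \<in> borel_measurable (borel \<Otimes>\<^sub>M ?R)"
  proof (rule borel_measurable_LIMSEQ_real[OF _ Qm])
    fix p :: "'a \<times> real" assume "p \<in> space (borel \<Otimes>\<^sub>M ?R)"
    then have "0 < snd p" unfolding sp by auto
    then show "(\<lambda>n. ex.Qs (snd p) n (fst p - x0)) \<longlonglongrightarrow> limit_density (snd p) (fst p - x0)"
      by (intro tendsto_apply_bcontfun Qs_tendsto)
  qed
  then show ?thesis by (simp add: case_prod_beta')
qed

lemma integrable_gen_tail:
  assumes "0 < \<epsilon>" "integrable lborel (apply_bcontfun \<phi>)"
  shows "integrable lborel (apply_bcontfun (ap (gen_op (tail \<epsilon>)) \<phi>))"
  using adj_opD(1)[OF adj_conv_op[OF jump_densityD[OF jump_tail[OF assms(1)]]] assms(2)] assms(2)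
  by (simp add: gen_op_def ap.diff_left ap.scaleR_left minus_bcontfun.rep_eq[abs_def])

text \<open>The truncated semigroups satisfy the integral equation exactly; the limit may be taken in each term.
  In the integrand both the operator and the function vary with the truncation, which is disentangled by
  freezing the function at a level \<open>m\<close>.\<close>
lemma limit_density_weak:
  assumes \<psi>: "test_function \<psi>" and t: "0 < t"
  shows "(LINT x|lborel. limit_density t (x - x0) * \<psi> x) =
    \<psi> x0 + (LINT s:{0<..<t}|lborel. (LINT x|lborel. limit_density s (x - x0) * levy_operator levy \<psi> x))"
proof -
  obtain \<psi>b K where \<psi>b: "apply_bcontfun \<psi>b = \<psi>" and K: "0 \<le> K" "second_diff K \<psi>b"
    by (rule test_function_bcontfun[OF \<psi>], rule that)
  obtain L where L: "\<And>\<epsilon>. 0 < \<epsilon> \<Longrightarrow> norm (ap (gen_op (tail \<epsilon>)) \<psi>b - L) \<le> K / 2 * small_moment \<epsilon>"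
    by (rule gen_tail_limit[OF K(2,1)], rule that)
  have lev: "levy_operator levy \<psi> x = L x" for x using levy_operator_eq[OF L] by (simp add: \<psi>b)
  have i\<psi>: "integrable lborel (apply_bcontfun \<psi>b)" using test_function_integrable[OF \<psi>] by (simp add: \<psi>b)
  let ?e = "radius 1"
  have e: "0 < ?e n" "?e n \<le> 1" for n using radius_pos[of 1 n] radius_le[of 1 n] by auto
  have lime: "(\<lambda>n. K / 2 * small_moment (?e n)) \<longlonglongrightarrow> 0"
    by (rule tendsto_mult_right_zero, rule filterlim_compose[OF small_moment_tendsto radius_tendsto]) simp
  let ?g = "\<lambda>n. ap (gen_op (tail (?e n))) \<psi>b"
  define F where "F n s = ap (ex.Ps s n) (?g n) x0" for n s
  define G where "G s = (LINT y|lborel. limit_density s y * L (x0 + y))" for s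
  have Fbound: "\<bar>F n s\<bar> \<le> norm L + K / 2 * small_moment 1" if "0 \<le> s" for n s
  proof -
    have "\<bar>F n s\<bar> \<le> norm (?g n)" unfolding F_def by (rule markov_abs_le[OF ex.markov_Ps[OF that]])
    also have "\<dots> \<le> norm L + norm (?g n - L)" using norm_triangle_ineq[of L "?g n - L"] by simp
    also have "norm (?g n - L) \<le> K / 2 * small_moment 1"
      using L[OF e(1)[of n]] mult_left_mono[OF small_moment_mono[OF e(2)[of n]], of "K / 2"] K(1) by linarith
    finally show ?thesis by simp
  qed
  have Flim: "(\<lambda>n. F n s) \<longlonglongrightarrow> G s" if s: "0 < s" for s
  proof (rule LIMSEQ_I)
    fix \<delta> :: real assume \<delta>: "0 < \<delta>"
    then have "0 < \<delta> / 4" by simp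
    from order_tendstoD(2)[OF lime this] obtain m where m: "K / 2 * small_moment (?e m) < \<delta> / 4"
      by (auto simp: eventually_sequentially)
    note im = integrable_gen_tail[OF e(1)[of m] i\<psi>]
    let ?Gm = "LINT y|lborel. limit_density s y * ?g m (x0 + y)"
    obtain n0 where n0: "\<And>n. n0 \<le> n \<Longrightarrow> \<bar>ap (ex.Ps s n) (?g m) x0 - ?Gm\<bar> < \<delta> / 4"
      using LIMSEQ_D[OF limit_density_limit[OF s im, of x0] \<open>0 < \<delta> / 4\<close>] by auto
    have GmG: "\<bar>?Gm - G s\<bar> \<le> K / 2 * small_moment (?e m)"
    proof -
      have j: "integrable lborel (\<lambda>y. limit_density s y * \<phi> (x0 + y))" for \<phi> :: "'a \<Rightarrow>\<^sub>C real"
        by (rule integrable_mult_bcontfun[OF limit_density_integrable(1)[OF s]])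
      have eq: "?Gm - G s = (LINT y|lborel. limit_density s y * (?g m - L) (x0 + y))"
        unfolding G_def Bochner_Integration.integral_diff[OF j j, symmetric] by (simp add: minus_bcontfun.rep_eq right_diff_distrib)
      have "\<bar>LINT y|lborel. limit_density s y * (?g m - L) (x0 + y)\<bar> \<le> (LINT y|lborel. \<bar>limit_density s y * (?g m - L) (x0 + y)\<bar>)"
        by (rule integral_abs_bound)
      also have "\<dots> \<le> (LINT y|lborel. limit_density s y * (K / 2 * small_moment (?e m)))"
      proof (rule integral_mono)
        show "integrable lborel (\<lambda>y. \<bar>limit_density s y * (?g m - L) (x0 + y)\<bar>)" by (rule integrable_abs[OF j])
        show "integrable lborel (\<lambda>y. limit_density s y * (K / 2 * small_moment (?e m)))" using limit_density_integrable(1)[OF s] by simp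
        fix y
        have "\<bar>(?g m - L) (x0 + y)\<bar> \<le> K / 2 * small_moment (?e m)"
          using abs_apply_le_norm[of "?g m - L" "x0 + y"] L[OF e(1)[of m]] by linarith
        then show "\<bar>limit_density s y * (?g m - L) (x0 + y)\<bar> \<le> limit_density s y * (K / 2 * small_moment (?e m))"
          unfolding abs_mult abs_of_nonneg[OF limit_density_nonneg[OF s]] by (rule mult_left_mono[OF _ limit_density_nonneg[OF s]])
      qed
      also have "\<dots> = (LINT y|lborel. limit_density s y) * (K / 2 * small_moment (?e m))" by (rule integral_mult_left_zero)
      also have "\<dots> \<le> 1 * (K / 2 * small_moment (?e m))"
        using limit_density_integrable(2)[OF s] K(1) small_moment_nonneg[of "?e m"] by (intro mult_right_mono) auto
      finally show ?thesis unfolding eq by (simp only: mult_1)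
    qed
    have "norm (F n s - G s) < \<delta>" if n: "max m n0 \<le> n" for n
    proof -
      have "?e n \<le> ?e m" using n by (simp add: radius_def field_simps)
      then have sn: "K / 2 * small_moment (?e n) \<le> K / 2 * small_moment (?e m)" using K(1) by (intro mult_left_mono small_moment_mono) auto
      have "\<bar>F n s - ap (ex.Ps s n) (?g m) x0\<bar> = \<bar>ap (ex.Ps s n) (?g n - ?g m) x0\<bar>"
        by (simp add: F_def ap.diff_right minus_bcontfun.rep_eq)
      also have "\<dots> \<le> norm (?g n - ?g m)" by (rule markov_abs_le[OF ex.markov_Ps[OF less_imp_le[OF s]]])
      also have "\<dots> \<le> norm (?g n - L) + norm (?g m - L)"
        using norm_triangle_ineq4[of "?g n - L" "?g m - L"] by simp
      also have "\<dots> \<le> 2 * (K / 2 * small_moment (?e m))" using L[OF e(1)[of n]] L[OF e(1)[of m]] sn by linarith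
      finally have "\<bar>F n s - ap (ex.Ps s n) (?g m) x0\<bar> \<le> 2 * (K / 2 * small_moment (?e m))" .
      moreover have "\<bar>ap (ex.Ps s n) (?g m) x0 - ?Gm\<bar> < \<delta> / 4" using n by (intro n0) simp
      ultimately show ?thesis using GmG m unfolding real_norm_def by linarith
    qed
    then show "\<exists>n0. \<forall>n\<ge>n0. norm (F n s - G s) < \<delta>" by blast
  qed
  have Fm: "(\<lambda>s. indicator {0<..<t} s *\<^sub>R F n s) \<in> borel_measurable borel" for n
    unfolding F_def Ps_tail by (rule borel_measurable_continuous_on_indicator[OF _ continuous_on_ap_cps]) simp
  have lim0: "(\<lambda>n. indicator {0<..<t} s *\<^sub>R F n s) \<longlonglongrightarrow> indicator {0<..<t} s *\<^sub>R G s" for s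
    using Flim[of s] by (cases "s \<in> {0<..<t}") auto
  have Gm: "(\<lambda>s. indicator {0<..<t} s *\<^sub>R G s) \<in> borel_measurable borel"
    by (rule borel_measurable_LIMSEQ_real[OF lim0 Fm])
  have intlim: "(\<lambda>n. LINT s:{0<..<t}|lborel. F n s) \<longlonglongrightarrow> (LINT s:{0<..<t}|lborel. G s)"
    unfolding set_lebesgue_integral_def
  proof (rule integral_dominated_convergence[where w = "\<lambda>s. indicator {0<..<t} s * (norm L + K / 2 * small_moment 1)"])
    show "integrable lborel (\<lambda>s. indicator {0<..<t} s * (norm L + K / 2 * small_moment 1))"
      using t by (intro integrable_mult_left) (simp add: integrable_indicator_iff)
    show "AE s in lborel. norm (indicator {0<..<t} s *\<^sub>R F n s) \<le> indicator {0<..<t} s * (norm L + K / 2 * small_moment 1)" for n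
      using Fbound by (intro AE_I2) (auto simp: indicator_def)
  qed (use Fm Gm lim0 in auto)
  have eq: "ap (ex.Ps t n) \<psi>b x0 = \<psi> x0 + (LINT s:{0<..<t}|lborel. F n s)" for n
    unfolding F_def Ps_tail by (subst cps_integral_equation[OF less_imp_le[OF t]]) (simp add: \<psi>b)
  have "(\<lambda>n. ap (ex.Ps t n) \<psi>b x0) \<longlonglongrightarrow> \<psi> x0 + (LINT s:{0<..<t}|lborel. G s)"
    unfolding eq by (intro tendsto_intros intlim)
  from LIMSEQ_unique[OF this limit_density_limit[OF t i\<psi>, of x0]]
  have "(LINT y|lborel. limit_density t y * \<psi> (x0 + y)) = \<psi> x0 + (LINT s:{0<..<t}|lborel. G s)" by (simp add: \<psi>b)
  moreover have tr: "(LINT x|lborel. limit_density s (x - x0) * l x) = (LINT y|lborel. limit_density s y * l (x0 + y))"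
    if [measurable]: "l \<in> borel_measurable borel" for s and l :: "'a \<Rightarrow> real"
  proof -
    have "(\<lambda>x. limit_density s (x - x0) * l x) \<in> borel_measurable borel" by measurable
    from integral_lborel_translate(2)[OF this, of x0] show ?thesis by (simp add: add.commute)
  qed
  ultimately show ?thesis
    using tr[OF test_function_measurable[OF \<psi>], of t] tr[OF borel_measurable_bcontfun[of L]] by (simp add: lev G_def)
qed

lemma heat_kernel_exists: "\<exists>H. heat_kernel levy H"
proof -
  define H where "H x0 x t = limit_density t (x - x0)" for x0 x t
  have "fundamental_solution levy x0 (H x0)" for x0
    unfolding fundamental_solution_def H_def
  proof (intro conjI exI[of _ 1] allI impI)
    show "(\<lambda>(x, t). limit_density t (x - x0)) \<in> borel_measurable (borel \<Otimes>\<^sub>M restrict_space borel {0<..})" by (rule limit_density_measurable)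
    fix t :: real assume t: "0 < t"
    show "0 \<le> limit_density t (x - x0)" for x by (rule limit_density_nonneg[OF t])
    show "integrable lborel (\<lambda>x. limit_density t (x - x0))" "(LINT x|lborel. limit_density t (x - x0)) \<le> 1"
      using integral_lborel_translate[of "apply_bcontfun (limit_density t)" "- x0"] limit_density_integrable[OF t] by simp_all
    show "(LINT x|lborel. limit_density t (x - x0) * \<psi> x) =
      \<psi> x0 + (LINT s:{0<..<t}|lborel. (LINT x|lborel. limit_density s (x - x0) * levy_operator levy \<psi> x))" if "test_function \<psi>" for \<psi>
      by (rule limit_density_weak[OF that t])
  qed
  then have "heat_kernel levy H" unfolding heat_kernel_def by (simp add: H_def)
  then show ?thesis by blast
qed

end

section \<open>From heat kernel bounds to the Green function\<close>

lemma nn_integral_min_powers: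
  fixes \<alpha> d r :: real
  assumes \<alpha>: "0 < \<alpha>" "\<alpha> < d" and r: "0 < r"
  shows "(\<integral>\<^sup>+t. ennreal (min (t powr (- (d / \<alpha>))) (t * r powr (- (d + \<alpha>)))) * indicator {0<..} t \<partial>lborel)
    \<le> ennreal ((1 + \<alpha> / (d - \<alpha>)) * r powr (- (d - \<alpha>)))"
proof -
  define p where "p = d / \<alpha>"
  define T where "T = r powr \<alpha>"
  have p: "1 < p" using \<alpha> by (simp add: p_def)
  have T: "0 < T" using r by (simp add: T_def)
  have e1: "T * r powr (- (d + \<alpha>)) * T = r powr (- (d - \<alpha>))"
  proof -
    have "T * r powr (- (d + \<alpha>)) * T = r powr (\<alpha> + - (d + \<alpha>) + \<alpha>)" by (simp only: T_def powr_add)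
    also have "\<alpha> + - (d + \<alpha>) + \<alpha> = - (d - \<alpha>)" by simp
    finally show ?thesis .
  qed
  have e2: "T powr (1 - p) / (p - 1) = \<alpha> / (d - \<alpha>) * r powr (- (d - \<alpha>))"
  proof -
    have "\<alpha> * (1 - p) = - (d - \<alpha>)" using \<alpha> by (simp add: p_def field_simps)
    then have "T powr (1 - p) = r powr (- (d - \<alpha>))" by (simp add: T_def powr_powr)
    moreover have "p - 1 = (d - \<alpha>) / \<alpha>" using \<alpha> by (simp add: p_def field_simps)
    ultimately show ?thesis by simp
  qed
  have "(\<integral>\<^sup>+t. ennreal (min (t powr (- p)) (t * r powr (- (d + \<alpha>)))) * indicator {0<..} t \<partial>lborel)
     \<le> (\<integral>\<^sup>+t. ennreal (T * r powr (- (d + \<alpha>))) * indicator {0..T} t + ennreal (t powr (- p)) * indicator {T..} t \<partial>lborel)"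
  proof (rule nn_integral_mono)
    fix t :: real
    show "ennreal (min (t powr (- p)) (t * r powr (- (d + \<alpha>)))) * indicator {0<..} t
      \<le> ennreal (T * r powr (- (d + \<alpha>))) * indicator {0..T} t + ennreal (t powr (- p)) * indicator {T..} t"
    proof (cases "0 < t")
      case t: True
      show ?thesis
      proof (cases "t \<le> T")
        case True
        have "min (t powr (- p)) (t * r powr (- (d + \<alpha>))) \<le> T * r powr (- (d + \<alpha>))"
          by (rule order_trans[OF min.cobounded2]) (use True in \<open>intro mult_right_mono, auto\<close>)
        then have "ennreal (min (t powr (- p)) (t * r powr (- (d + \<alpha>)))) \<le> ennreal (T * r powr (- (d + \<alpha>)))"
          by (rule ennreal_leI)
        then show ?thesis using True t by (simp add: add_increasing2)
      next
        case False
        then show ?thesis using t by (auto intro!: ennreal_leI)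
      qed
    qed simp
  qed
  also have "\<dots> = (\<integral>\<^sup>+t. ennreal (T * r powr (- (d + \<alpha>))) * indicator {0..T} t \<partial>lborel) + (\<integral>\<^sup>+t. ennreal (t powr (- p)) * indicator {T..} t \<partial>lborel)"
    by (rule nn_integral_add) auto
  also have "(\<integral>\<^sup>+t. ennreal (T * r powr (- (d + \<alpha>))) * indicator {0..T} t \<partial>lborel) = ennreal (T * r powr (- (d + \<alpha>)) * T)"
    using T by (subst nn_integral_cmult_indicator) (auto simp: ennreal_mult)
  also have "(\<integral>\<^sup>+t. ennreal (t powr (- p)) * indicator {T..} t \<partial>lborel) = ennreal (0 - (- (T powr (1 - p) / (p - 1))))"
  proof (rule nn_integral_FTC_atLeast)
    show "((\<lambda>t. - (t powr (1 - p) / (p - 1))) \<longlongrightarrow> 0) at_top"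
    proof -
      have "((\<lambda>t :: real. t powr (1 - p)) \<longlongrightarrow> 0) at_top"
        by (rule tendsto_neg_powr) (use p in \<open>auto intro: filterlim_ident\<close>)
      from tendsto_minus[OF tendsto_divide_zero[OF this, of "p - 1"]] show ?thesis by simp
    qed
    fix t :: real assume "T \<le> t"
    then have t: "0 < t" using T by simp
    have "((\<lambda>t. t powr (1 - p)) has_real_derivative (1 - p) * t powr (1 - p - 1)) (at t)"
      by (rule has_real_derivative_powr[OF t])
    then have "((\<lambda>t. - (t powr (1 - p) / (p - 1))) has_real_derivative - ((1 - p) * t powr (1 - p - 1) / (p - 1))) (at t)"
      by (intro DERIV_minus DERIV_cdivide)
    moreover have "- ((1 - p) * t powr (1 - p - 1) / (p - 1)) = t powr (- p)" using p by (simp add: field_simps)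
    ultimately show "DERIV (\<lambda>t. - (t powr (1 - p) / (p - 1))) t :> t powr (- p)" by simp
  qed auto
  also have "ennreal (T * r powr (- (d + \<alpha>)) * T) + ennreal (0 - (- (T powr (1 - p) / (p - 1))))
      = ennreal ((1 + \<alpha> / (d - \<alpha>)) * r powr (- (d - \<alpha>)))"
    unfolding e1 using e2 \<alpha> by (subst ennreal_plus[symmetric]) (auto simp: distrib_right)
  finally show ?thesis by (simp add: p_def)
qed

lemma green_bound_of_heat_kernel_bound:
  fixes \<mu> :: "'a::euclidean_space measure"
  assumes \<alpha>: "0 < \<alpha>" "\<alpha> < real DIM('a)" and hb: "heat_kernel_bound \<alpha> \<mu>"
  shows "green_function_bound \<alpha> \<mu>"
  unfolding green_function_bound_def
proof (intro conjI allI impI)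
  show "\<exists>H. heat_kernel \<mu> H" using hb by (simp add: heat_kernel_bound_def)
  fix H assume H: "heat_kernel \<mu> H"
  let ?N = "real DIM('a)"
  obtain C where C: "0 < C" "\<And>x0 t. 0 < t \<Longrightarrow> AE x in lborel.
      H x0 x t \<le> C * min (t powr (- (?N / \<alpha>))) (t * norm (x - x0) powr (- (?N + \<alpha>)))"
    using hb H unfolding heat_kernel_bound_def by blast
  define D where "D = C * (1 + \<alpha> / (?N - \<alpha>))"
  have D: "0 < D" using C(1) \<alpha> by (simp add: D_def add_pos_pos)
  have "AE x in lborel. green_function H x0 x \<le> ennreal (D * norm (x - x0) powr (- (?N - \<alpha>)))" for x0
  proof -
    have m: "(\<lambda>(x, t). H x0 x t) \<in> borel_measurable (borel \<Otimes>\<^sub>M restrict_space borel {0<..})"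
      using H by (simp add: heat_kernel_def fundamental_solution_def)
    \<comment> \<open>the kernel is measurable only on positive times; any value may be taken elsewhere\<close>
    define pos where "pos t = (if 0 < t then t else 1)" for t :: real
    have pos: "pos \<in> borel \<rightarrow>\<^sub>M restrict_space borel {0<..}"
      unfolding pos_def by (rule measurable_restrict_space2) (auto simp: pos_def)
    have "(\<lambda>p. (fst p, pos (snd p))) \<in> ((lborel :: 'a measure) \<Otimes>\<^sub>M lborel) \<rightarrow>\<^sub>M (borel \<Otimes>\<^sub>M restrict_space borel {0<..})"
    proof (rule measurable_Pair)
      show "fst \<in> (lborel \<Otimes>\<^sub>M lborel) \<rightarrow>\<^sub>M (borel :: 'a measure)" by measurable
      have "snd \<in> ((lborel :: 'a measure) \<Otimes>\<^sub>M lborel) \<rightarrow>\<^sub>M (borel :: real measure)" by measurable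
      from measurable_compose[OF this pos]
      show "(\<lambda>p. pos (snd p)) \<in> ((lborel :: 'a measure) \<Otimes>\<^sub>M lborel) \<rightarrow>\<^sub>M restrict_space borel {0<..}" .
    qed
    from measurable_compose[OF this m]
    have hm: "(\<lambda>p. H x0 (fst p) (pos (snd p))) \<in> borel_measurable ((lborel :: 'a measure) \<Otimes>\<^sub>M lborel)"
      by simp
    let ?P = "\<lambda>x t. 0 < t \<longrightarrow> H x0 x (pos t) \<le> C * min (t powr (- (?N / \<alpha>))) (t * norm (x - x0) powr (- (?N + \<alpha>)))"
    let ?M = "(lborel :: 'a measure) \<Otimes>\<^sub>M (lborel :: real measure)"
    have sm: "snd \<in> borel_measurable ?M" and fm: "fst \<in> borel_measurable ?M" by measurable
    have "(\<lambda>p. norm (fst p - x0)) \<in> borel_measurable ?M"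
      by measurable
    then have Fm: "(\<lambda>p. C * min (snd p powr (- (?N / \<alpha>))) (snd p * norm (fst p - x0) powr (- (?N + \<alpha>)))) \<in> borel_measurable ?M"
      by (intro borel_measurable_times borel_measurable_min powr_real_measurable sm borel_measurable_const)
    have "{p \<in> space ?M. ?P (fst p) (snd p)} \<in> sets ?M"
      by (intro sets.sets_Collect_imp borel_measurable_le borel_measurable_less Fm hm sm borel_measurable_const)
    from lborel_pair.AE_commute[OF this]
    have "(AE x in lborel. AE t in lborel. ?P x t) \<longleftrightarrow> (AE t in lborel. AE x in lborel. ?P x t)" .
    moreover have "AE t in lborel. AE x in lborel. ?P x t"
    proof (rule AE_I2)
      fix t :: real
      show "AE x in lborel. ?P x t" using C(2)[of t x0] by (cases "0 < t") (auto simp: pos_def)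
    qed
    ultimately have "AE x in lborel. AE t in lborel. ?P x t" by blast
    then show ?thesis
      using AE_lborel_singleton[of x0]
    proof eventually_elim
      case (elim x)
      define r where "r = norm (x - x0)"
      have r: "0 < r" using elim(2) by (simp add: r_def)
      let ?m = "\<lambda>t. min (t powr (- (?N / \<alpha>))) (t * r powr (- (?N + \<alpha>)))"
      have "green_function H x0 x \<le> (\<integral>\<^sup>+t. ennreal C * (ennreal (?m t) * indicator {0<..} t) \<partial>lborel)"
        unfolding green_function_def
      proof (rule nn_integral_mono_AE)
        show "AE t in lborel. ennreal (H x0 x t) * indicator {0<..} t \<le> ennreal C * (ennreal (?m t) * indicator {0<..} t)"
          using elim(1)
        proof eventually_elim
          case (elim t)
          show ?case
          proof (cases "0 < t")
            case True
            then have "ennreal (H x0 x t) \<le> ennreal (C * ?m t)" using elim by (intro ennreal_leI) (simp add: pos_def r_def)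
            also have "\<dots> = ennreal C * ennreal (?m t)" using C(1) True by (intro ennreal_mult) auto
            finally show ?thesis using True by simp
          qed simp
        qed
      qed
      also have "\<dots> = ennreal C * (\<integral>\<^sup>+t. ennreal (?m t) * indicator {0<..} t \<partial>lborel)"
        by (rule nn_integral_cmult) simp
      also have "\<dots> \<le> ennreal C * ennreal ((1 + \<alpha> / (?N - \<alpha>)) * r powr (- (?N - \<alpha>)))"
        by (rule mult_left_mono[OF nn_integral_min_powers[OF \<alpha> r]]) simp
      also have "\<dots> = ennreal (D * r powr (- (?N - \<alpha>)))"
        using C(1) \<alpha> by (subst ennreal_mult[symmetric]) (auto simp: D_def mult.assoc)
      finally show ?case by (simp add: r_def)
    qed
  qed
  with D show "\<exists>C>0. \<forall>x0. AE x in lborel. green_function H x0 x \<le> ennreal (C * norm (x - x0) powr (- (?N - \<alpha>)))"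
    by blast
qed

section \<open>A symmetric version of the jump density\<close>

text \<open>The density of a symmetric measure is symmetric only up to a null set. Averaging it over reflections
  and cutting it off at its bounds makes its properties hold everywhere.\<close>
lemma density_comparable_stable_like:
  fixes \<mu> :: "'a::euclidean_space measure"
  assumes \<alpha>: "0 < \<alpha>" "\<alpha> < 2" and sym: "symmetric_levy_measure \<mu>" and dc: "density_comparable \<alpha> \<mu>"
  obtains f c C where "stable_like f \<alpha> c C" "\<mu> = density lborel (\<lambda>z. ennreal (f z))"
proof -
  obtain f0 C0 c where f0 [measurable]: "f0 \<in> borel_measurable borel" and \<mu>0: "\<mu> = density lborel (\<lambda>z. ennreal (f0 z))"
    and c: "0 < C0" "0 < c" and bd: "AE z in lborel. c / norm z powr (real DIM('a) + \<alpha>) \<le> f0 z \<and> f0 z \<le> C0 / norm z powr (real DIM('a) + \<alpha>)"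
    using dc unfolding density_comparable_def by blast
  define C where "C = max C0 c"
  have C: "0 < C" "c \<le> C" "C0 \<le> C" using c by (auto simp: C_def)
  let ?w = "\<lambda>z :: 'a. norm z powr (real DIM('a) + \<alpha>)"
  define f where "f z = max (c / ?w z) (min (C / ?w z) ((f0 z + f0 (- z)) / 2))" for z
  have fm [measurable]: "f \<in> borel_measurable borel" unfolding f_def[abs_def] by measurable
  have f0m [measurable]: "(\<lambda>z. f0 (- z)) \<in> borel_measurable borel" by measurable
  have symA: "emeasure \<mu> (uminus ` A) = emeasure \<mu> A" if "A \<in> sets borel" for A
    using sym that by (simp add: symmetric_levy_measure_def)
  have "density lborel (\<lambda>z. ennreal (f0 (- z))) = density lborel (\<lambda>z. ennreal (f0 z))"
  proof (rule measure_eqI)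
    fix A :: "'a set" assume "A \<in> sets (density lborel (\<lambda>z. ennreal (f0 (- z))))"
    then have A [measurable]: "A \<in> sets borel" by simp
    have uA: "uminus ` A = uminus -` A"
    proof (intro set_eqI iffI)
      fix x assume "x \<in> uminus -` A"
      then show "x \<in> uminus ` A" by (intro image_eqI[of _ _ "- x"]) auto
    qed auto
    have uAm: "uminus -` A \<in> sets borel" using measurable_sets_borel[OF borel_measurable_uminus[OF measurable_ident] A] by simp
    have "emeasure (density lborel (\<lambda>z. ennreal (f0 (- z)))) A = (\<integral>\<^sup>+z. ennreal (f0 (- z)) * indicator A z \<partial>lborel)"
      by (rule emeasure_density) auto
    also have "\<dots> = (\<integral>\<^sup>+z. ennreal (f0 (- (0 + (- 1) *\<^sub>R z))) * indicator A (0 + (- 1) *\<^sub>R z) \<partial>lborel)"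
      by (subst nn_integral_lborel_affine[where c = "- 1" and t = 0]) auto
    also have "\<dots> = (\<integral>\<^sup>+z. ennreal (f0 z) * indicator (uminus -` A) z \<partial>lborel)"
      by (simp add: indicator_def vimage_def)
    also have "\<dots> = emeasure \<mu> (uminus -` A)"
      unfolding \<mu>0 by (rule emeasure_density[symmetric]) (use uAm in auto)
    also have "\<dots> = emeasure (density lborel (\<lambda>z. ennreal (f0 z))) A" using symA[OF A] unfolding uA \<mu>0 .
    finally show "emeasure (density lborel (\<lambda>z. ennreal (f0 (- z)))) A = emeasure (density lborel (\<lambda>z. ennreal (f0 z))) A" .
  qed simp
  then have "AE z in lborel. ennreal (f0 (- z)) = ennreal (f0 z)"
    by (subst (asm) sigma_finite_measure.density_unique_iff[OF sigma_finite_lborel]) auto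
  then have ff0: "AE z in lborel. f z = f0 z"
    using bd AE_lborel_singleton[of 0]
  proof eventually_elim
    case (elim z)
    have w: "0 < ?w z" using elim(3) by simp
    have "0 < c / ?w z" using w c by simp
    then have "0 < f0 z" using elim(2) by linarith
    moreover from this have "0 < ennreal (f0 (- z))" unfolding elim(1) by simp
    then have "0 < f0 (- z)" by simp
    ultimately have "f0 (- z) = f0 z" using elim(1) ennreal_inj[of "f0 (- z)" "f0 z"] by simp
    moreover have "C0 / ?w z \<le> C / ?w z" using C w by (intro divide_right_mono) auto
    ultimately show ?case using elim(2) by (simp add: f_def)
  qed
  have \<mu>: "\<mu> = density lborel (\<lambda>z. ennreal (f z))"
    unfolding \<mu>0 by (rule density_cong) (use ff0 in \<open>auto elim!: eventually_mono\<close>)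
  have fpos: "0 \<le> f z" for z using c by (simp add: f_def le_max_iff_disj)
  have fin: "(\<integral>\<^sup>+z\<in>{z. norm z \<le> 1}. ennreal ((norm z)\<^sup>2) \<partial>\<mu>) < \<infinity>" "(\<integral>\<^sup>+z\<in>{z. norm z > 1}. 1 \<partial>\<mu>) < \<infinity>"
    using sym by (auto simp: symmetric_levy_measure_def)
  have "stable_like f \<alpha> c C"
  proof
    show "f (- z) = f z" for z by (simp add: f_def add.commute)
    show "c / ?w z \<le> f z" for z by (simp add: f_def)
    show "f z \<le> C / ?w z" for z using C by (auto simp: f_def intro!: divide_right_mono)
    show "integrable lborel (\<lambda>z. indicator {z. norm z \<le> 1} z * ((norm z)\<^sup>2 * f z))"
    proof (rule integrableI_nonneg)
      have "(\<integral>\<^sup>+z. ennreal (indicator {z. norm z \<le> 1} z * ((norm z)\<^sup>2 * f z)) \<partial>lborel)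
        = (\<integral>\<^sup>+z. ennreal (f z) * (ennreal ((norm z)\<^sup>2) * indicator {z. norm z \<le> 1} z) \<partial>lborel)"
        by (rule nn_integral_cong) (auto simp: indicator_def ennreal_mult fpos mult.commute)
      also have "\<dots> = (\<integral>\<^sup>+z\<in>{z. norm z \<le> 1}. ennreal ((norm z)\<^sup>2) \<partial>\<mu>)"
        unfolding \<mu> by (rule nn_integral_density[symmetric]) auto
      finally show "(\<integral>\<^sup>+z. ennreal (indicator {z. norm z \<le> 1} z * ((norm z)\<^sup>2 * f z)) \<partial>lborel) < \<infinity>" using fin(1) by simp
    qed (auto simp: fpos)
    show "integrable lborel (\<lambda>z. indicator {z. 1 < norm z} z * f z)"
    proof (rule integrableI_nonneg)
      have "(\<integral>\<^sup>+z. ennreal (indicator {z. 1 < norm z} z * f z) \<partial>lborel)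
        = (\<integral>\<^sup>+z. ennreal (f z) * (1 * indicator {z. 1 < norm z} z) \<partial>lborel)"
        by (rule nn_integral_cong) (auto simp: indicator_def)
      also have "\<dots> = (\<integral>\<^sup>+z\<in>{z. norm z > 1}. 1 \<partial>\<mu>)"
        unfolding \<mu> by (rule nn_integral_density[symmetric]) auto
      finally show "(\<integral>\<^sup>+z. ennreal (indicator {z. 1 < norm z} z * f z) \<partial>lborel) < \<infinity>" using fin(2) by simp
    qed (auto simp: fpos)
  qed (use \<alpha> c C in auto)
  then show ?thesis using that \<mu> by blast
qed

text \<open>The off-diagonal bounds hold outside a null set that may depend on the distance, hence only dyadic
  distances are used.\<close>
lemma (in stable_like) heat_kernel_bound_levy: "heat_kernel_bound \<alpha> levy"
  unfolding heat_kernel_bound_def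
proof (intro conjI allI impI)
  show "\<exists>H. heat_kernel levy H" by (rule heat_kernel_exists)
  fix H :: "'a \<Rightarrow> 'a \<Rightarrow> real \<Rightarrow> real" assume H: "heat_kernel levy H"
  let ?N = "real DIM('a)"
  obtain D where D: "0 < D"
    "\<And>x0 u t. fundamental_solution levy x0 u \<Longrightarrow> 0 < t \<Longrightarrow> AE x in lborel. u x t \<le> D * t powr (- (?N / \<alpha>))"
    "\<And>x0 u t R. fundamental_solution levy x0 u \<Longrightarrow> 0 < t \<Longrightarrow> 0 < R \<Longrightarrow>
      AE x in lborel. R < norm (x - x0) \<longrightarrow> u x t \<le> D * (t * R powr (- (?N + \<alpha>)))"
    by (rule heat_kernel_bounds, rule that)
  let ?E = "D * 2 powr (?N + \<alpha>)"
  have DE: "D \<le> ?E" using D(1) \<alpha> by (simp add: ge_one_powr_ge_zero)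
  have "AE x in lborel. H x0 x t \<le> ?E * min (t powr (- (?N / \<alpha>))) (t * norm (x - x0) powr (- (?N + \<alpha>)))"
    if t: "0 < t" for x0 t
  proof -
    have u: "fundamental_solution levy x0 (H x0)" using H by (simp add: heat_kernel_def)
    have "AE x in lborel. \<forall>j::int. 2 powr j < norm (x - x0) \<longrightarrow> H x0 x t \<le> D * (t * (2 powr j) powr (- (?N + \<alpha>)))"
      unfolding AE_all_countable using D(3)[OF u t] by simp
    then show ?thesis
      using D(2)[OF u t] AE_lborel_singleton[of x0]
    proof eventually_elim
      case (elim x)
      define r where "r = norm (x - x0)"
      have r: "0 < r" using elim(3) by (simp add: r_def)
      define j where "j = \<lceil>log 2 r\<rceil> - 1"
      have j: "of_int j < log 2 r" "log 2 r \<le> of_int j + 1"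
        using ceiling_correct[of "log 2 r"] by (auto simp: j_def)
      have j1: "2 powr j < r" using j(1) r by (simp add: less_log_iff)
      have "r \<le> 2 powr (of_int j + 1)" using j(2) r by (simp add: log_le_iff)
      then have j2: "r / 2 \<le> 2 powr j" by (simp add: powr_add)
      have "H x0 x t \<le> D * (t * (2 powr j) powr (- (?N + \<alpha>)))" using elim(1) j1 by (simp add: r_def)
      also have "\<dots> \<le> D * (t * (r / 2) powr (- (?N + \<alpha>)))"
        using D(1) t r \<alpha> by (intro mult_left_mono powr_mono2' j2) auto
      also have "(r / 2) powr (- (?N + \<alpha>)) = 2 powr (?N + \<alpha>) * r powr (- (?N + \<alpha>))"
        using r by (simp only: powr_minus powr_divide) (simp add: field_simps)
      finally have 1: "H x0 x t \<le> ?E * (t * r powr (- (?N + \<alpha>)))" by (simp add: ac_simps)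
      have "H x0 x t \<le> D * t powr (- (?N / \<alpha>))" by (rule elim(2))
      also have "\<dots> \<le> ?E * t powr (- (?N / \<alpha>))" using DE by (intro mult_right_mono) auto
      finally have 2: "H x0 x t \<le> ?E * t powr (- (?N / \<alpha>))" .
      show ?case using 1 2 by (auto simp: min_def r_def)
    qed
  qed
  moreover have "0 < ?E" using D(1) by simp
  ultimately show "\<exists>C>0. \<forall>x0. \<forall>t>0. AE x in lborel.
      H x0 x t \<le> C * min (t powr (- (?N / \<alpha>))) (t * norm (x - x0) powr (- (?N + \<alpha>)))" by blast
qed

theorem lemma7p8:
  fixes \<mu> :: "'a::euclidean_space measure" and \<alpha> :: real
  assumes "DIM('a) \<ge> 3"
    and "0 < \<alpha>" and "\<alpha> < 2"
    and "symmetric_levy_measure \<mu>"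
  shows "(density_comparable \<alpha> \<mu> \<longrightarrow> heat_kernel_bound \<alpha> \<mu>) \<and>
         (heat_kernel_bound \<alpha> \<mu> \<longrightarrow> green_function_bound \<alpha> \<mu>)"
proof (intro conjI impI)
  assume "density_comparable \<alpha> \<mu>"
  then obtain f c C where f: "stable_like f \<alpha> c C" "\<mu> = density lborel (\<lambda>z. ennreal (f z))"
    using density_comparable_stable_like[OF assms(2-4)] by blast
  from stable_like.heat_kernel_bound_levy[OF f(1)] show "heat_kernel_bound \<alpha> \<mu>" unfolding f(2) .
next
  assume "heat_kernel_bound \<alpha> \<mu>"
  then show "green_function_bound \<alpha> \<mu>"
    using assms by (intro green_bound_of_heat_kernel_bound) auto
qed

end
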